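(* Let $d\in\mathbb N$. There is a $\mathbb K$-algebra isomorphism $$\mathbf U(2,d)\cong\bigoplus_{m\in\mathcal I_d}\operatorname{Mat}_{m+1}(\mathbb K)\ \oplus\bigoplus_{m\in\mathcal I_d,\,m\ge1}\operatorname{Mat}_{2m}(\mathbb K)\ \oplus\bigoplus_{m\in\mathcal I_{d-2}}\operatorname{Mat}_{m+1}(\mathbb K).$$ The three sums correspond, in order, to the simple $\mathbf U(2,d)$-modules $L^+(m,1)$, $L^+(m,01)$ and $L^+(m,0)$ (each matrix block being the Wedderburn component belonging to the corresponding simple module). Moreover, $$\dim_{\mathbb K}\mathbf U(2,d)=(d+1)^3.$$
   Context: $v$ is an indeterminate, $\mathbb K=\mathbb C(v)$, $\mathbb N=\{0,1,2,\dots\}$, $[m]=\frac{v^m-v^{-m}}{v-v^{-1}}$. Define $\mathcal I_d=\{m\in\mathbb N\mid 0\le m\le d,\ m\equiv d \pmod 2\}$, and $\mathcal I_t=\varnothing$ for $t<0$. $\mathbf U^{\mathrm{mir}}_v(2)$ is the unital associative $\mathbb K$-algebra generated by $e,f,k,k^{-1},\ell$ subject to: $kk^{-1}=k^{-1}k=1$; $kek^{-1}=v^2e$, $kfk^{-1}=v^{-2}f$; $ef-fe=(k-k^{-1})/(v-v^{-1})$; $\ell^2=\ell$, $k\ell=\ell k$, $\ell e\ell=\ell e$, $\ell f\ell=f\ell$; $[2]e\ell e=v^{-1}e^2\ell+v\ell e^2$; $[2]f\ell f=v^{-1}\ell f^2+vf^2\ell$. $\mathbf U(2,d)$ is the quotient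 of $\mathbf U^{\mathrm{mir}}_v(2)$ by the two-sided ideal generated by $P_d(k)=\prod_{r=0}^{d}(k-v^{2r-d})$ and $(\ell-1)Q_d(k)$, where $Q_d(k)=\prod_{r=1}^{d}(k-v^{2r-d})$ (so $Q_0=1$). A $\mathbf U(2,d)$-module is the same as a $\mathbf U^{\mathrm{mir}}_v(2)$-module annihilated by this ideal. Modules. For $m\in\mathbb N$ and $\delta\in\{0,1\}$, $L^+(m,\delta)$ is the $\mathbf U^{\mathrm{mir}}_v(2)$-module whose restriction to the subalgebra $U_v(\mathfrak{sl}_2)=\langle e,f,k^{\pm1}\rangle$ is the standard $(m+1)$-dimensional simple module of highest $k$-weight $v^m$ and on which $\ell$ acts as the scalar $\delta$. For $m\ge1$, $L^+(m,01)$ is the $2m$-dimensional simple $\mathbf U^{\mathrm{mir}}_v(2)$-module of Rosso; up to isomorphism it is the unique simple module with a basis $\{u^+_{i,0}\mid 0\le i\le m-1\}\sqcup\{u^+_{j,1}\mid 1\le j\le m\}$ such that $ku^+_{i,\epsilon}=v^{m-2i}u^+_{i,\epsilon}$ and $\ell u^+_{i,\epsilon}=\epsilon u^+_{i,\epsilon}$. *)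

theory Defs
  imports "HOL-Algebra.QuotRing" "Jordan_Normal_Form.VS_Connect" "HOL-Library.Poly_Mapping"
begin

type_synonym K = "complex poly fract"

definition vv :: K where
  "vv = Fract [:0, 1:] 1"

definition qint :: "int \<Rightarrow> K" where
  "qint m = (vv powi m - vv powi (- m)) / (vv - inverse vv)"

text \<open>The index is an integer so that \<open>I_set t\<close> is empty for negative \<open>t\<close>.\<close>

definition I_set :: "int \<Rightarrow> nat set" where
  "I_set t = {m. int m \<le> t \<and> int m mod 2 = t mod 2}"

text \<open>The record \<^typ>\<open>('k, 'a) module\<close> carries both the ring operations and the
  scalar multiplication, so it serves as the record of \<open>'k\<close>-algebras; \<open>'k\<close> itself is
  \<open>class_ring\<close>. HOL-Algebra's own locale \<open>algebra\<close> covers commutative algebras only.\<close>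

definition is_algebra :: "('k::field, 'a) module \<Rightarrow> bool" where
  "is_algebra A \<longleftrightarrow> ring A \<and> vectorspace class_ring A \<and>
     (\<forall>c. \<forall>x\<in>carrier A. \<forall>y\<in>carrier A.
        (c \<odot>\<^bsub>A\<^esub> x) \<otimes>\<^bsub>A\<^esub> y = c \<odot>\<^bsub>A\<^esub> (x \<otimes>\<^bsub>A\<^esub> y) \<and>
        x \<otimes>\<^bsub>A\<^esub> (c \<odot>\<^bsub>A\<^esub> y) = c \<odot>\<^bsub>A\<^esub> (x \<otimes>\<^bsub>A\<^esub> y))"

definition algebra_iso ::
  "('k::field, 'a) module \<Rightarrow> ('k, 'b) module \<Rightarrow> ('a \<Rightarrow> 'b) set" where
  "algebra_iso A B =
     {\<phi> \<in> ring_iso A B. \<forall>c. \<forall>x\<in>carrier A. \<phi> (c \<odot>\<^bsub>A\<^esub> x) = c \<odot>\<^bsub>B\<^esub> \<phi> x}"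

text \<open>Scalars act on cosets through representatives, in the style of \<^const>\<open>rcoset_mult\<close>.\<close>

definition quot_algebra :: "('k, 'a) module \<Rightarrow> 'a set \<Rightarrow> ('k, 'a set) module" where
  "quot_algebra A I = ring.extend (A Quot I)
     (module.fields (\<lambda>c X. \<Union>x\<in>X. I +>\<^bsub>A\<^esub> (c \<odot>\<^bsub>A\<^esub> x)))"

text \<open>For finite \<open>J\<close>, which is the only case used, the direct product is the direct sum.\<close>

definition direct_sum_algebra ::
  "'i set \<Rightarrow> ('i \<Rightarrow> ('k, 'a) module) \<Rightarrow> ('k, 'i \<Rightarrow> 'a) module" where
  "direct_sum_algebra J A =
     \<lparr>carrier = (\<Pi>\<^sub>E i\<in>J. carrier (A i)),
      mult = (\<lambda>x y. \<lambda>i\<in>J. x i \<otimes>\<^bsub>A i\<^esub> y i),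
      one = (\<lambda>i\<in>J. \<one>\<^bsub>A i\<^esub>),
      zero = (\<lambda>i\<in>J. \<zero>\<^bsub>A i\<^esub>),
      add = (\<lambda>x y. \<lambda>i\<in>J. x i \<oplus>\<^bsub>A i\<^esub> y i),
      smult = (\<lambda>c x. \<lambda>i\<in>J. c \<odot>\<^bsub>A i\<^esub> x i)\<rparr>"

abbreviation Mat :: "nat \<Rightarrow> (K, K mat) module" where
  "Mat n \<equiv> module_mat TYPE(K) n n"

text \<open>A left \<open>A\<close>-module is a vector space \<open>V\<close> with an action \<open>act\<close>. The multiplicative
  fields of the record \<open>V\<close> play no role.\<close>

definition is_left_module ::
  "('k::field, 'a) module \<Rightarrow> ('k, 'b) module \<Rightarrow> ('a \<Rightarrow> 'b \<Rightarrow> 'b) \<Rightarrow> bool" where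
  "is_left_module A V act \<longleftrightarrow> vectorspace class_ring V \<and>
     (\<forall>a\<in>carrier A. act a \<in> LinearCombinations.module_hom class_ring V V) \<and>
     (\<forall>w\<in>carrier V. act \<one>\<^bsub>A\<^esub> w = w) \<and>
     (\<forall>a\<in>carrier A. \<forall>b\<in>carrier A. \<forall>w\<in>carrier V.
        act (a \<otimes>\<^bsub>A\<^esub> b) w = act a (act b w) \<and>
        act (a \<oplus>\<^bsub>A\<^esub> b) w = act a w \<oplus>\<^bsub>V\<^esub> act b w) \<and>
     (\<forall>c. \<forall>a\<in>carrier A. \<forall>w\<in>carrier V. act (c \<odot>\<^bsub>A\<^esub> a) w = c \<odot>\<^bsub>V\<^esub> act a w)"

definition is_simple_module ::
  "('k::field, 'a) module \<Rightarrow> ('k, 'b) module \<Rightarrow> ('a \<Rightarrow> 'b \<Rightarrow> 'b) \<Rightarrow> bool" where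
  "is_simple_module A V act \<longleftrightarrow> is_left_module A V act \<and> carrier V \<noteq> {\<zero>\<^bsub>V\<^esub>} \<and>
     (\<forall>W. VectorSpace.subspace class_ring W V \<and> (\<forall>a\<in>carrier A. \<forall>w\<in>W. act a w \<in> W)
        \<longrightarrow> W = {\<zero>\<^bsub>V\<^esub>} \<or> W = carrier V)"

datatype gen = gen_e | gen_f | gen_k | gen_kinv | gen_l

text \<open>Words under concatenation, written additively because \<^typ>\<open>'a \<Rightarrow>\<^sub>0 'b\<close> is a
  convolution algebra over additive monoids of exponents.\<close>

datatype word = Word (letters: "gen list")

instantiation word :: monoid_add
begin

definition zero_word :: word where
  "zero_word = Word []"

definition plus_word :: "word \<Rightarrow> word \<Rightarrow> word" where
  "plus_word x y = Word (letters x @ letters y)"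

instance
  by standard (simp_all add: zero_word_def plus_word_def)

end

type_synonym free = "word \<Rightarrow>\<^sub>0 K"

definition scal :: "K \<Rightarrow> free" where
  "scal c = Poly_Mapping.single 0 c"

definition fgen :: "gen \<Rightarrow> free" where
  "fgen g = Poly_Mapping.single (Word [g]) 1"

abbreviation "Fe \<equiv> fgen gen_e"
abbreviation "Ff \<equiv> fgen gen_f"
abbreviation "Fk \<equiv> fgen gen_k"
abbreviation "Fki \<equiv> fgen gen_kinv"
abbreviation "Fl \<equiv> fgen gen_l"

definition free_algebra :: "(K, free) module" where
  "free_algebra =
     \<lparr>carrier = UNIV, mult = (*), one = 1, zero = 0, add = (+),
      smult = (\<lambda>c x. scal c * x)\<rparr>"

definition mir_relators :: "free set" where
  "mir_relators =
     {Fk * Fki - 1,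
      Fki * Fk - 1,
      Fk * Fe * Fki - scal (vv powi 2) * Fe,
      Fk * Ff * Fki - scal (vv powi (-2)) * Ff,
      (Fe * Ff - Ff * Fe) - scal (1 / (vv - inverse vv)) * (Fk - Fki),
      Fl ^ 2 - Fl,
      Fk * Fl - Fl * Fk,
      Fl * Fe * Fl - Fl * Fe,
      Fl * Ff * Fl - Ff * Fl,
      scal (qint 2) * (Fe * Fl * Fe)
        - (scal (inverse vv) * (Fe ^ 2 * Fl) + scal vv * (Fl * Fe ^ 2)),
      scal (qint 2) * (Ff * Fl * Ff)
        - (scal (inverse vv) * (Fl * Ff ^ 2) + scal vv * (Ff ^ 2 * Fl))}"

definition mir_ideal :: "free set" where
  "mir_ideal = Idl\<^bsub>free_algebra\<^esub> mir_relators"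

definition Umir :: "(K, free set) module" where
  "Umir = quot_algebra free_algebra mir_ideal"

definition mir_class :: "free \<Rightarrow> free set" where
  "mir_class x = mir_ideal +>\<^bsub>free_algebra\<^esub> x"

text \<open>\<^const>\<open>prod_list\<close> because the free algebra is not commutative; the factors commute.\<close>

definition P_poly :: "nat \<Rightarrow> free" where
  "P_poly d = prod_list (map (\<lambda>r. Fk - scal (vv powi (2 * int r - int d))) [0..<Suc d])"

definition Q_poly :: "nat \<Rightarrow> free" where
  "Q_poly d = prod_list (map (\<lambda>r. Fk - scal (vv powi (2 * int r - int d))) [1..<Suc d])"

definition U2_ideal :: "nat \<Rightarrow> free set set" where
  "U2_ideal d = Idl\<^bsub>Umir\<^esub> {mir_class (P_poly d), mir_class ((Fl - 1) * Q_poly d)}"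

definition U2 :: "nat \<Rightarrow> (K, free set set) module" where
  "U2 d = quot_algebra Umir (U2_ideal d)"

definition U2_class :: "nat \<Rightarrow> free set \<Rightarrow> free set set" where
  "U2_class d x = U2_ideal d +>\<^bsub>Umir\<^esub> x"

text \<open>\<open>is_Lplus m \<delta> V act\<close>: the \<open>Umir\<close>-module \<open>(V, act)\<close> is a copy of \<open>L\<^sup>+(m, \<delta>)\<close>, i.e.
  \<open>l\<close> acts as the scalar \<open>\<delta>\<close> and some basis \<open>u 0, \<dots>, u m\<close> satisfies the standard formulas
  for the simple \<open>U_v(sl_2)\<close>-module of highest weight \<open>v^m\<close>. The action of the inverse of \<open>k\<close>
  is forced.\<close>

definition is_Lplus ::
  "nat \<Rightarrow> K \<Rightarrow> (K, 'b) module \<Rightarrow> (free set \<Rightarrow> 'b \<Rightarrow> 'b) \<Rightarrow> bool" where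
  "is_Lplus m \<delta> V act \<longleftrightarrow> is_left_module Umir V act \<and>
     (\<exists>u. inj_on u {0..m} \<and> vectorspace.basis class_ring V (u ` {0..m}) \<and>
       (\<forall>i\<in>{0..m}.
          act (mir_class Fk) (u i) = (vv powi (int m - 2 * int i)) \<odot>\<^bsub>V\<^esub> u i \<and>
          act (mir_class Ff) (u i) =
            (if i = m then \<zero>\<^bsub>V\<^esub> else qint (int i + 1) \<odot>\<^bsub>V\<^esub> u (i + 1)) \<and>
          act (mir_class Fe) (u i) =
            (if i = 0 then \<zero>\<^bsub>V\<^esub> else qint (int m - int i + 1) \<odot>\<^bsub>V\<^esub> u (i - 1)))) \<and>
     (\<forall>w\<in>carrier V. act (mir_class Fl) w = \<delta> \<odot>\<^bsub>V\<^esub> w)"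

text \<open>\<open>is_Lplus01 m V act\<close>, for \<open>m \<ge> 1\<close>: \<open>(V, act)\<close> is a copy of Rosso's module
  \<open>L\<^sup>+(m, 01)\<close>, which is determined up to isomorphism by being simple with such a basis.\<close>

definition Lplus01_index :: "nat \<Rightarrow> (nat \<times> nat) set" where
  "Lplus01_index m = {0..<m} \<times> {0} \<union> {1..m} \<times> {1}"

definition is_Lplus01 ::
  "nat \<Rightarrow> (K, 'b) module \<Rightarrow> (free set \<Rightarrow> 'b \<Rightarrow> 'b) \<Rightarrow> bool" where
  "is_Lplus01 m V act \<longleftrightarrow> is_simple_module Umir V act \<and>
     (\<exists>u. inj_on u (Lplus01_index m) \<and>
       vectorspace.basis class_ring V (u ` Lplus01_index m) \<and>
       (\<forall>(i, \<epsilon>)\<in>Lplus01_index m.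
          act (mir_class Fk) (u (i, \<epsilon>)) = (vv powi (int m - 2 * int i)) \<odot>\<^bsub>V\<^esub> u (i, \<epsilon>) \<and>
          act (mir_class Fl) (u (i, \<epsilon>)) = of_nat \<epsilon> \<odot>\<^bsub>V\<^esub> u (i, \<epsilon>)))"

datatype block = B1 nat | B01 nat | B0 nat

fun block_size :: "block \<Rightarrow> nat" where
  "block_size (B1 m) = m + 1"
| "block_size (B01 m) = 2 * m"
| "block_size (B0 m) = m + 1"

definition blocks :: "nat \<Rightarrow> block set" where
  "blocks d = B1 ` I_set (int d) \<union> B01 ` {m \<in> I_set (int d). m \<ge> 1} \<union> B0 ` I_set (int d - 2)"

text \<open>The action of an algebra on the column space of block \<open>b\<close>, through \<open>\<phi>\<close> and the
  projection onto that block.\<close>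

definition block_act :: "('a \<Rightarrow> block \<Rightarrow> K mat) \<Rightarrow> block \<Rightarrow> 'a \<Rightarrow> K vec \<Rightarrow> K vec" where
  "block_act \<phi> b x w = \<phi> x b *\<^sub>v w"

abbreviation block_space :: "block \<Rightarrow> (K, K vec) module" where
  "block_space b \<equiv> module_vec TYPE(K) (block_size b)"

end

theory Submission
  imports Defs
begin

text \<open>
  The algebra \<open>U(2,d)\<close> is semisimple, and its simple modules can be written down. Both facts are
  proved by hand, with no appeal to a general structure theorem.

  Every simple block has an explicit basis. For \<open>L\<^sup>+(m,\<delta>)\<close> it is the standard one; Rosso's module
  \<open>L\<^sup>+(m,01)\<close> has a basis of vectors \<open>z i\<close> (\<open>0 \<le> i < m\<close>, killed by \<open>l\<close>) and \<open>y i\<close> (\<open>1 \<le> i \<le> m\<close>,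
  fixed by \<open>l\<close>), both of weight \<open>m - 2 * i\<close>, with \<open>e (z i) = v [m-i] z (i-1)\<close>, \<open>f (z i) = [i+1] z
  (i+1) + v^i y (i+1)\<close>, \<open>e (y i) = [m-i+1] y (i-1) + v^(i-m) z (i-1)\<close> and \<open>f (y i) = v^(-1) [i] y
  (i+1)\<close>. Letting the free algebra act on all blocks at once gives the map to the product of matrix
  algebras. It factors through \<open>U(2,d)\<close> because the relations hold on these bases.

  Injectivity. Suppose that an element \<open>x\<close> of \<open>U(2,d)\<close> acts as zero on all blocks. It is enough that
  the left regular module is spanned by vectors lying in families of vectors on which the generators
  act by the formulas of some block, since \<open>x\<close> kills such a family. This is \<open>generated_by_families\<close>.
  The relation \<open>P_d(k) = 0\<close> reduces it to weight vectors, and the usual \<open>sl_2\<close> argument to highest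
  weight vectors \<open>h\<close>. Such an \<open>h\<close> splits along \<open>l\<close>, and the two cubic relations are exactly what
  makes the pieces generate copies of \<open>L\<^sup>+(n,1)\<close>, \<open>L\<^sup>+(n,0)\<close>, \<open>L\<^sup>+(n,01)\<close> or \<open>L\<^sup>+(n+2,01)\<close>: on a
  vector \<open>x\<close> of weight \<open>n\<close> killed by \<open>e\<close> and by \<open>l\<close>, the vector \<open>v^(n-1) e l f x\<close> generates a Rosso
  module, and the rest of \<open>x\<close> a module on which \<open>l\<close> vanishes. The relation \<open>(l - 1) Q_d(k) = 0\<close> is
  what excludes \<open>L\<^sup>+(d,0)\<close>.

  Surjectivity. In each block the joint eigenvalues of \<open>k\<close> and \<open>l\<close> are simple, so the diagonal
  matrix units are polynomials in \<open>k\<close> and \<open>l\<close>; the nonzero entries of \<open>e\<close> and \<open>f\<close> connect all basis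
  vectors and produce the other matrix units of that block. The blocks are separated by a triangular
  system of elements (\<open>separator\<close>), read off from the action on vectors of highest weight.

  The blocks are then simple because all matrices act on them, and the dimension is the sum of the
  squares of the block sizes.
\<close>

section \<open>Quantum integers and linear extension\<close>

text \<open>The indeterminate is not a root of unity, by comparison of degrees; hence quantum integers of
  nonzero index are invertible.\<close>

lemma vv_power: "vv ^ n = Fract (monom 1 n) 1"
proof (induction n)
  case 0 then show ?case by (simp add: One_fract_def)
next
  case (Suc n)
  have "monom (1::complex) (Suc n) = [:0,1:] * monom 1 n" by (simp add: monom_Suc)
  with Suc show ?case by (simp add: vv_def)
qed

lemma vv_nonzero [simp]: "vv \<noteq> 0"
  by (simp add: vv_def Zero_fract_def eq_fract)

lemma vv_power_eq_1: "vv ^ n = 1 \<longleftrightarrow> n = 0"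
proof
  assume "vv ^ n = 1"
  then have "Fract (monom (1::complex) n) 1 = Fract 1 1" by (simp add: vv_power One_fract_def)
  then have "monom (1::complex) n = 1" by (simp add: eq_fract)
  then have "degree (monom (1::complex) n) = 0" by simp
  then show "n = 0" by (simp add: degree_monom_eq)
qed simp

lemma vv_powi_eq_1: "vv powi i = 1 \<longleftrightarrow> i = 0"
proof (cases "i \<ge> 0")
  case True then show ?thesis by (simp add: power_int_def vv_power_eq_1)
next
  case False
  then show ?thesis using vv_power_eq_1[of "nat (-i)"] by (auto simp: power_int_def power_inverse)
qed

lemma vv_powi_eq_iff [simp]: "vv powi i = vv powi j \<longleftrightarrow> i = j"
proof -
  have "vv powi i = vv powi j \<longleftrightarrow> vv powi (i - j) = 1" by (simp add: power_int_diff)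
  then show ?thesis by (simp add: vv_powi_eq_1)
qed

lemma vv_square_neq_1 [simp]: "vv * vv \<noteq> 1"
  using vv_power_eq_1[of 2] by (simp add: power2_eq_square)

lemma vv_neq_inverse [simp]: "vv \<noteq> inverse vv"
  using vv_square_neq_1 by (metis right_inverse vv_nonzero)

lemma qint_eq_0_iff [simp]: "qint i = 0 \<longleftrightarrow> i = 0"
  by (auto simp add: qint_def)

lemma qint_1 [simp]: "qint 1 = 1" by (simp add: qint_def)

text \<open>With these rules and \<open>divide_simps\<close>, an identity between quantum integers becomes a polynomial
  identity in \<open>v\<close> and the powers \<open>v powi a\<close>.\<close>

lemma vv_powi_double: "vv powi (i * 2) = vv powi i * vv powi i" "vv powi (2 * i) = vv powi i * vv powi i"
  by (simp_all add: power_int_add[symmetric])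

lemmas vv_powi_simps = power_int_add power_int_diff power_int_minus vv_powi_double

lemma vv_power4: "vv ^ 4 = vv * vv * vv * vv"
  by (simp add: power4_eq_xxxx)

lemmas qint_identity_simps = algebra_simps power2_eq_square vv_power4

lemma qint_2_mult: "qint 2 * qint a = qint (a + 1) + qint (a - 1)"
  unfolding qint_def by (simp add: vv_powi_simps divide_simps) (simp add: qint_identity_simps)

text \<open>The coefficient identity behind the action of \<open>e f - f e\<close> on divided powers of a highest
  weight vector of weight \<open>n\<close>.\<close>

lemma qint_mult_shift:
  "qint (i + 1) * qint (n - i) = qint i * qint (n - i + 1) + qint (n - 2 * i)"
  unfolding qint_def by (simp add: vv_powi_simps divide_simps) (simp add: qint_identity_simps)

lemma qint_add_1: "vv * qint a + vv powi (- a) = qint (a + 1)"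
  unfolding qint_def by (simp add: vv_powi_simps divide_simps) (simp add: qint_identity_simps)

lemma qint_add_1': "inverse vv * qint a + vv powi a = qint (a + 1)"
  unfolding qint_def by (simp add: vv_powi_simps divide_simps) (simp add: qint_identity_simps)

lemma int_nonneg_induct:
  assumes "\<And>i. i < 0 \<Longrightarrow> P i" "P 0" "\<And>i. i \<ge> 0 \<Longrightarrow> P i \<Longrightarrow> P (i + 1)"
  shows "P (i::int)"
proof (cases "i \<ge> 0")
  case True
  then show ?thesis by (induction i rule: int_ge_induct) (auto intro: assms)
qed (auto intro: assms)

lemma poly_mapping_induct_add [case_names zero single add]:
  fixes x :: "'i \<Rightarrow>\<^sub>0 'c::comm_monoid_add"
  assumes "P 0" "\<And>k c. P (Poly_Mapping.single k c)" "\<And>x y. P x \<Longrightarrow> P y \<Longrightarrow> P (x + y)"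
  shows "P x"
proof -
  have x: "x = (\<Sum>k\<in>Poly_Mapping.keys x. Poly_Mapping.single k (Poly_Mapping.lookup x k))"
    by (rule poly_mapping_eqI)
      (auto simp: lookup_sum lookup_single when_def sum.delta' in_keys_iff)
  have "P (\<Sum>k\<in>A. Poly_Mapping.single k (Poly_Mapping.lookup x k))" if "finite A" for A
    using that by (induction A rule: finite_induct) (auto intro: assms)
  from this[of "Poly_Mapping.keys x"] show ?thesis using x by simp
qed

lemma scal_simps [simp]: "scal 0 = 0" "scal 1 = 1" "scal (a + b) = scal a + scal b"
  "scal (a * b) = scal a * scal b" "scal (- a) = - scal a"
  by (simp_all add: scal_def single_add mult_single single_uminus)

lemma scal_commute: "scal c * x = x * scal c"
  by (induction x rule: poly_mapping_induct_add) (simp_all add: scal_def mult_single algebra_simps)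

definition lin_ext :: "('c \<Rightarrow> 'b \<Rightarrow> 'b) \<Rightarrow> ('i \<Rightarrow> 'b) \<Rightarrow> ('i \<Rightarrow>\<^sub>0 'c::zero) \<Rightarrow> 'b::comm_monoid_add" where
  "lin_ext s b x = (\<Sum>i\<in>Poly_Mapping.keys x. s (Poly_Mapping.lookup x i) (b i))"

lemma lin_ext_0 [simp]: "lin_ext s b 0 = 0"
  by (simp add: lin_ext_def)

lemma (in vector_space) lin_ext_superset:
  "finite A \<Longrightarrow> Poly_Mapping.keys x \<subseteq> A \<Longrightarrow>
    lin_ext scale b x = (\<Sum>i\<in>A. scale (Poly_Mapping.lookup x i) (b i))"
  unfolding lin_ext_def by (rule sum.mono_neutral_left) (auto simp: in_keys_iff)

lemma (in vector_space) lin_ext_add: "lin_ext scale b (x + y) = lin_ext scale b x + lin_ext scale b y"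
proof -
  let ?A = "Poly_Mapping.keys x \<union> Poly_Mapping.keys y"
  have "Poly_Mapping.keys (x + y) \<subseteq> ?A" by (rule Poly_Mapping.keys_add)
  then show ?thesis
    by (simp add: lin_ext_superset[of ?A] lookup_add scale_left_distrib sum.distrib)
qed

lemma (in vector_space) lin_ext_single [simp]:
  "lin_ext scale b (Poly_Mapping.single i c) = scale c (b i)"
  by (simp add: lin_ext_superset[of "{i}"])

section \<open>Modules over the free algebra and highest weight vectors\<close>

text \<open>An action is a function on the whole type rather than on a carrier, so that the relations can
  be used as unconditional rewrite rules.\<close>

locale free_module =
  fixes act :: "free \<Rightarrow> 'b::ab_group_add \<Rightarrow> 'b"
  assumes act_add_left: "act (x + y) w = act x w + act y w"
    and act_add: "act x (w + w') = act x w + act x w'"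
    and act_mult: "act (x * y) w = act x (act y w)"
    and act_one: "act 1 w = w"
begin

definition sm :: "K \<Rightarrow> 'b \<Rightarrow> 'b" (infixr "*\<^sub>s" 75) where "c *\<^sub>s w = act (scal c) w"

lemma act_scal: "act (scal c) w = c *\<^sub>s w" by (simp add: sm_def)

sublocale vector_space sm
  by unfold_locales (simp_all add: sm_def act_add act_add_left act_mult act_one)

lemma act_sm [simp]: "act x (c *\<^sub>s w) = c *\<^sub>s act x w"
  unfolding sm_def by (simp add: act_mult[symmetric] scal_commute)

lemma act_0 [simp]: "act x 0 = 0"
  using act_add[of x 0 0] by simp

lemma act_0_left [simp]: "act 0 w = 0"
  using act_add_left[of 0 0 w] by simp

lemma act_minus [simp]: "act x (- w) = - act x w"
  using act_add[of x w "- w"] by (simp add: eq_neg_iff_add_eq_0 add.commute)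

lemma act_minus_left: "act (- x) w = - act x w"
  using act_add_left[of x "- x" w] by (simp add: eq_neg_iff_add_eq_0 add.commute)

lemma act_diff: "act x (w - w') = act x w - act x w'"
  using act_add[of x w "- w'"] by simp

lemma act_diff_left: "act (x - y) w = act x w - act y w"
  using act_add_left[of x "- y" w] by (simp add: act_minus_left)

lemmas act_simps = act_add_left act_add act_mult act_one act_diff act_diff_left act_minus_left act_scal

abbreviation "e \<equiv> act Fe"
abbreviation "f \<equiv> act Ff"
abbreviation "k \<equiv> act Fk"
abbreviation "ki \<equiv> act Fki"
abbreviation "l \<equiv> act Fl"

definition wt :: "int \<Rightarrow> 'b \<Rightarrow> bool" where "wt \<mu> w \<longleftrightarrow> k w = (vv powi \<mu>) *\<^sub>s w"

lemma wt_0 [simp]: "wt \<mu> 0" by (simp add: wt_def)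
lemma wt_add: "wt \<mu> w \<Longrightarrow> wt \<mu> w' \<Longrightarrow> wt \<mu> (w + w')" by (simp add: wt_def act_add scale_right_distrib)
lemma wt_diff: "wt \<mu> w \<Longrightarrow> wt \<mu> w' \<Longrightarrow> wt \<mu> (w - w')" by (simp add: wt_def act_diff scale_right_diff_distrib)
lemma wt_sm: "wt \<mu> w \<Longrightarrow> wt \<mu> (c *\<^sub>s w)" by (simp add: wt_def scale_left_commute)

text \<open>A family of vectors on which the generators act as on the standard basis of \<open>L\<^sup>+(n,\<delta>)\<close>. The
  index runs over all integers, with zero vectors outside \<open>{0..n}\<close>: the quantum integers vanish at
  the boundary, so that no case distinction is needed at the ends. The vectors need not be linearly
  independent.\<close>

definition Lplus_family :: "int \<Rightarrow> K \<Rightarrow> (int \<Rightarrow> 'b) \<Rightarrow> bool" where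
  "Lplus_family n \<delta> u \<longleftrightarrow> (\<forall>i. (i < 0 \<or> i > n \<longrightarrow> u i = 0) \<and> wt (n - 2 * i) (u i) \<and>
     ki (u i) = (vv powi (2 * i - n)) *\<^sub>s u i \<and>
     l (u i) = \<delta> *\<^sub>s u i \<and>
     f (u i) = qint (i + 1) *\<^sub>s u (i + 1) \<and> e (u i) = qint (n - i + 1) *\<^sub>s u (i - 1))"

text \<open>The same for Rosso's module \<open>L\<^sup>+(n,01)\<close>. The subspace spanned by \<open>z\<close> is the kernel of \<open>l\<close> and
  is stable under \<open>e\<close>; the one spanned by \<open>y\<close> is the image of \<open>l\<close> and is stable under \<open>f\<close>.\<close>

definition Rosso_family :: "int \<Rightarrow> (int \<Rightarrow> 'b) \<Rightarrow> (int \<Rightarrow> 'b) \<Rightarrow> bool" where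
  "Rosso_family n z y \<longleftrightarrow> (\<forall>i. (i < 0 \<or> i \<ge> n \<longrightarrow> z i = 0) \<and> (i < 1 \<or> i > n \<longrightarrow> y i = 0) \<and>
     wt (n - 2 * i) (z i) \<and> wt (n - 2 * i) (y i) \<and> ki (z i) = (vv powi (2 * i - n)) *\<^sub>s z i \<and>
     ki (y i) = (vv powi (2 * i - n)) *\<^sub>s y i \<and> l (z i) = 0 \<and> l (y i) = y i \<and>
     f (z i) = qint (i + 1) *\<^sub>s z (i + 1) + (vv powi i) *\<^sub>s y (i + 1) \<and>
     f (y i) = (inverse vv * qint i) *\<^sub>s y (i + 1) \<and>
     e (z i) = (vv * qint (n - i)) *\<^sub>s z (i - 1) \<and>
     e (y i) = qint (n - i + 1) *\<^sub>s y (i - 1) + (vv powi (i - n)) *\<^sub>s z (i - 1))"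

end

locale mir_module = free_module act for act :: "free \<Rightarrow> 'b::ab_group_add \<Rightarrow> 'b" +
  assumes relator: "r \<in> mir_relators \<Longrightarrow> act r w = 0"
begin

lemma relation: "x - y \<in> mir_relators \<Longrightarrow> act x w = act y w"
  using relator[of "x - y" w] by (simp add: act_diff_left)

lemma ki_k: "ki (k w) = w"
  using relation[of "Fki * Fk" 1 w] by (simp add: mir_relators_def act_simps)

lemma k_e: "k (e w) = (vv powi 2) *\<^sub>s e (k w)"
  using relation[of "Fk * Fe * Fki" "scal (vv powi 2) * Fe" "k w"]
  by (simp add: mir_relators_def act_simps ki_k del: power_int_numeral)

lemma k_f: "k (f w) = (vv powi (-2)) *\<^sub>s f (k w)"
  using relation[of "Fk * Ff * Fki" "scal (vv powi (-2)) * Ff" "k w"]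
  by (simp add: mir_relators_def act_simps ki_k del: power_int_minus)

lemma e_f: "e (f w) = f (e w) + (1 / (vv - inverse vv)) *\<^sub>s (k w - ki w)"
  using relation[of "Fe * Ff - Ff * Fe" "scal (1 / (vv - inverse vv)) * (Fk - Fki)" w]
  by (simp add: mir_relators_def act_simps algebra_simps)

lemma l_l [simp]: "l (l w) = l w"
  using relation[of "Fl ^ 2" "Fl" w] by (simp add: mir_relators_def act_simps power2_eq_square)

lemma k_l: "k (l w) = l (k w)"
  using relation[of "Fk * Fl" "Fl * Fk" w] by (simp add: mir_relators_def act_simps)

lemma l_e_l: "l (e (l w)) = l (e w)"
  using relation[of "Fl * Fe * Fl" "Fl * Fe" w] by (simp add: mir_relators_def act_simps)

lemma l_f_l: "l (f (l w)) = f (l w)"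
  using relation[of "Fl * Ff * Fl" "Ff * Fl" w] by (simp add: mir_relators_def act_simps)

lemma e_l_e: "qint 2 *\<^sub>s e (l (e w)) = inverse vv *\<^sub>s e (e (l w)) + vv *\<^sub>s l (e (e w))"
  using relation[of "scal (qint 2) * (Fe * Fl * Fe)" "scal (inverse vv) * (Fe ^ 2 * Fl) + scal vv *
      (Fl * Fe ^ 2)" w]
  by (simp add: mir_relators_def act_simps power2_eq_square)

lemma f_l_f: "qint 2 *\<^sub>s f (l (f w)) = inverse vv *\<^sub>s l (f (f w)) + vv *\<^sub>s f (f (l w))"
  using relation[of "scal (qint 2) * (Ff * Fl * Ff)" "scal (inverse vv) * (Fl * Ff ^ 2) + scal vv *
      (Ff ^ 2 * Fl)" w]
  by (simp add: mir_relators_def act_simps power2_eq_square)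

lemma wt_e: "wt \<mu> w \<Longrightarrow> wt (\<mu> + 2) (e w)"
  by (simp add: wt_def k_e power_int_add mult.commute)

lemma wt_f: "wt \<mu> w \<Longrightarrow> wt (\<mu> - 2) (f w)"
  by (simp add: wt_def k_f power_int_diff power_int_minus field_simps)

lemma wt_l: "wt \<mu> w \<Longrightarrow> wt \<mu> (l w)"
  by (simp add: wt_def k_l)

lemma wt_ki: assumes "wt \<mu> w" shows "ki w = (vv powi (- \<mu>)) *\<^sub>s w"
proof -
  have "ki (k w) = (vv powi \<mu>) *\<^sub>s ki w" using assms by (simp add: wt_def)
  then have "(vv powi (- \<mu>)) *\<^sub>s w = (vv powi (- \<mu>)) *\<^sub>s (vv powi \<mu>) *\<^sub>s ki w" by (simp only: ki_k)
  then show ?thesis by (simp add: power_int_minus)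
qed

lemma e_f_wt: assumes "wt \<mu> w" shows "e (f w) = f (e w) + qint \<mu> *\<^sub>s w"
  using assms wt_ki[OF assms]
      by (simp add: e_f wt_def qint_def diff_divide_distrib scale_right_diff_distrib
      scale_left_diff_distrib)

lemma f_l_eq: "l w = w \<Longrightarrow> l (f w) = f w" using l_f_l[of w] by simp

text \<open>The divided powers \<open>f^i h / [i]!\<close>.\<close>

primrec dpow_nat :: "'b \<Rightarrow> nat \<Rightarrow> 'b" where
  "dpow_nat h 0 = h"
| "dpow_nat h (Suc i) = inverse (qint (int i + 1)) *\<^sub>s f (dpow_nat h i)"

definition dpow :: "'b \<Rightarrow> int \<Rightarrow> 'b" where "dpow h i = (if i < 0 then 0 else dpow_nat h (nat i))"

lemma dpow_0 [simp]: "dpow h 0 = h" and dpow_neg [simp]: "i < 0 \<Longrightarrow> dpow h i = 0"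
  by (simp_all add: dpow_def)

lemma dpow_f: "f (dpow h i) = qint (i + 1) *\<^sub>s dpow h (i + 1)"
proof (cases "i \<ge> 0")
  case True
  then have "nat (i + 1) = Suc (nat i)" by simp
  with True show ?thesis by (simp add: dpow_def)
next
  case False then show ?thesis by (cases "i = -1") (simp_all)
qed

lemma dpow_Suc: "i \<ge> 0 \<Longrightarrow> dpow h (i + 1) = inverse (qint (i + 1)) *\<^sub>s f (dpow h i)"
  by (simp add: dpow_f)

lemma dpow_wt: assumes "wt n h" shows "wt (n - 2 * i) (dpow h i)"
proof (induction i rule: int_nonneg_induct)
  case (3 i)
  have "wt (n - 2 * i - 2) (dpow h (i + 1))"
    unfolding dpow_Suc[OF 3(1)] by (intro wt_sm wt_f 3)
  then show ?case by (simp add: algebra_simps)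
qed (use assms in simp_all)

lemma dpow_e:
  assumes "wt n h" "e h = 0"
  shows "e (dpow h i) = qint (n - i + 1) *\<^sub>s dpow h (i - 1)"
proof (induction i rule: int_nonneg_induct)
  case (3 i)
  have "e (f (dpow h i)) = (qint i * qint (n - i + 1) + qint (n - 2 * i)) *\<^sub>s dpow h i"
    unfolding e_f_wt[OF dpow_wt[OF assms(1)]] using 3 by (simp add: dpow_f scale_left_distrib mult.commute)
  also have "\<dots> = (qint (i + 1) * qint (n - i)) *\<^sub>s dpow h i" by (simp only: qint_mult_shift)
  finally have "e (dpow h (i + 1)) = inverse (qint (i + 1)) *\<^sub>s (qint (i + 1) * qint (n - i)) *\<^sub>s dpow h i"
    by (simp only: dpow_Suc[OF 3(1)] act_sm)
  then show ?case using 3(1) by simp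
qed (use assms in simp_all)

lemma Lplus_family_1:
  assumes h: "wt n h" "e h = 0" "l h = h" and z: "\<And>i. i > n \<Longrightarrow> dpow h i = 0"
  shows "Lplus_family n 1 (dpow h)"
proof -
  have "l (dpow h i) = dpow h i" for i
    by (induction i rule: int_nonneg_induct) (simp_all add: h dpow_Suc f_l_eq)
  with h z show ?thesis by (simp add: Lplus_family_def dpow_wt wt_ki[OF dpow_wt[OF h(1)]] dpow_f dpow_e)
qed

text \<open>By the cubic relation for \<open>f\<close>, if \<open>l\<close> kills two consecutive vectors \<open>f^i h\<close> and \<open>f^(i+1) h\<close>
  then it kills the next one.\<close>

lemma f_l_f_0: assumes "l w = 0" "l (f w) = 0" shows "l (f (f w)) = 0"
  using f_l_f[of w] assms by simp

lemma Lplus_family_0: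
  assumes h: "wt n h" "e h = 0" "l h = 0" "l (f h) = 0" and z: "\<And>i. i > n \<Longrightarrow> dpow h i = 0"
  shows "Lplus_family n 0 (dpow h)"
proof -
  have "l (dpow h i) = 0 \<and> l (dpow h (i + 1)) = 0" for i
  proof (induction i rule: int_nonneg_induct)
    case (1 i) then show ?case by (cases "i = -1") (simp_all add: h)
  next
    case 2 then show ?case using dpow_Suc[of 0 h] by (simp add: h)
  next
    case (3 i)
    then have "l (f (dpow h i)) = 0" by (simp add: dpow_f)
    then have "l (f (dpow h (i + 1))) = 0" using 3 f_l_f_0[of "dpow h i"] by (simp add: dpow_Suc)
    then show ?case using 3 dpow_Suc[of "i + 1" h] by simp
  qed
  with h z show ?thesis by (simp add: Lplus_family_def dpow_wt wt_ki[OF dpow_wt[OF h(1)]] dpow_f dpow_e)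
qed

text \<open>A highest weight vector \<open>h\<close> killed by \<open>l\<close> generates a copy of \<open>L\<^sup>+(n,01)\<close> as soon as \<open>e l f h\<close>
  is the right multiple of \<open>h\<close>: the vectors \<open>z\<close> and \<open>y\<close> are the components of the divided powers of
  \<open>h\<close> along the idempotent \<open>l\<close>.\<close>

context
  fixes h :: 'b and n :: int
  assumes h: "wt n h" "e h = 0" "l h = 0" and elf: "e (l (f h)) = (vv powi (1 - n)) *\<^sub>s h"
    and n: "n \<ge> 1" and z: "\<And>i. i > n \<Longrightarrow> dpow h i = 0"
begin

text \<open>Induction on \<open>i\<close>: the cubic relation for \<open>f\<close>, applied to \<open>dpow h i\<close>, expresses \<open>f l f\<close> through
  \<open>l f\<^sup>2\<close> and \<open>f (f l)\<close>, and the last term is known by induction. The coefficient \<open>[2] [i+1] - [i]\<close>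
  that has to be inverted is \<open>[i+2]\<close>.\<close>

lemma f_l_dpow: "f (l (dpow h i)) = (inverse vv * qint i) *\<^sub>s l (dpow h (i + 1))"
proof (induction i rule: int_nonneg_induct)
  case (1 i) then show ?case by (cases "i = -1") (simp_all add: h)
next
  case 2 then show ?case by (simp add: h)
next
  case (3 i)
  have nz: "qint (i + 1) \<noteq> 0" "qint (i + 2) \<noteq> 0" using 3 by auto
  have "(qint 2 * qint (i + 1)) *\<^sub>s f (l (dpow h (i + 1))) =
      (inverse vv * qint (i + 1) * qint (i + 2)) *\<^sub>s l (dpow h (i + 2)) + qint i *\<^sub>s f (l (dpow h (i + 1)))"
    using f_l_f[of "dpow h i"] by (simp add: dpow_f 3 add.assoc ac_simps)
  then have "(qint 2 * qint (i + 1) - qint i) *\<^sub>s f (l (dpow h (i + 1))) =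
      (inverse vv * qint (i + 1) * qint (i + 2)) *\<^sub>s l (dpow h (i + 2))"
    by (simp add: scale_left_diff_distrib)
  also have "qint 2 * qint (i + 1) - qint i = qint (i + 2)" using qint_2_mult[of "i + 1"]
      by (simp add: ac_simps)
  also have "(inverse vv * qint (i + 1) * qint (i + 2)) *\<^sub>s l (dpow h (i + 2)) =
      qint (i + 2) *\<^sub>s (inverse vv * qint (i + 1)) *\<^sub>s l (dpow h (i + 2))" by (simp add: mult.commute)
  finally have "f (l (dpow h (i + 1))) = (inverse vv * qint (i + 1)) *\<^sub>s l (dpow h (i + 2))"
    using nz(2) by (simp only: scale_left_imp_eq scale_cancel_left) simp
  then show ?case by (simp add: ac_simps)
qed

text \<open>The start \<open>i = 1\<close> is the hypothesis on \<open>e l f h\<close>. Since \<open>l (dpow h (i+1))\<close> is a multiple of \<open>f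
  (l (dpow h i))\<close> by \<open>f_l_dpow\<close>, the commutator of \<open>e\<close> and \<open>f\<close> gives the induction step.\<close>

lemma e_l_dpow: "e (l (dpow h i)) = qint (n - i + 1) *\<^sub>s l (dpow h (i - 1)) +
    (vv powi (i - n)) *\<^sub>s (dpow h (i - 1) - l (dpow h (i - 1)))"
proof -
  have "e (l (dpow h i)) = qint (n - i + 1) *\<^sub>s l (dpow h (i - 1)) +
      (vv powi (i - n)) *\<^sub>s (dpow h (i - 1) - l (dpow h (i - 1)))" if "i \<ge> 1" for i
    using that
  proof (induction i rule: int_ge_induct)
    case base
    show ?case using elf dpow_Suc[of 0 h] by (simp add: h)
  next
    case (step i)
    let ?y = "l (dpow h i)" and ?g = "dpow h i"
    have nz: "qint i \<noteq> 0" "inverse vv * qint i \<noteq> 0" using step by auto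
    have fg: "f (dpow h (i - 1)) = qint i *\<^sub>s ?g" using dpow_f[of h "i - 1"] by simp
    have fl: "f (l (dpow h (i - 1))) = (inverse vv * qint (i - 1)) *\<^sub>s ?y" using f_l_dpow[of "i - 1"]
        by simp
    let ?c = "qint (n - i + 1) * (inverse vv * qint (i - 1)) + qint (n - 2 * i) - vv powi (i - n) *
        (inverse vv * qint (i - 1))"
    have "(inverse vv * qint i) *\<^sub>s e (l (dpow h (i + 1))) = e (f ?y)" by (simp add: f_l_dpow)
    also have "\<dots> = f (e ?y) + qint (n - 2 * i) *\<^sub>s ?y" by (rule e_f_wt) (intro wt_l dpow_wt h)
    also have "\<dots> = ?c *\<^sub>s ?y + (vv powi (i - n) * qint i) *\<^sub>s ?g"
      by (simp add: step act_add act_diff fg fl algebra_simps)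
    also have "?c = (inverse vv * qint i) * (qint (n - i) - vv powi (i + 1 - n))"
      unfolding qint_def by (simp add: vv_powi_simps divide_simps) (simp add: qint_identity_simps)
    also have "vv powi (i - n) * qint i = (inverse vv * qint i) * vv powi (i + 1 - n)"
      by (simp add: vv_powi_simps field_simps)
    finally have "(inverse vv * qint i) *\<^sub>s e (l (dpow h (i + 1))) = (inverse vv * qint i) *\<^sub>s
        ((qint (n - i) - vv powi (i + 1 - n)) *\<^sub>s ?y + (vv powi (i + 1 - n)) *\<^sub>s ?g)"
      by (simp only: scale_right_distrib scale_scale)
    then have "e (l (dpow h (i + 1))) = (qint (n - i) - vv powi (i + 1 - n)) *\<^sub>s ?y +
        (vv powi (i + 1 - n)) *\<^sub>s ?g"
      using nz(2) by (simp only: scale_cancel_left) simp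
    then show ?case by (simp add: algebra_simps)
  qed
  then show ?thesis by (cases "i \<ge> 1"; cases "i = 0") (simp_all add: h)
qed

text \<open>The bottom vector of \<open>L\<^sup>+(n,01)\<close> is fixed by \<open>l\<close>: the other component is killed by \<open>e\<close> and
  \<open>f\<close>, which is impossible for a nonzero vector of nonzero weight \<open>- n\<close>.\<close>

lemma l_dpow_top: "l (dpow h n) = dpow h n"
proof -
  let ?w = "dpow h n - l (dpow h n)"
  have "wt (n - 2 * n) ?w" by (intro wt_diff wt_l dpow_wt h)
  then have wt: "wt (- n) ?w" by simp
  have "e ?w = 0" using dpow_e[OF h(1,2), of n] e_l_dpow[of n] by (simp add: act_diff)
  moreover have "f ?w = 0" using dpow_f[of h n] f_l_dpow[of n] z by (simp add: act_diff)
  ultimately have "qint (- n) *\<^sub>s ?w = 0" using e_f_wt[OF wt] by simp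
  then show ?thesis using n by simp
qed

lemma Rosso_family_dpow: "Rosso_family n (\<lambda>i. dpow h i - l (dpow h i)) (\<lambda>i. l (dpow h i))"
proof -
  have zero: "dpow h i = 0 \<or> i = n" if "i < 0 \<or> i \<ge> n" for i using that z[of i] by auto
  have fz: "f (dpow h i - l (dpow h i)) = qint (i + 1) *\<^sub>s (dpow h (i + 1) - l (dpow h (i + 1))) +
      (vv powi i) *\<^sub>s l (dpow h (i + 1))" for i
  proof -
    have "f (dpow h i - l (dpow h i)) = qint (i + 1) *\<^sub>s dpow h (i + 1) - (inverse vv * qint i) *\<^sub>s l
        (dpow h (i + 1))"
      by (simp add: act_diff dpow_f f_l_dpow)
    also have "inverse vv * qint i = qint (i + 1) - vv powi i" using qint_add_1'[of i]
        by (simp add: algebra_simps)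
    finally show ?thesis by (simp add: algebra_simps)
  qed
  have ez: "e (dpow h i - l (dpow h i)) = (vv * qint (n - i)) *\<^sub>s (dpow h (i - 1) - l (dpow h (i - 1)))"
      for i
  proof -
    have "e (dpow h i - l (dpow h i)) = (qint (n - i + 1) - vv powi (i - n)) *\<^sub>s (dpow h (i - 1) - l
        (dpow h (i - 1)))"
      by (simp add: act_diff dpow_e[OF h(1,2)] e_l_dpow algebra_simps)
    also have "qint (n - i + 1) - vv powi (i - n) = vv * qint (n - i)" using qint_add_1[of "n - i"]
        by (simp add: algebra_simps)
    finally show ?thesis .
  qed
  have y: "l (dpow h i) = 0" if "i < 1 \<or> i > n" for i
    using that z[of i] h by (cases "i = 0") auto
  have zz: "dpow h i - l (dpow h i) = 0" if "i < 0 \<or> i \<ge> n" for i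
    using zero[OF that] l_dpow_top by auto
  have wt: "wt (n - 2 * i) (l (dpow h i))" "wt (n - 2 * i) (dpow h i - l (dpow h i))" for i
    by (intro wt_diff wt_l dpow_wt h)+
  have ki: "ki (l (dpow h i)) = (vv powi (2 * i - n)) *\<^sub>s l (dpow h i)"
    "ki (dpow h i - l (dpow h i)) = (vv powi (2 * i - n)) *\<^sub>s (dpow h i - l (dpow h i))" for i
    using wt_ki[OF wt(1), of i] wt_ki[OF wt(2), of i] by simp_all
  show ?thesis
    unfolding Rosso_family_def
    by (intro allI conjI impI wt ki fz ez f_l_dpow e_l_dpow y zz; simp add: act_diff)
qed

end

end

section \<open>Generation of bounded modules by the standard families\<close>

lemma prod_list_nonzero: "(\<And>x. x \<in> set xs \<Longrightarrow> x \<noteq> 0) \<Longrightarrow> prod_list xs \<noteq> (0::K)"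
  by (auto simp: prod_list_zero_iff)

text \<open>The exponents of the roots of \<open>P_d\<close>.\<close>

definition weights :: "nat \<Rightarrow> int set" where "weights d = (\<lambda>r. 2 * int r - int d) ` {..d}"

lemma weights_iff: "\<mu> \<in> weights d \<longleftrightarrow> - int d \<le> \<mu> \<and> \<mu> \<le> int d \<and> even (\<mu> + int d)"
proof
  assume *: "- int d \<le> \<mu> \<and> \<mu> \<le> int d \<and> even (\<mu> + int d)"
  then obtain r where r: "\<mu> + int d = 2 * r" by (meson evenE)
  then have "\<mu> = 2 * int (nat r) - int d" "nat r \<le> d" using * by auto
  then show "\<mu> \<in> weights d" unfolding weights_def by blast
qed (auto simp: weights_def)

abbreviation kfac :: "int \<Rightarrow> free" where "kfac \<mu> \<equiv> Fk - scal (vv powi \<mu>)"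

definition kprod :: "int list \<Rightarrow> free" where "kprod \<mu>s = prod_list (map kfac \<mu>s)"

lemma kprod_simps [simp]: "kprod [] = 1" "kprod (\<mu> # \<mu>s) = kfac \<mu> * kprod \<mu>s"
  by (simp_all add: kprod_def)

lemma P_poly_kprod: "P_poly d = kprod (map (\<lambda>r. 2 * int r - int d) [0..<Suc d])"
  and Q_poly_kprod: "Q_poly d = kprod (map (\<lambda>r. 2 * int r - int d) [1..<Suc d])"
  by (simp_all only: P_poly_def Q_poly_def kprod_def map_map o_def)

lemma kfac_commute: "kfac a * kfac b = kfac b * kfac a"
  by (simp add: algebra_simps scal_commute[of "vv powi a" Fk] scal_commute[of "vv powi b" Fk]
      scal_commute[of "vv powi a" "scal (vv powi b)"])

lemma kprod_commute: "kprod \<mu>s * kfac a = kfac a * kprod \<mu>s"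
  by (induction \<mu>s) (simp_all add: mult.assoc, simp add: kfac_commute flip: mult.assoc)

context free_module begin

lemma act_kprod:
  "wt \<mu> w \<Longrightarrow> act (kprod \<mu>s) w = prod_list (map (\<lambda>\<nu>. vv powi \<mu> - vv powi \<nu>) \<mu>s) *\<^sub>s w"
  by (induction \<mu>s) (simp_all add: act_simps wt_def algebra_simps)

end

text \<open>The relations of \<open>U(2,d)\<close> are imposed only on the submodule \<open>S\<close>. The intended module is the
  product of all \<open>U(2,d)\<close>, which can be a type of its own because it does not depend on \<open>d\<close>; \<open>S\<close> is
  then one of its factors.\<close>

locale bounded_mir_module = mir_module act for act :: "free \<Rightarrow> 'b::ab_group_add \<Rightarrow> 'b" +
  fixes d :: nat and S :: "'b set"
  assumes S_0 [simp]: "0 \<in> S"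
    and S_add: "w \<in> S \<Longrightarrow> w' \<in> S \<Longrightarrow> w + w' \<in> S"
    and S_act [simp]: "w \<in> S \<Longrightarrow> act x w \<in> S"
    and P_poly_act: "w \<in> S \<Longrightarrow> act (P_poly d) w = 0"
    and Q_poly_act: "w \<in> S \<Longrightarrow> act ((Fl - 1) * Q_poly d) w = 0"
begin

definition submod :: "'b set \<Rightarrow> bool" where
  "submod N \<longleftrightarrow> N \<subseteq> S \<and> 0 \<in> N \<and> (\<forall>a\<in>N. \<forall>b\<in>N. a + b \<in> N) \<and> (\<forall>x. \<forall>a\<in>N. act x a \<in> N)"

lemma submod_S: "submod S" by (simp add: submod_def S_add)
lemma submod_0: "submod {0}" by (simp add: submod_def)

lemma submod_closed:
  assumes "submod N"
  shows "0 \<in> N" "a \<in> N \<Longrightarrow> b \<in> N \<Longrightarrow> a + b \<in> N" "a \<in> N \<Longrightarrow> act x a \<in> N"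
    "a \<in> N \<Longrightarrow> c *\<^sub>s a \<in> N" "a \<in> N \<Longrightarrow> b \<in> N \<Longrightarrow> a - b \<in> N"
proof -
  show "0 \<in> N" "a \<in> N \<Longrightarrow> b \<in> N \<Longrightarrow> a + b \<in> N" "a \<in> N \<Longrightarrow> act x a \<in> N"
    using assms by (auto simp: submod_def)
  show c: "a \<in> N \<Longrightarrow> c *\<^sub>s a \<in> N" for a c
    using assms by (auto simp: submod_def simp flip: act_scal)
  show "a \<in> N \<Longrightarrow> b \<in> N \<Longrightarrow> a - b \<in> N"
    using assms c[of b "-1"] unfolding submod_def by (metis diff_conv_add_uminus scale_minus_left scale_one)
qed

lemma submod_cancel: assumes "submod N" "c *\<^sub>s a \<in> N" "c \<noteq> 0" shows "a \<in> N"
  using submod_closed(4)[OF assms(1,2), of "inverse c"] assms(3) by simp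

lemma submod_cancel_diff: assumes "submod N" "a \<in> N" "a - b \<in> N" shows "b \<in> N"
  using submod_closed(5)[OF assms] by simp

lemmas S_closed = submod_closed[OF submod_S]

lemma dpow_in: "submod N \<Longrightarrow> h \<in> N \<Longrightarrow> dpow h i \<in> N"
  by (induction i rule: int_nonneg_induct) (simp_all add: submod_closed dpow_Suc)

text \<open>Because \<open>P_d(k)\<close> acts on a vector of weight \<open>\<mu>\<close> as the scalar \<open>P_d(v^\<mu>)\<close>.\<close>

lemma wt_outside: assumes "w \<in> S" "wt \<mu> w" "\<mu> \<notin> weights d" shows "w = 0"
proof -
  have "prod_list (map (\<lambda>\<nu>. vv powi \<mu> - vv powi \<nu>) (map (\<lambda>r. 2 * int r - int d) [0..<Suc d])) \<noteq> 0"
    using assms(3) by (intro prod_list_nonzero) (auto simp: weights_def simp del: upt_Suc)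
  then show ?thesis using P_poly_act[OF assms(1)] act_kprod[OF assms(2)]
      by (simp only: P_poly_kprod scale_eq_0_iff) simp
qed

lemma wt_fpow: "wt \<mu> w \<Longrightarrow> wt (\<mu> - 2 * int i) (act (Ff ^ i) w)"
proof (induction i)
  case (Suc i) then show ?case using wt_f[of "\<mu> - 2 * int i" "act (Ff ^ i) w"]
      by (simp add: act_mult algebra_simps)
qed (simp add: act_one)

lemma wt_epow: "wt \<mu> w \<Longrightarrow> wt (\<mu> + 2 * int i) (act (Fe ^ i) w)"
proof (induction i)
  case (Suc i) then show ?case using wt_e[of "\<mu> + 2 * int i" "act (Fe ^ i) w"]
      by (simp add: act_mult algebra_simps)
qed (simp add: act_one)

lemma e_fpow: assumes "wt \<mu> w"
  shows "e (act (Ff ^ Suc i) w) = act (Ff ^ Suc i) (e w) + (qint (int i + 1) * qint (\<mu> - int i)) *\<^sub>s act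
      (Ff ^ i) w"
proof (induction i)
  case 0 then show ?case using e_f_wt[OF assms] by (simp add: act_one)
next
  case (Suc i)
  have "qint (int i + 1) * qint (\<mu> - int i) + qint (\<mu> - 2 * (int i + 1)) = qint (int i + 2) * qint
      (\<mu> - int i - 1)"
    using qint_mult_shift[of "int i + 1" "\<mu>"] by (simp add: algebra_simps)
  note coeff = this
  have "e (act (Ff ^ Suc (Suc i)) w) = e (f (act (Ff ^ Suc i) w))" by (simp add: act_mult)
  also have "\<dots> = f (e (act (Ff ^ Suc i) w)) + qint (\<mu> - 2 * int (Suc i)) *\<^sub>s act (Ff ^ Suc i) w"
    by (rule e_f_wt[OF wt_fpow[OF assms]])
  also have "\<dots> = act (Ff ^ Suc (Suc i)) (e w) +
      (qint (int i + 1) * qint (\<mu> - int i) + qint (\<mu> - 2 * (int i + 1))) *\<^sub>s act (Ff ^ Suc i) w"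
    unfolding Suc scale_left_distrib by (simp add: act_mult act_add ac_simps)
  finally show ?case unfolding coeff by (simp add: ac_simps diff_diff_eq)
qed

text \<open>Modulo \<open>N\<close> the vector \<open>w\<close> is a highest weight vector of negative weight. Some power of \<open>f\<close>
  kills \<open>w\<close>, because its weight leaves the allowed range, and \<open>e\<close> leads back from \<open>f^(i+1) w\<close> to a
  multiple of \<open>f^i w\<close> modulo \<open>N\<close>, where the factor \<open>[i+1] [\<mu>-i]\<close> is nonzero for negative \<open>\<mu>\<close>.\<close>

lemma negative_weight:
  assumes N: "submod N" and w: "w \<in> S" "wt \<mu> w" "\<mu> < 0" and ew: "e w \<in> N"
  shows "w \<in> N"
proof -
  define m where "m = nat (\<mu> + int d + 1)"
  have "act (Ff ^ m) w = 0"
    using w by (intro wt_outside[OF _ wt_fpow[OF w(2), of m]]) (auto simp: weights_iff m_def)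
  then have m: "act (Ff ^ m) w \<in> N" using N by (simp add: submod_closed)
  have "act (Ff ^ 0) w \<in> N"
    using le0[of m]
  proof (induction rule: inc_induct)
    case base show ?case by (rule m)
  next
    case (step i)
    have "e (act (Ff ^ Suc i) w) - act (Ff ^ Suc i) (e w) \<in> N"
      by (intro submod_closed[OF N] step ew)
    then have "(qint (int i + 1) * qint (\<mu> - int i)) *\<^sub>s act (Ff ^ i) w \<in> N"
      unfolding e_fpow[OF w(2)] by simp
    then show ?case by (rule submod_cancel[OF N]) (use w(3) in auto)
  qed
  then show ?thesis by (simp add: act_one)
qed

text \<open>The vector \<open>dpow h (n+1)\<close> is again killed by \<open>e\<close>, and its weight \<open>- n - 2\<close> is negative.\<close>

lemma dpow_top: assumes h: "h \<in> S" "wt n h" "e h = 0" "n \<ge> 0" and "i > n" shows "dpow h i = 0"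
proof -
  from assms(5) have "n + 1 \<le> i" by simp
  then show ?thesis
  proof (induction i rule: int_ge_induct)
    case base
    have "wt (n - 2 * (n + 1)) (dpow h (n + 1))" by (rule dpow_wt[OF h(2)])
    moreover have "e (dpow h (n + 1)) = 0" using dpow_e[OF h(2,3), of "n + 1"] by simp
    moreover have "dpow h (n + 1) \<in> S" by (rule dpow_in[OF submod_S h(1)])
    ultimately show ?case using negative_weight[OF submod_0, of "dpow h (n + 1)"] h(4) by simp
  next
    case (step i) then show ?case using h(4) by (simp add: dpow_Suc)
  qed
qed

text \<open>The operator \<open>e\<close> leads from \<open>dpow h i\<close> back to \<open>h\<close> with nonzero coefficients \<open>[n-i+1]\<close>.\<close>

lemma dpow_descend: assumes h: "wt n h" "e h = 0" and "0 \<le> i" "i \<le> n" "dpow h i = 0" shows "h = 0"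
  using assms(3-)
proof (induction i rule: int_ge_induct)
  case (step i)
  then have "qint (n - i) *\<^sub>s dpow h i = 0" using dpow_e[OF h, of "i + 1"] by simp
  then show ?case using step by simp
qed simp

lemma epow_dpow:
  assumes h: "wt n h" "e h = 0" and "int i \<le> n"
  shows "\<exists>c. c \<noteq> 0 \<and> act (Fe ^ i) (dpow h (int i)) = c *\<^sub>s h"
  using assms(3)
proof (induction i)
  case 0 then show ?case by (intro exI[of _ 1]) (simp add: act_one)
next
  case (Suc i)
  then obtain c where c: "c \<noteq> 0" "act (Fe ^ i) (dpow h (int i)) = c *\<^sub>s h" by auto
  have "act (Fe ^ Suc i) (dpow h (int (Suc i))) = act (Fe ^ i) (e (dpow h (int (Suc i))))"
    by (simp only: power_Suc2 act_mult)
  also have "\<dots> = (qint (n - int i) * c) *\<^sub>s h" using c by (simp add: dpow_e[OF h])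
  finally show ?case using c Suc by (intro exI[of _ "qint (n - int i) * c"]) auto
qed

text \<open>The remaining lemmas show that a submodule \<open>N\<close> is all of \<open>S\<close> if it contains the top vector of
  each family belonging to a block of \<open>U(2,d)\<close>.\<close>

context
  fixes N assumes N: "submod N"
    and N_L1: "\<And>n u. 0 \<le> n \<Longrightarrow> n \<in> weights d \<Longrightarrow> range u \<subseteq> S \<Longrightarrow> Lplus_family n 1 u \<Longrightarrow> u 0 \<in> N"
    and N_L0: "\<And>n u. 0 \<le> n \<Longrightarrow> n \<in> weights d \<Longrightarrow> n \<noteq> int d \<Longrightarrow> range u \<subseteq> S \<Longrightarrow> Lplus_family n 0 u \<Longrightarrow> u 0 \<in> N"
    and N_01: "\<And>n z y. 1 \<le> n \<Longrightarrow> n \<in> weights d \<Longrightarrow> range z \<subseteq> S \<Longrightarrow> range y \<subseteq> S \<Longrightarrow> Rosso_family n z y \<Longrightarrow> z 0 \<in> N"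
begin

text \<open>Highest weight vectors of negative weight vanish, and so do weight vectors outside the range.\<close>

lemma highest_weight_reduce:
  assumes "h \<in> S" "wt n h" "e h = 0" "h \<noteq> 0 \<Longrightarrow> 0 \<le> n \<Longrightarrow> n \<in> weights d \<Longrightarrow> h \<in> N"
  shows "h \<in> N"
proof (cases "h = 0 \<or> n < 0")
  case True then show ?thesis using negative_weight[OF N assms(1,2)] assms(3) submod_closed(1)[OF N] by auto
next
  case False then show ?thesis using assms wt_outside by force
qed

lemma highest_weight_L1: assumes h: "h \<in> S" "wt n h" "e h = 0" "l h = h" shows "h \<in> N"
proof (rule highest_weight_reduce[OF h(1-3)])
  assume n: "0 \<le> n" "n \<in> weights d"
  have "Lplus_family n 1 (dpow h)" using h n by (intro Lplus_family_1) (auto intro: dpow_top)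
  then show "h \<in> N" using N_L1[OF n, of "dpow h"] dpow_in[OF submod_S h(1)] by auto
qed

text \<open>If \<open>h\<close> and \<open>f h\<close> are killed by \<open>l\<close>, then so is the whole string below \<open>h\<close>. The highest weight
  \<open>d\<close> does not occur: the bottom of the string would have weight \<open>- d\<close>, the one root of \<open>P_d\<close> that
  is not a root of \<open>Q_d\<close>, so that \<open>(l - 1) Q_d(k) = 0\<close> forces it to be fixed by \<open>l\<close>.\<close>

lemma highest_weight_L0: assumes h: "h \<in> S" "wt n h" "e h = 0" "l h = 0" "l (f h) = 0" shows "h \<in> N"
proof (rule highest_weight_reduce[OF h(1-3)])
  assume n: "0 \<le> n" "n \<in> weights d" and "h \<noteq> 0"
  have fam: "Lplus_family n 0 (dpow h)" using h n by (intro Lplus_family_0) (auto intro: dpow_top)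
  have "n \<noteq> int d"
  proof
    assume nd: "n = int d"
    let ?w = "dpow h n"
    have "wt (- int d) ?w" using dpow_wt[OF h(2), of n] nd by simp
    note Q = act_kprod[OF this, of "map (\<lambda>r. 2 * int r - int d) [1..<Suc d]", folded Q_poly_kprod]
    have "prod_list (map (\<lambda>\<nu>. vv powi (- int d) - vv powi \<nu>) (map (\<lambda>r. 2 * int r - int d) [1..<Suc d]))
        *\<^sub>s ?w = 0"
      using Q_poly_act[OF dpow_in[OF submod_S h(1)], of n] fam
          by (simp only: act_mult Q) (simp add: Lplus_family_def act_diff_left act_one)
    moreover have "prod_list (map (\<lambda>\<nu>. vv powi (- int d) - vv powi \<nu>) (map (\<lambda>r. 2 * int r - int d)
        [1..<Suc d])) \<noteq> 0"
      by (intro prod_list_nonzero) (auto simp del: upt_Suc)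
    ultimately have "?w = 0" by (simp only: scale_eq_0_iff) simp
    then show False using dpow_descend[OF h(2,3) n(1)] \<open>h \<noteq> 0\<close> by simp
  qed
  then show "h \<in> N" using N_L0[OF n _ _ fam] dpow_in[OF submod_S h(1)] by auto
qed

lemma highest_weight_01:
  assumes h: "h \<in> S" "wt n h" "e h = 0" "l h = 0" "e (l (f h)) = (vv powi (1 - n)) *\<^sub>s h" "n \<ge> 1"
  shows "h \<in> N"
proof (rule highest_weight_reduce[OF h(1-3)])
  assume n: "0 \<le> n" "n \<in> weights d"
  have "Rosso_family n (\<lambda>i. dpow h i - l (dpow h i)) (\<lambda>i. l (dpow h i))"
    using h n by (intro Rosso_family_dpow) (auto intro: dpow_top)
  from N_01[OF h(6) n(2) _ _ this] show "h \<in> N" using dpow_in[OF submod_S h(1)] h(4)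
      by (auto intro: S_closed)
qed

text \<open>A highest weight vector \<open>h\<close> in the kernel of \<open>l\<close> is the sum of \<open>x = v^(n-1) e l f h\<close>, which
  generates a Rosso module, and of \<open>h - x\<close>, for which \<open>l f (h - x) = 0\<close>. For \<open>n = 0\<close> the vector \<open>f
  h\<close> vanishes and there is nothing to split off.\<close>

lemma highest_weight_V0: assumes h: "h \<in> S" "wt n h" "e h = 0" "l h = 0" shows "h \<in> N"
proof (rule highest_weight_reduce[OF h(1-3)])
  assume n: "0 \<le> n" "n \<in> weights d"
  have top: "dpow h i = 0" if "i > n" for i using dpow_top[OF h(1-3) n(1) that] .
  show "h \<in> N"
  proof (cases "n = 0")
    case True
    then have "f h = 0" using dpow_f[of h 0] top[of 1] by simp
    then show ?thesis using highest_weight_L0[OF h] by simp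
  next
    case False
    then have n1: "n \<ge> 1" using n by simp
    let ?y = "l (f h)"
    have wty: "wt (n - 2) ?y" by (intro wt_l wt_f h)
    have ef: "e (f h) = qint n *\<^sub>s h" using e_f_wt[OF h(2)] h by simp
    have eff: "e (f (f h)) = (qint 2 * qint (n - 1)) *\<^sub>s f h"
      using e_f_wt[OF wt_f[OF h(2)]] unfolding qint_2_mult[of "n - 1"] by (simp add: ef scale_left_distrib)
    have 1: "e (e ?y) = 0"
    proof -
      have "inverse vv *\<^sub>s e (e ?y) = 0" using e_l_e[of "f h"] by (simp add: ef h)
      then show ?thesis by simp
    qed
    have 2: "l (e ?y) = 0" using l_e_l[of "f h"] by (simp add: ef h)
    (* This makes x = v^(n-1) e y satisfy l f x = y = l f h. The cubic relation for f makes f y a multiple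
       of l f f h, and l e l = l e then makes l e f y a multiple of y. *)
    have 3: "l (f (e ?y)) = (vv powi (1 - n)) *\<^sub>s ?y"
    proof -
      have "qint 2 *\<^sub>s f ?y = inverse vv *\<^sub>s l (f (f h))" using f_l_f[of h] by (simp add: h)
      then have "qint 2 *\<^sub>s l (e (f ?y)) = inverse vv *\<^sub>s l (e (l (f (f h))))"
        by (simp flip: act_sm)
      also have "\<dots> = qint 2 *\<^sub>s (inverse vv * qint (n - 1)) *\<^sub>s ?y"
        by (simp add: l_e_l eff mult_ac)
      finally have "l (e (f ?y)) = (inverse vv * qint (n - 1)) *\<^sub>s ?y"
        by (rule scale_left_imp_eq[rotated]) simp
      moreover have "l (e (f ?y)) = l (f (e ?y)) + qint (n - 2) *\<^sub>s ?y"
        using e_f_wt[OF wty] by (simp add: act_add)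
      ultimately have "l (f (e ?y)) = (inverse vv * qint (n - 1) - qint (n - 2)) *\<^sub>s ?y"
        by (simp add: scale_left_diff_distrib eq_diff_eq)
      also have "inverse vv * qint (n - 1) - qint (n - 2) = vv powi (1 - n)"
        unfolding qint_def by (simp add: vv_powi_simps divide_simps) (simp add: qint_identity_simps)
      finally show ?thesis .
    qed
    let ?x = "(vv powi (n - 1)) *\<^sub>s e ?y"
    have "wt (n - 2 + 2) ?x" by (intro wt_sm wt_e wty)
    then have wtx: "wt n ?x" by simp
    have lfx: "l (f ?x) = ?y"
      by (simp add: 3 flip: power_int_add)
    have xN: "?x \<in> N"
    proof (rule highest_weight_01[OF _ wtx])
      show "e (l (f ?x)) = (vv powi (1 - n)) *\<^sub>s ?x"
        unfolding lfx by (simp flip: power_int_add)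
    qed (use n1 1 2 h S_closed in simp_all)
    have "h - ?x \<in> N"
      by (rule highest_weight_L0[of _ n]) (use h 1 2 lfx wtx S_closed in \<open>simp_all add: wt_diff act_diff\<close>)
    then show ?thesis using submod_closed(2)[OF N xN] by fastforce
  qed
qed

text \<open>The components \<open>l h\<close> and \<open>h - l h\<close> of a highest weight vector need not be killed by \<open>e\<close>: their
  images under \<open>e\<close> are \<open>x\<close> and \<open>- x\<close>. But the cubic relation for \<open>e\<close> shows that \<open>x\<close> is a highest
  weight vector, of weight \<open>n + 2\<close>, and that it generates a Rosso module. That module contains
  vectors in the image and in the kernel of \<open>l\<close> with image \<open>x\<close> under \<open>e\<close>; subtracting them from the
  components corrects both.\<close>

lemma highest_weight: assumes h: "h \<in> S" "wt n h" "e h = 0" shows "h \<in> N"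
proof (rule highest_weight_reduce[OF h])
  assume n: "0 \<le> n" "n \<in> weights d"
  let ?h1 = "l h" let ?x = "e ?h1" let ?y = "l (f ?x)"
  have wt1: "wt n ?h1" by (rule wt_l[OF h(2)])
  have wtx: "wt (n + 2) ?x" by (rule wt_e[OF wt1])
  have lx: "l ?x = 0" using l_e_l[of h] by (simp add: h)
  have ex: "e ?x = 0"
  proof -
    have "inverse vv *\<^sub>s e ?x = 0" using e_l_e[of h] by (simp add: h)
    then show ?thesis by simp
  qed
  have ely: "e ?y = (vv powi (1 - (n + 2))) *\<^sub>s ?x"
  proof -
    have fx: "f ?x = e (f ?h1) - qint n *\<^sub>s ?h1" using e_f_wt[OF wt1] by simp
    have lf: "l (f ?h1) = f ?h1" by (rule l_f_l)
    have eef: "e (e (f ?h1)) = (qint 2 * qint (n + 1)) *\<^sub>s ?x"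
      using e_f_wt[OF wt1] e_f_wt[OF wtx] unfolding qint_2_mult[of "n + 1"]
          by (simp add: act_add ex scale_left_distrib add.commute)
    have "qint 2 *\<^sub>s e (l (e (f ?h1))) = qint 2 *\<^sub>s (inverse vv * qint (n + 1)) *\<^sub>s ?x"
      using e_l_e[of "f ?h1"] by (simp add: lf eef lx mult_ac)
    then have "e (l (e (f ?h1))) = (inverse vv * qint (n + 1)) *\<^sub>s ?x"
      by (rule scale_left_imp_eq[rotated]) simp
    then have "e ?y = (inverse vv * qint (n + 1) - qint n) *\<^sub>s ?x"
      unfolding fx by (simp add: act_diff scale_left_diff_distrib)
    also have "inverse vv * qint (n + 1) - qint n = vv powi (1 - (n + 2))"
      unfolding qint_def by (simp add: vv_powi_simps divide_simps) (simp add: qint_identity_simps)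
    finally show ?thesis .
  qed
  have xN: "?x \<in> N" by (rule highest_weight_01[OF _ wtx ex lx ely]) (use n h in simp_all)
  have wtfx: "wt n (f ?x)" using wt_f[OF wtx] by simp
  (* In terms of the Rosso family of x, with n + 2 in place of n, this is v^(n+1) y 1, and ?z below is
     a multiple of z 1. Both are mapped to x by e. *)
  let ?u = "(vv powi (n + 1)) *\<^sub>s ?y"
  have uN: "?u \<in> N" by (intro submod_closed[OF N] xN)
  have "?h1 - ?u \<in> N"
  proof (rule highest_weight_L1[of _ n])
    show "e (?h1 - ?u) = 0" by (simp add: act_diff ely flip: power_int_add)
  qed (use h wt1 wtfx in \<open>auto intro!: S_closed wt_diff wt_sm wt_l simp: act_diff\<close>)
  then have h1: "?h1 \<in> N" using submod_closed(2)[OF N _ uN] by fastforce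
  let ?z = "inverse (vv * qint (n + 1)) *\<^sub>s (f ?x - ?y)"
  have zN: "?z \<in> N" by (intro submod_closed[OF N] xN)
  have nz: "vv * qint (n + 1) \<noteq> 0" using n by simp
  have ez: "e ?z = ?x"
  proof -
    have "e (f ?x - ?y) = (qint (n + 2) - vv powi (1 - (n + 2))) *\<^sub>s ?x"
      using e_f_wt[OF wtx] by (simp add: act_diff ex ely scale_left_diff_distrib)
    also have "qint (n + 2) - vv powi (1 - (n + 2)) = vv * qint (n + 1)"
      using qint_add_1[of "n + 1"] by (simp add: algebra_simps)
    finally show ?thesis by (simp only: act_sm scale_scale left_inverse[OF nz] scale_one)
  qed
  have "h - ?h1 + ?z \<in> N"
  proof (rule highest_weight_V0[of _ n])
    show "e (h - ?h1 + ?z) = 0" unfolding act_add act_diff ez using h by simp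
  qed (use h wt1 wtfx in \<open>auto intro!: S_closed wt_add wt_diff wt_sm wt_l simp: act_diff act_add\<close>)
  from submod_closed(5)[OF N this zN] have "h - ?h1 \<in> N" by (simp only: add_diff_cancel_right')
  from submod_closed(2)[OF N this h1] show "h \<in> N" by (simp only: diff_add_cancel)
qed

text \<open>Induction on \<open>s\<close> such that \<open>e^s\<close> kills \<open>w\<close>. If \<open>e^(s+1)\<close> does, then \<open>h = e^s w\<close> is a highest
  weight vector, and a multiple of \<open>f^s h\<close> has the same image under \<open>e^s\<close> as \<open>w\<close>; here \<open>s\<close> is at
  most the weight \<open>\<mu> + 2 * s\<close> of \<open>h\<close> because \<open>\<mu> \<ge> 0\<close>.\<close>

lemma nonneg_weight:
  assumes "w \<in> S" "wt \<mu> w" "\<mu> \<ge> 0" shows "w \<in> N"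
proof -
  have *: "w \<in> N" if "w \<in> S" "wt \<mu> w" "act (Fe ^ s) w = 0" for w s
    using that
  proof (induction s arbitrary: w)
    case 0 then show ?case using submod_closed(1)[OF N] by (simp add: act_one)
  next
    case (Suc s)
    let ?h = "act (Fe ^ s) w" and ?n = "\<mu> + 2 * int s"
    have wth: "wt ?n ?h" by (rule wt_epow[OF Suc(3)])
    have eh: "e ?h = 0" using Suc(4) by (simp add: act_mult)
    have hN: "?h \<in> N" by (rule highest_weight[OF _ wth eh]) (simp add: Suc)
    obtain c where c: "c \<noteq> 0" "act (Fe ^ s) (dpow ?h (int s)) = c *\<^sub>s ?h"
      using epow_dpow[OF wth eh, of s] assms(3) by auto
    let ?g = "inverse c *\<^sub>s dpow ?h (int s)"
    have gN: "?g \<in> N" by (intro submod_closed[OF N] dpow_in[OF N] hN)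
    have "wt (?n - 2 * int s) ?g" by (intro wt_sm dpow_wt wth)
    then have wtg: "wt \<mu> ?g" by simp
    have "w - ?g \<in> N"
    proof (rule Suc.IH)
      show "act (Fe ^ s) (w - ?g) = 0" using c by (simp add: act_diff)
    qed (use Suc wtg gN N in \<open>auto intro!: S_closed(5) wt_diff simp: submod_def\<close>)
    then show ?case using submod_closed(2)[OF N _ gN] by fastforce
  qed
  have "act (Fe ^ (d + 1)) w = 0"
    by (rule wt_outside[OF _ wt_epow[OF assms(2), of "d + 1"]]) (use assms in \<open>auto simp: weights_iff\<close>)
  from *[OF assms(1,2) this] show ?thesis .
qed

text \<open>Negative weights are reached from above by \<open>negative_weight\<close>, as \<open>e\<close> raises the weight.\<close>

lemma any_weight: "w \<in> S \<Longrightarrow> wt \<mu> w \<Longrightarrow> w \<in> N"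
proof (induction "nat (- \<mu>)" arbitrary: w \<mu> rule: less_induct)
  case less
  show ?case
  proof (cases "\<mu> \<ge> 0")
    case False
    then have "e w \<in> N" using wt_e[OF less(3)] less(2) by (intro less(1)[of "\<mu> + 2"]) auto
    then show ?thesis using negative_weight[OF N less(2,3)] False by simp
  qed (use less nonneg_weight in blast)
qed

text \<open>Decomposition into weight vectors, one factor at a time: if \<open>(k - v^\<mu>) R(k)\<close> kills \<open>w\<close>, then
  \<open>R(k) w\<close> has weight \<open>\<mu>\<close> and so lies in \<open>N\<close>, and \<open>(k - v^\<mu>) w\<close> lies in \<open>N\<close> by induction. Modulo \<open>N\<close>
  therefore \<open>R(k) w\<close> is both zero and the nonzero multiple \<open>R(v^\<mu>) w\<close>.\<close>

lemma kprod_annihilated: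
  assumes "w \<in> S" "act (kprod \<mu>s) w = 0" "distinct \<mu>s" shows "w \<in> N"
  using assms
proof (induction \<mu>s arbitrary: w)
  case Nil then show ?case using submod_closed(1)[OF N] by (simp add: act_one)
next
  case (Cons \<mu> \<mu>s)
  let ?p = "act (kprod \<mu>s) w" and ?w = "act (kfac \<mu>) w"
  have "act (kfac \<mu>) ?p = 0" using Cons(3) by (simp add: act_mult)
  then have "wt \<mu> ?p" by (simp add: wt_def act_diff_left act_scal)
  then have pN: "?p \<in> N" using any_weight Cons(2) by simp
  have "act (kprod \<mu>s) ?w = 0" using Cons(3) by (simp add: kprod_commute flip: act_mult)
  then have wN: "?w \<in> N" using Cons by simp
  have "act (kprod \<nu>s) w - prod_list (map (\<lambda>\<nu>. vv powi \<mu> - vv powi \<nu>) \<nu>s) *\<^sub>s w \<in> N" for \<nu>s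
  proof (induction \<nu>s)
    case Nil then show ?case using submod_closed(1)[OF N] by (simp add: act_one)
  next
    case (Cons \<nu> \<nu>s)
    let ?c = "prod_list (map (\<lambda>\<nu>. vv powi \<mu> - vv powi \<nu>) \<nu>s)"
    have "act (kfac \<nu>) (act (kprod \<nu>s) w - ?c *\<^sub>s w) + ?c *\<^sub>s ?w \<in> N"
      by (intro submod_closed[OF N] Cons wN)
    then show ?case by (simp add: act_mult act_simps algebra_simps)
  qed
  from submod_cancel_diff[OF N pN this] have "prod_list (map (\<lambda>\<nu>. vv powi \<mu> - vv powi \<nu>) \<mu>s) *\<^sub>s w \<in> N" .
  then show ?case by (rule submod_cancel[OF N]) (use Cons in \<open>intro prod_list_nonzero, auto\<close>)
qed

theorem generated_by_families: "w \<in> S \<Longrightarrow> w \<in> N"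
  by (rule kprod_annihilated[OF _ P_poly_act[unfolded P_poly_kprod]]) (auto simp: distinct_map
      inj_on_def simp del: upt_Suc)

end
end

section \<open>Modules given by the action of the generators\<close>

lemma letters_simps [simp]: "letters 0 = []" "letters (x + y) = letters x @ letters y"
  by (simp_all add: zero_word_def plus_word_def)

text \<open>The free algebra acts through any assignment of linear maps to the generators.\<close>

definition free_op :: "(K \<Rightarrow> 'b \<Rightarrow> 'b) \<Rightarrow> (gen \<Rightarrow> 'b \<Rightarrow> 'b) \<Rightarrow> free \<Rightarrow> 'b \<Rightarrow> 'b::ab_group_add" where
  "free_op s op x w = lin_ext s (\<lambda>wd. foldr op (letters wd) w) x"

context
  fixes s :: "K \<Rightarrow> 'b \<Rightarrow> 'b::ab_group_add" and op :: "gen \<Rightarrow> 'b \<Rightarrow> 'b"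
  assumes s: "vector_space s"
    and op_add: "\<And>g a b. op g (a + b) = op g a + op g b" and op_scale: "\<And>g c a. op g (s c a) = s c (op g a)"
begin

interpretation vector_space s by (rule s)

lemma foldr_op_add: "foldr op gs (a + b) = foldr op gs a + foldr op gs b"
  by (induction gs) (simp_all add: op_add)

lemma foldr_op_scale: "foldr op gs (s c a) = s c (foldr op gs a)"
  by (induction gs) (simp_all add: op_scale)

lemma foldr_op_0: "foldr op gs 0 = 0"
  using foldr_op_add[of gs 0 0] by simp

lemma free_op_single: "free_op s op (Poly_Mapping.single wd c) w = s c (foldr op (letters wd) w)"
  by (simp add: free_op_def)

lemma free_op_add_left: "free_op s op (x + y) w = free_op s op x w + free_op s op y w"
  by (simp add: free_op_def lin_ext_add)

lemma free_op_0_left: "free_op s op 0 w = 0"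
  by (simp add: free_op_def)

lemma free_op_add: "free_op s op x (w + w') = free_op s op x w + free_op s op x w'"
  by (simp add: free_op_def lin_ext_def foldr_op_add scale_right_distrib sum.distrib)

lemma free_op_module: "free_module (free_op s op)"
proof
  fix x y :: free and w w' :: 'b
  show "free_op s op (x + y) w = free_op s op x w + free_op s op y w" by (rule free_op_add_left)
  show "free_op s op x (w + w') = free_op s op x w + free_op s op x w'" by (rule free_op_add)
  show "free_op s op 1 w = w"
    using free_op_single[of 0 1 w] by simp
  show "free_op s op (x * y) w = free_op s op x (free_op s op y w)"
  proof (induction x rule: poly_mapping_induct_add)
    case (single wd c)
    show ?case
    proof (induction y rule: poly_mapping_induct_add)
      case (single wd' c')
      show ?case by (simp add: mult_single free_op_single foldr_op_scale plus_word_def)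
    qed (simp_all add: distrib_left free_op_add_left free_op_0_left free_op_add free_op_single
        foldr_op_0 foldr_op_add scale_right_distrib)
  qed (simp_all add: distrib_right free_op_add_left free_op_0_left)
qed

lemma free_op_fgen: "free_op s op (fgen g) w = op g w"
  by (simp add: fgen_def free_op_single)

lemma free_op_sm: "free_module.sm (free_op s op) = s"
  unfolding free_module.sm_def[OF free_op_module, abs_def]
  by (intro ext) (simp add: scal_def free_op_single zero_word_def)

end

lemma free_generated:
  assumes "\<And>c. P (scal c)" "\<And>g x. P x \<Longrightarrow> P (fgen g * x)" "\<And>x y. P x \<Longrightarrow> P y \<Longrightarrow> P (x + y)"
  shows "P (x :: free)"
proof (induction x rule: poly_mapping_induct_add)
  case zero then show ?case using assms(1)[of 0] by simp
next
  case (single wd c)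
  have "P (Poly_Mapping.single (Word gs) c)" for gs
  proof (induction gs)
    case Nil then show ?case using assms(1)[of c] by (simp add: scal_def zero_word_def)
  next
    case (Cons g gs) then show ?case
      using assms(2)[of "Poly_Mapping.single (Word gs) c" g]
          by (simp add: fgen_def mult_single plus_word_def)
  qed
  then show ?case by (cases wd) simp
qed (rule assms(3))

lemma intertwiner:
  assumes "free_module act" "free_module act'" "\<And>a b. \<theta> (a + b) = \<theta> a + \<theta> b"
    "\<And>c a. \<theta> (free_module.sm act c a) = free_module.sm act' c (\<theta> a)"
    "\<And>g a. \<theta> (act (fgen g) a) = act' (fgen g) (\<theta> a)"
  shows "\<theta> (act x a) = act' x (\<theta> a)"
proof -
  interpret A: free_module act by fact
  interpret B: free_module act' by fact
  show ?thesis
    by (induction x rule: free_generated) (simp_all add: A.act_simps B.act_simps assms)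
qed


context free_module begin

text \<open>Vanishing of the defining relators on a single vector. On the bases of the blocks this is
  checked vector by vector, with no multiplication of matrices.\<close>

lemma relators_vanishI:
  assumes "r \<in> mir_relators"
    and "k (ki w) = w" "ki (k w) = w"
    and "k (e (ki w)) = (vv powi 2) *\<^sub>s e w" "k (f (ki w)) = (vv powi (- 2)) *\<^sub>s f w"
    and "e (f w) = f (e w) + (1 / (vv - inverse vv)) *\<^sub>s (k w - ki w)"
    and "l (l w) = l w" "k (l w) = l (k w)" "l (e (l w)) = l (e w)" "l (f (l w)) = f (l w)"
    and "qint 2 *\<^sub>s e (l (e w)) = inverse vv *\<^sub>s e (e (l w)) + vv *\<^sub>s l (e (e w))"
    and "qint 2 *\<^sub>s f (l (f w)) = inverse vv *\<^sub>s l (f (f w)) + vv *\<^sub>s f (f (l w))"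
  shows "act r w = 0"
  using assms(1) unfolding mir_relators_def insert_iff empty_iff
  by (elim disjE) (simp_all only: power2_eq_square act_simps assms, simp_all add: scale_right_diff_distrib)

lemma relators_Lplus_family:
  assumes u: "Lplus_family n \<delta> u" and \<delta>: "\<delta> = 0 \<or> \<delta> = 1" and r: "r \<in> mir_relators"
  shows "act r (u i) = 0"
proof -
  have u: "k (u i) = (vv powi (n - 2 * i)) *\<^sub>s u i" "ki (u i) = (vv powi (2 * i - n)) *\<^sub>s u i"
     "l (u i) = \<delta> *\<^sub>s u i" "f (u i) = qint (i + 1) *\<^sub>s u (i + 1)" "e (u i) = qint (n - i + 1) *\<^sub>s u
         (i - 1)" for i
    using u by (auto simp: Lplus_family_def wt_def)
  have ef: "qint (i + 1) * qint (n - i) = qint i * qint (n - i + 1) + (vv powi (n - 2 * i) - vv powi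
      (2 * i - n)) / (vv - inverse vv)"
    using qint_mult_shift[of i n] by (simp add: qint_def[of "n - 2 * i"])
  have q2: "qint 2 = inverse vv + vv" using qint_add_1[of 1] by (simp add: power_int_minus add.commute)
  from r show ?thesis
  proof (rule relators_vanishI)
    show "e (f (u i)) = f (e (u i)) + (1 / (vv - inverse vv)) *\<^sub>s (k (u i) - ki (u i))"
      using ef by (simp add: u mult.commute flip: scale_left_distrib scale_left_diff_distrib)
    show "qint 2 *\<^sub>s e (l (e (u i))) = inverse vv *\<^sub>s e (e (l (u i))) + vv *\<^sub>s l (e (e (u i)))"
      using \<delta> by (auto simp: u q2 distrib_right simp flip: scale_left_distrib)
    show "qint 2 *\<^sub>s f (l (f (u i))) = inverse vv *\<^sub>s l (f (f (u i))) + vv *\<^sub>s f (f (l (u i)))"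
      using \<delta> by (auto simp: u q2 distrib_right simp flip: scale_left_distrib)
  qed (use \<delta> in \<open>auto simp: u mult_ac algebra_simps simp flip: power_int_add\<close>)
qed

lemma relators_Rosso_family:
  assumes zy: "Rosso_family n z y" and r: "r \<in> mir_relators"
  shows "act r (z i) = 0" "act r (y i) = 0"
proof -
  have z: "k (z i) = (vv powi (n - 2 * i)) *\<^sub>s z i" "ki (z i) = (vv powi (2 * i - n)) *\<^sub>s z i" "l (z i) = 0"
     "f (z i) = qint (i + 1) *\<^sub>s z (i + 1) + (vv powi i) *\<^sub>s y (i + 1)"
     "e (z i) = (vv * qint (n - i)) *\<^sub>s z (i - 1)" for i
    using zy by (auto simp: Rosso_family_def wt_def)
  have y: "k (y i) = (vv powi (n - 2 * i)) *\<^sub>s y i" "ki (y i) = (vv powi (2 * i - n)) *\<^sub>s y i" "l (y i)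
      = y i"
     "f (y i) = (inverse vv * qint i) *\<^sub>s y (i + 1)"
     "e (y i) = qint (n - i + 1) *\<^sub>s y (i - 1) + (vv powi (i - n)) *\<^sub>s z (i - 1)" for i
    using zy by (auto simp: Rosso_family_def wt_def)
  have q2: "qint 2 = inverse vv + vv" using qint_add_1[of 1] by (simp add: power_int_minus add.commute)
  note dist = scale_left_distrib scale_right_distrib scale_left_diff_distrib scale_right_diff_distrib
  show "act r (z i) = 0"
    using r
  proof (rule relators_vanishI)
    have 1: "qint (i + 1) * (vv * qint (n - i - 1)) + vv powi i * vv powi (i + 1 - n) =
        vv * qint (n - i) * qint i + (1 / (vv - inverse vv)) * (vv powi (n - 2 * i) - vv powi (2 * i - n))"
      unfolding qint_def by (simp add: vv_powi_simps divide_simps) (simp add: qint_identity_simps)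
    have 2: "vv powi i * qint (n - i) = vv * qint (n - i) * vv powi (i - 1)"
      by (simp add: vv_powi_simps)
    show "e (f (z i)) = f (e (z i)) + (1 / (vv - inverse vv)) *\<^sub>s (k (z i) - ki (z i))"
      using arg_cong[OF 1, of "\<lambda>c. c *\<^sub>s z i"] arg_cong[OF 2, of "\<lambda>c. c *\<^sub>s y i"]
      by (simp add: z y act_add dist algebra_simps)
    show "qint 2 *\<^sub>s e (l (e (z i))) = inverse vv *\<^sub>s e (e (l (z i))) + vv *\<^sub>s l (e (e (z i)))"
      by (simp add: z y act_add)
    have 3: "qint 2 * (vv powi i * (inverse vv * qint (i + 1))) = inverse vv * (qint (i + 1) * vv powi
        (i + 1) + vv powi i * (inverse vv * qint (i + 1)))"
      by (simp add: q2 vv_powi_simps algebra_simps)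
    show "qint 2 *\<^sub>s f (l (f (z i))) = inverse vv *\<^sub>s l (f (f (z i))) + vv *\<^sub>s f (f (l (z i)))"
      using arg_cong[OF 3, of "\<lambda>c. c *\<^sub>s y (i + 2)"]
      by (simp add: z y act_add dist algebra_simps)
    show "k (e (ki (z i))) = (vv powi 2) *\<^sub>s e (z i)" "k (f (ki (z i))) = (vv powi - 2) *\<^sub>s f (z i)"
      by (simp_all add: z y act_add dist vv_powi_simps field_simps power2_eq_square)
  qed (simp_all add: z y act_add dist flip: power_int_add)
  show "act r (y i) = 0"
    using r
  proof (rule relators_vanishI)
    have 1: "inverse vv * qint i * qint (n - i) =
        qint (n - i + 1) * (inverse vv * qint (i - 1)) + vv powi (i - n) * vv powi (i - 1) +
            (1 / (vv - inverse vv)) * (vv powi (n - 2 * i) - vv powi (2 * i - n))"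
      unfolding qint_def by (simp add: vv_powi_simps divide_simps) (simp add: qint_identity_simps)
    have 2: "inverse vv * vv powi (1 + i - n) = vv powi (i - n)"
      by (simp add: vv_powi_simps)
    show "e (f (y i)) = f (e (y i)) + (1 / (vv - inverse vv)) *\<^sub>s (k (y i) - ki (y i))"
      using arg_cong[OF 1, of "\<lambda>c. c *\<^sub>s y i"] 2
      by (simp add: z y act_add dist algebra_simps)
    have 3: "qint 2 * (qint (n - i + 1) * vv powi (i - 1 - n)) = inverse vv * (qint (n - i + 1) * vv
        powi (i - 1 - n) + vv powi (i - n) * (vv * qint (n - i + 1)))"
      by (simp add: q2 vv_powi_simps field_simps)
    have 4: "qint 2 * (qint (n - i + 1) * qint (n - i + 2)) = inverse vv * (qint (n - i + 1) * qint
        (n - i + 2)) + vv * (qint (n - i + 1) * qint (n - i + 2))"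
      by (simp add: q2 algebra_simps)
    show "qint 2 *\<^sub>s e (l (e (y i))) = inverse vv *\<^sub>s e (e (l (y i))) + vv *\<^sub>s l (e (e (y i)))"
      using arg_cong[OF 3, of "\<lambda>c. c *\<^sub>s z (i - 2)"] arg_cong[OF 4, of "\<lambda>c. c *\<^sub>s y (i - 2)"]
      by (simp add: z y act_add dist algebra_simps)
    show "qint 2 *\<^sub>s f (l (f (y i))) = inverse vv *\<^sub>s l (f (f (y i))) + vv *\<^sub>s f (f (l (y i)))"
      by (simp add: z y q2 act_add dist algebra_simps)
    show "k (e (ki (y i))) = (vv powi 2) *\<^sub>s e (y i)" "k (f (ki (y i))) = (vv powi - 2) *\<^sub>s f (y i)"
      by (simp_all add: z y act_add dist vv_powi_simps field_simps power2_eq_square)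
  qed (simp_all add: z y act_add dist flip: power_int_add)
qed

end

section \<open>The direct sum of the block modules\<close>

definition pm_scale :: "K \<Rightarrow> ('i \<Rightarrow>\<^sub>0 K) \<Rightarrow> 'i \<Rightarrow>\<^sub>0 K" where
  "pm_scale c x = Poly_Mapping.map ((*) c) x"

lemma lookup_pm_scale [simp]: "Poly_Mapping.lookup (pm_scale c x) i = c * Poly_Mapping.lookup x i"
  by (simp add: pm_scale_def Poly_Mapping.map.rep_eq when_def)

lemma pm_scale_vector_space: "vector_space pm_scale"
  by unfold_locales (rule poly_mapping_eqI, simp add: lookup_add algebra_simps)+

interpretation pm: vector_space pm_scale by (rule pm_scale_vector_space)

lemma pm_scale_single [simp]: "pm_scale c (Poly_Mapping.single i a) = Poly_Mapping.single i (c * a)"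
  by (rule poly_mapping_eqI) (simp add: lookup_single when_def)

text \<open>The direct sum of all block modules, including those that do not occur for a given \<open>d\<close>, so
  that the action and the comparison maps are defined only once.\<close>

type_synonym model = "(block \<times> nat) \<Rightarrow>\<^sub>0 K"

text \<open>Basis vectors with integer index, zero outside the range of the block, as in the standard
  families. In the block of \<open>L\<^sup>+(m,01)\<close> the vectors \<open>zv m i\<close> come first and \<open>yv m 1, \<dots>, yv m m\<close>
  follow from position \<open>m\<close> on.\<close>

definition uv :: "block \<Rightarrow> int \<Rightarrow> model" where
  "uv b i = (if 0 \<le> i \<and> nat i < block_size b then Poly_Mapping.single (b, nat i) 1 else 0)"

definition zv :: "nat \<Rightarrow> int \<Rightarrow> model" where
  "zv m i = (if i < int m then uv (B01 m) i else 0)"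

definition yv :: "nat \<Rightarrow> int \<Rightarrow> model" where
  "yv m i = (if 1 \<le> i then uv (B01 m) (int m + i - 1) else 0)"

text \<open>The images of the basis vectors under the generators: \<open>colL\<close> for \<open>L\<^sup>+(n,\<delta>)\<close>, and \<open>colz\<close> and
  \<open>coly\<close> for the two halves of \<open>L\<^sup>+(n,01)\<close>.\<close>

fun colL :: "int \<Rightarrow> K \<Rightarrow> (int \<Rightarrow> model) \<Rightarrow> gen \<Rightarrow> int \<Rightarrow> model" where
  "colL n \<delta> u gen_e i = pm_scale (qint (n - i + 1)) (u (i - 1))"
| "colL n \<delta> u gen_f i = pm_scale (qint (i + 1)) (u (i + 1))"
| "colL n \<delta> u gen_k i = pm_scale (vv powi (n - 2 * i)) (u i)"
| "colL n \<delta> u gen_kinv i = pm_scale (vv powi (2 * i - n)) (u i)"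
| "colL n \<delta> u gen_l i = pm_scale \<delta> (u i)"

fun colz :: "int \<Rightarrow> (int \<Rightarrow> model) \<Rightarrow> (int \<Rightarrow> model) \<Rightarrow> gen \<Rightarrow> int \<Rightarrow> model" where
  "colz n z y gen_e i = pm_scale (vv * qint (n - i)) (z (i - 1))"
| "colz n z y gen_f i = pm_scale (qint (i + 1)) (z (i + 1)) + pm_scale (vv powi i) (y (i + 1))"
| "colz n z y gen_k i = pm_scale (vv powi (n - 2 * i)) (z i)"
| "colz n z y gen_kinv i = pm_scale (vv powi (2 * i - n)) (z i)"
| "colz n z y gen_l i = 0"

fun coly :: "int \<Rightarrow> (int \<Rightarrow> model) \<Rightarrow> (int \<Rightarrow> model) \<Rightarrow> gen \<Rightarrow> int \<Rightarrow> model" where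
  "coly n z y gen_e i = pm_scale (qint (n - i + 1)) (y (i - 1)) + pm_scale (vv powi (i - n)) (z (i - 1))"
| "coly n z y gen_f i = pm_scale (inverse vv * qint i) (y (i + 1))"
| "coly n z y gen_k i = pm_scale (vv powi (n - 2 * i)) (y i)"
| "coly n z y gen_kinv i = pm_scale (vv powi (2 * i - n)) (y i)"
| "coly n z y gen_l i = y i"

fun model_col :: "gen \<Rightarrow> block \<Rightarrow> nat \<Rightarrow> model" where
  "model_col g (B1 m) i = colL (int m) 1 (uv (B1 m)) g (int i)"
| "model_col g (B0 m) i = colL (int m) 0 (uv (B0 m)) g (int i)"
| "model_col g (B01 m) i = (if i < m then colz (int m) (zv m) (yv m) g (int i)
     else coly (int m) (zv m) (yv m) g (int i - int m + 1))"

text \<open>Positions beyond the size of a block are sent to zero, so that the \<open>comparison\<close> maps below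
  commute with the action on the whole space.\<close>

definition model_gen :: "gen \<Rightarrow> model \<Rightarrow> model" where
  "model_gen g = lin_ext pm_scale (\<lambda>(b, i). if i < block_size b then model_col g b i else 0)"

lemma lin_ext_pm_scale:
  assumes "vector_space s" shows "lin_ext s b (pm_scale c w) = s c (lin_ext s b w)"
proof -
  interpret vector_space s by fact
  show ?thesis
  proof (induction w rule: poly_mapping_induct_add)
    case zero show ?case by (simp add: lin_ext_0)
  qed (simp_all add: lin_ext_add pm.scale_right_distrib scale_right_distrib)
qed

lemma model_gen_add: "model_gen g (w + w') = model_gen g w + model_gen g w'" and model_gen_scale:
    "model_gen g (pm_scale c w) = pm_scale c (model_gen g w)"
  by (simp_all add: model_gen_def pm.lin_ext_add lin_ext_pm_scale[OF pm_scale_vector_space])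

lemma model_gen_0 [simp]: "model_gen g 0 = 0" by (simp add: model_gen_def)

lemma model_gen_single: "model_gen g (Poly_Mapping.single (b, i) c) = (if i < block_size b then pm_scale
    c (model_col g b i) else 0)"
  by (simp add: model_gen_def)

definition model_act :: "free \<Rightarrow> model \<Rightarrow> model" where "model_act = free_op pm_scale model_gen"

lemmas model_gen_module = pm_scale_vector_space model_gen_add model_gen_scale

interpretation model: free_module model_act
  unfolding model_act_def by (rule free_op_module) (rule model_gen_module)+

lemma model_sm: "model.sm = pm_scale"
  unfolding model_act_def by (rule free_op_sm) (rule model_gen_module)+

lemma model_act_fgen: "model_act (fgen g) w = model_gen g w"
  unfolding model_act_def by (rule free_op_fgen) (rule model_gen_module)+

lemma model_gen_uv: "0 \<le> i \<Longrightarrow> nat i < block_size b \<Longrightarrow> model_gen g (uv b i) = model_col g b (nat i)"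
  by (simp add: uv_def model_gen_single)

lemma uv_0: "i < 0 \<or> i \<ge> int (block_size b) \<Longrightarrow> uv b i = 0"
  by (auto simp: uv_def)

text \<open>The formulas extend from basis vectors to all integer indices, since both sides vanish outside
  the range.\<close>

lemma model_gen_L:
  assumes b: "block_size b = m + 1" "\<And>g i. model_col g b i = colL (int m) \<delta> (uv b) g (int i)"
  shows "model_gen g (uv b i) = colL (int m) \<delta> (uv b) g i"
proof (cases "0 \<le> i \<and> i \<le> int m")
  case True then show ?thesis using model_gen_uv[of i b g] b by auto
next
  case False
  then have "uv b i = 0" "i \<noteq> -1 \<Longrightarrow> uv b (i + 1) = 0" "i \<noteq> int m + 1 \<Longrightarrow> uv b (i - 1) = 0"
    using b by (auto intro!: uv_0)
  then show ?thesis by (cases g; cases "i = -1"; cases "i = int m + 1") simp_all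
qed

lemma model_Lplus_family:
  assumes b: "block_size b = m + 1" "\<And>g i. model_col g b i = colL (int m) \<delta> (uv b) g (int i)"
  shows "model.Lplus_family (int m) \<delta> (uv b)"
  unfolding model.Lplus_family_def model.wt_def model_act_fgen model_sm model_gen_L[OF b] using b
      by (auto intro!: uv_0)

lemma model_Lplus_family_1: "model.Lplus_family (int m) 1 (uv (B1 m))" and model_Lplus_family_0:
    "model.Lplus_family (int m) 0 (uv (B0 m))"
  by (rule model_Lplus_family; simp)+

lemma zv_0: "i < 0 \<or> i \<ge> int m \<Longrightarrow> zv m i = 0" and yv_0: "i < 1 \<or> i > int m \<Longrightarrow> yv m i = 0"
  by (auto simp: zv_def yv_def uv_def)

lemma model_gen_z: "model_gen g (zv m i) = colz (int m) (zv m) (yv m) g i"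
proof (cases "0 \<le> i \<and> i < int m")
  case True then show ?thesis using model_gen_uv[of i "B01 m" g] by (auto simp: zv_def)
next
  case False
  then have 0: "zv m i = 0" by (auto intro: zv_0)
  moreover have "zv m (i + 1) = 0 \<or> i = -1" "zv m (i - 1) = 0 \<or> i = int m" "yv m (i + 1) = 0"
    using False by (auto intro!: zv_0 yv_0)
  ultimately show ?thesis by (cases g) (auto simp: zv_0)
qed

lemma model_gen_y: "model_gen g (yv m i) = coly (int m) (zv m) (yv m) g i"
proof (cases "1 \<le> i \<and> i \<le> int m")
  case True
  then have "int (nat (int m + i - 1)) - int m + 1 = i" by simp
  with True show ?thesis using model_gen_uv[of "int m + i - 1" "B01 m" g] by (auto simp: yv_def)
next
  case False
  then have 0: "yv m i = 0" by (auto intro: yv_0)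
  moreover have "yv m (i + 1) = 0 \<or> i = 0" "yv m (i - 1) = 0 \<or> i = int m + 1" "zv m (i - 1) = 0"
    using False by (auto intro!: zv_0 yv_0)
  ultimately show ?thesis by (cases g) (auto simp: yv_0)
qed

lemma model_Rosso_family: "model.Rosso_family (int m) (zv m) (yv m)"
  unfolding model.Rosso_family_def model.wt_def model_act_fgen model_sm model_gen_z model_gen_y
      by (auto intro!: zv_0 yv_0)

text \<open>The subspace of a block; it is stable under the action, which makes the matrix entries below
  multiplicative.\<close>

definition block_part :: "block \<Rightarrow> model set" where
  "block_part b = {w. \<forall>a j. Poly_Mapping.lookup w (a, j) \<noteq> 0 \<longrightarrow> a = b \<and> j < block_size b}"

lemma block_part_D: "w \<in> block_part b \<Longrightarrow> Poly_Mapping.lookup w (a, j) \<noteq> 0 \<Longrightarrow> a = b \<and> j < block_size b"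
  unfolding block_part_def mem_Collect_eq by (drule spec2, erule (1) mp)
lemma block_part_0 [simp]: "0 \<in> block_part b" by (simp add: block_part_def)
lemma block_part_add: "w \<in> block_part b \<Longrightarrow> w' \<in> block_part b \<Longrightarrow> w + w' \<in> block_part b"
  unfolding block_part_def mem_Collect_eq lookup_add by (metis add_0)
lemma block_part_scale: "w \<in> block_part b \<Longrightarrow> pm_scale c w \<in> block_part b" by (auto simp: block_part_def)
lemma block_part_sum: "(\<And>i. i \<in> A \<Longrightarrow> w i \<in> block_part b) \<Longrightarrow> sum w A \<in> block_part b"
  by (induction A rule: infinite_finite_induct) (auto intro: block_part_add)
lemma block_part_uv: "uv b i \<in> block_part b" by (auto simp: uv_def block_part_def lookup_single when_def)
lemma block_part_zy: "zv m i \<in> block_part (B01 m)" "yv m i \<in> block_part (B01 m)"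
    by (auto simp: zv_def yv_def block_part_uv)

lemma block_part_model_col: "model_col g b i \<in> block_part b"
  by (cases b; cases g) (auto intro!: block_part_add block_part_scale block_part_uv block_part_zy)

lemma block_part_expand: "w \<in> block_part b \<Longrightarrow> w = (\<Sum>i<block_size b. pm_scale (Poly_Mapping.lookup w
    (b, i)) (Poly_Mapping.single (b, i) 1))"
proof (rule poly_mapping_eqI)
  fix p assume w: "w \<in> block_part b"
  show "Poly_Mapping.lookup w p = Poly_Mapping.lookup (\<Sum>i<block_size b. pm_scale (Poly_Mapping.lookup w
      (b, i)) (Poly_Mapping.single (b, i) 1)) p"
  proof (cases "fst p = b \<and> snd p < block_size b")
    case True
    then obtain j where p: "p = (b, j)" "j < block_size b" by (cases p) auto
    then show ?thesis by (simp add: lookup_sum lookup_single when_def)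
  next
    case False
    then have "Poly_Mapping.lookup w p = 0" using w by (cases p) (auto simp: block_part_def)
    moreover have "(b, i) \<noteq> p" if "i < block_size b" for i using False that by auto
    ultimately show ?thesis by (simp add: lookup_sum lookup_single when_def)
  qed
qed

lemma block_part_model_act: "w \<in> block_part b \<Longrightarrow> model_act x w \<in> block_part b"
proof (induction x arbitrary: w rule: free_generated)
  case (2 g x)
  have "model_gen g w \<in> block_part b" if "w \<in> block_part b" for w
  proof -
    have "(case p of (b, i) \<Rightarrow> if i < block_size b then model_col g b i else 0) \<in> block_part b"
        if "p \<in> Poly_Mapping.keys w" for p
      using that \<open>w \<in> block_part b\<close> by (cases p) (auto simp: in_keys_iff block_part_model_col dest:
          block_part_D)
    then show ?thesis unfolding model_gen_def lin_ext_def by (intro block_part_sum block_part_scale)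
  qed
  then show ?case using 2 by (simp add: model.act_mult model_act_fgen)
qed (simp_all add: model.act_simps model_sm block_part_scale block_part_add)

definition entry :: "free \<Rightarrow> block \<Rightarrow> nat \<Rightarrow> nat \<Rightarrow> K" where
  "entry x b i j = Poly_Mapping.lookup (model_act x (Poly_Mapping.single (b, j) 1)) (b, i)"

lemma block_part_single: "j < block_size b \<Longrightarrow> Poly_Mapping.single (b, j) 1 \<in> block_part b"
  by (auto simp: block_part_def lookup_single when_def)

lemma model_act_single: "j < block_size b \<Longrightarrow> model_act x (Poly_Mapping.single (b, j) 1) =
    (\<Sum>i<block_size b. pm_scale (entry x b i j) (Poly_Mapping.single (b, i) 1))"
  using block_part_expand[OF block_part_model_act[OF block_part_single]] by (simp add: entry_def)

lemma model_act_sum: "model_act x (sum w A) = (\<Sum>i\<in>A. model_act x (w i))"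
  by (induction A rule: infinite_finite_induct) (simp_all add: model.act_add)

lemma entry_mult: "j < block_size b \<Longrightarrow> entry (x * y) b i j = (\<Sum>k<block_size b. entry x b i k * entry y b
    k j)"
proof -
  assume j: "j < block_size b"
  have "model_act (x * y) (Poly_Mapping.single (b, j) 1) =
      (\<Sum>k<block_size b. pm_scale (entry y b k j) (model_act x (Poly_Mapping.single (b, k) 1)))"
    by (simp only: model.act_mult model_act_single[OF j, of y] model_act_sum) (simp only:
        model_sm[symmetric] model.act_sm)
  then show ?thesis by (simp add: entry_def[of "x * y"] lookup_sum) (simp add: entry_def mult.commute)
qed

lemma entry_add: "entry (x + y) b i j = entry x b i j + entry y b i j"
  by (simp add: entry_def model.act_simps lookup_add)
lemma entry_diff: "entry (x - y) b i j = entry x b i j - entry y b i j"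
  by (simp add: entry_def model.act_simps lookup_minus)
lemma entry_one: "entry 1 b i j = (if i = j then 1 else 0)"
  by (simp add: entry_def model.act_simps lookup_single when_def)
lemma entry_scal: "entry (scal c * x) b i j = c * entry x b i j"
  by (simp add: entry_def model.act_simps model_sm)
lemma entry_0: "entry 0 b i j = 0"
  by (simp add: entry_def)

definition annihilator :: "nat \<Rightarrow> free set" where
  "annihilator d = {x. \<forall>b\<in>blocks d. \<forall>i<block_size b. \<forall>j<block_size b. entry x b i j = 0}"

lemma annihilator_mult: "x \<in> annihilator d \<Longrightarrow> x * y \<in> annihilator d" "x \<in> annihilator d
    \<Longrightarrow> y * x \<in> annihilator d"
  by (simp_all add: annihilator_def entry_mult)

lemma annihilator_add: "x \<in> annihilator d \<Longrightarrow> y \<in> annihilator d \<Longrightarrow> x + y \<in> annihilator d"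
  by (simp add: annihilator_def entry_add)

lemma annihilator_act:
  assumes "x \<in> annihilator d" "b \<in> blocks d" "j < block_size b"
  shows "model_act x (Poly_Mapping.single (b, j) 1) = 0"
  using assms by (simp add: model_act_single annihilator_def)

lemma mem_I_set: "m \<in> I_set (int d) \<longleftrightarrow> int m \<in> weights d" "m \<in> I_set (int d - 2) \<longleftrightarrow> int m \<in> weights d \<and> m \<noteq> d"
proof -
  have 1: "a mod 2 = b mod 2 \<longleftrightarrow> even (a + b)" for a b :: int by presburger
  show "m \<in> I_set (int d) \<longleftrightarrow> int m \<in> weights d"
    unfolding I_set_def weights_iff mem_Collect_eq 1 by simp
  have 2: "even (a + (b - 2)) \<longleftrightarrow> even (a + b)" for a b :: int by presburger
  have 3: "a \<le> b - 2 \<and> even (a + b) \<longleftrightarrow> a \<le> b \<and> even (a + b) \<and> a \<noteq> b" for a b :: int by presburger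
  show "m \<in> I_set (int d - 2) \<longleftrightarrow> int m \<in> weights d \<and> m \<noteq> d"
    unfolding I_set_def weights_iff mem_Collect_eq 1 2 3 by auto
qed

context bounded_mir_module begin

text \<open>The linear map from a block to the module at hand that sends the basis vector with index \<open>j\<close>
  to \<open>t j\<close>. Every family of the right shape is the image of the block under such a map, and so it is
  killed by whatever kills the block.\<close>

definition comparison :: "block \<Rightarrow> (nat \<Rightarrow> 'b) \<Rightarrow> model \<Rightarrow> 'b" where
  "comparison b t = lin_ext sm (\<lambda>(b', j). if b' = b \<and> j < block_size b then t j else 0)"

lemma comparison_add: "comparison b t (v + w) = comparison b t v + comparison b t w"
  and comparison_scale: "comparison b t (pm_scale c w) = c *\<^sub>s comparison b t w"
  and comparison_0 [simp]: "comparison b t 0 = 0"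
  unfolding comparison_def by (rule lin_ext_add, rule lin_ext_pm_scale[OF vector_space_axioms], rule
      lin_ext_0)

lemma comparison_uv: "comparison b t (uv b i) = (if 0 \<le> i \<and> nat i < block_size b then t (nat i) else 0)"
  by (simp add: uv_def comparison_def)

lemma comparison_annihilates:
  assumes "\<And>g j. j < block_size b \<Longrightarrow> comparison b t (model_col g b j) = act (fgen g) (t j)"
    and b: "b \<in> blocks d" "0 < block_size b" and x: "x \<in> annihilator d"
  shows "act x (t 0) = 0"
proof -
  have "comparison b t (model_gen g w) = act (fgen g) (comparison b t w)" for g w
  proof (induction w rule: poly_mapping_induct_add)
    case (single p c)
    obtain b' j where p: "p = (b', j)" by (cases p)
    have *: "comparison b t (Poly_Mapping.single (b', j) c) = (if b' = b \<and> j < block_size b then c *\<^sub>s t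
        j else 0)"
      by (simp add: comparison_def)
    show ?case
    proof (cases "b' = b \<and> j < block_size b")
      case True
      then show ?thesis unfolding p * model_gen_single by (simp add: comparison_scale assms(1))
    next
      case False
      have "comparison b t (model_gen g (Poly_Mapping.single (b', j) c)) = 0"
      proof (cases "b' = b")
        case True with False show ?thesis by (simp add: model_gen_single)
      next
        case neq: False
        have "comparison b t w = 0" if "w \<in> block_part b'" for w
          unfolding comparison_def lin_ext_def
          by (rule sum.neutral) (use that neq in \<open>auto simp: in_keys_iff dest: block_part_D\<close>)
        moreover have "model_gen g (Poly_Mapping.single (b', j) c) \<in> block_part b'"
          by (simp add: model_gen_single block_part_model_col block_part_scale)
        ultimately show ?thesis by blast
      qed
      moreover have "comparison b t (Poly_Mapping.single (b', j) c) = 0"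
        unfolding * using False by (rule if_not_P)
      ultimately show ?thesis unfolding p by (simp only: act_0)
    qed
  next
    case (add v w) then show ?case by (simp only: model_gen_add comparison_add act_add)
  next
    case zero show ?case by simp
  qed
  then have "comparison b t (model_act x w) = act x (comparison b t w)" for w
    by - (rule intertwiner[OF model.free_module_axioms free_module_axioms],
        simp_all only: comparison_add model_sm comparison_scale model_act_fgen)
  from this[of "Poly_Mapping.single (b, 0) 1"] have "act x (comparison b t (Poly_Mapping.single (b, 0)
      1)) = 0"
    using annihilator_act[OF x b] by simp
  then show ?thesis using b by (simp add: comparison_def)
qed

lemma Lplus_family_annihilated:
  assumes u: "Lplus_family (int m) \<delta> u" and b: "b \<in> blocks d" "block_size b = m + 1" "\<And>g i. model_col g
      b i = colL (int m) \<delta> (uv b) g (int i)"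
    and x: "x \<in> annihilator d"
  shows "act x (u 0) = 0"
proof -
  let ?t = "\<lambda>j. u (int j)"
  have uv: "comparison b ?t (uv b i) = u i" for i
    using u b(2) by (auto simp: comparison_uv Lplus_family_def)
  have "act x (?t 0) = 0"
  proof (rule comparison_annihilates[OF _ b(1) _ x])
    fix g j assume "j < block_size b"
    show "comparison b ?t (model_col g b j) = act (fgen g) (?t j)"
      using u unfolding b(3) by (cases g) (simp_all add: comparison_scale uv Lplus_family_def wt_def)
  qed (simp add: b)
  then show ?thesis by simp
qed

lemma Rosso_family_annihilated:
  assumes zy: "Rosso_family (int m) z y" and b: "B01 m \<in> blocks d" and m: "m \<ge> 1" and x: "x \<in> annihilator d"
  shows "act x (z 0) = 0"
proof -
  let ?t = "\<lambda>j. if j < m then z (int j) else y (int j - int m + 1)"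
  have zv: "comparison (B01 m) ?t (zv m i) = z i" for i
    using zy by (auto simp: zv_def comparison_uv Rosso_family_def)
  have yv: "comparison (B01 m) ?t (yv m i) = y i" for i
    using zy by (auto simp: yv_def comparison_uv Rosso_family_def nat_less_iff)
  have "act x (?t 0) = 0"
  proof (rule comparison_annihilates[OF _ b _ x])
    fix g j
    show "comparison (B01 m) ?t (model_col g (B01 m) j) = act (fgen g) (?t j)"
      using zy by (cases g) (simp_all add: comparison_add comparison_scale zv yv Rosso_family_def wt_def)
  qed (use m in simp)
  then show ?thesis using m by simp
qed

text \<open>The vectors killed by the annihilator form a submodule, because the annihilator is a right
  ideal. It contains the top vectors of all families, hence it is everything.\<close>

theorem annihilator_faithful:
  assumes w: "w \<in> S" and x: "x \<in> annihilator d"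
  shows "act x w = 0"
proof -
  let ?N = "{w \<in> S. \<forall>x \<in> annihilator d. act x w = 0}"
  have "w \<in> ?N"
  proof (rule generated_by_families[OF _ _ _ _ w])
    show "submod ?N"
      unfolding submod_def using annihilator_mult(1)
      by (auto simp: S_add act_add simp flip: act_mult)
    show "u 0 \<in> ?N" if "0 \<le> n" "n \<in> weights d" "range u \<subseteq> S" "Lplus_family n 1 u" for n u
      using that Lplus_family_annihilated[of "nat n" 1 u "B1 (nat n)"] by (auto simp: blocks_def mem_I_set)
    show "u 0 \<in> ?N" if "0 \<le> n" "n \<in> weights d" "n \<noteq> int d" "range u \<subseteq> S" "Lplus_family n 0 u" for n u
      using that Lplus_family_annihilated[of "nat n" 0 u "B0 (nat n)"] by (auto simp: blocks_def mem_I_set)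
    show "z 0 \<in> ?N" if "1 \<le> n" "n \<in> weights d" "range z \<subseteq> S" "range y \<subseteq> S" "Rosso_family n z y" for n z y
      using that Rosso_family_annihilated[of "nat n" z y] by (auto simp: blocks_def mem_I_set)
  qed
  with x show ?thesis by simp
qed

end

section \<open>Quotient algebras and the kernel of the projection to U(2,d)\<close>

text \<open>The operations of a quotient algebra, computed on representatives. Everything about \<open>U(2,d)\<close>,
  a quotient of a quotient, is then phrased in the free algebra.\<close>

lemma quot_algebra_select:
  "carrier (quot_algebra A I) = a_rcosets\<^bsub>A\<^esub> I" "zero (quot_algebra A I) = I"
  "one (quot_algebra A I) = I +>\<^bsub>A\<^esub> \<one>\<^bsub>A\<^esub>"
  "add (quot_algebra A I) = set_add A" "mult (quot_algebra A I) = rcoset_mult A I"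
  "module.smult (quot_algebra A I) = (\<lambda>c X. \<Union>x\<in>X. I +>\<^bsub>A\<^esub> (c \<odot>\<^bsub>A\<^esub> x))"
  by (simp_all add: quot_algebra_def FactRing_def ring.extend_def module.fields_def)

context
  fixes A :: "('k::field, 'a) module" and I :: "'a set"
  assumes A: "is_algebra A" and I: "ideal I A"
begin

interpretation A: ring A using A by (simp add: is_algebra_def)
interpretation V: vectorspace class_ring A using A by (simp add: is_algebra_def)
interpretation I: ideal I A by (rule I)

lemma quot_algebra_carrier: "carrier (quot_algebra A I) = (\<lambda>x. I +>\<^bsub>A\<^esub> x) ` carrier A"
  by (auto simp: quot_algebra_select A_RCOSETS_def')

lemma coset_eq_iff:
  assumes "x \<in> carrier A" "y \<in> carrier A"
  shows "I +>\<^bsub>A\<^esub> x = I +>\<^bsub>A\<^esub> y \<longleftrightarrow> x \<ominus>\<^bsub>A\<^esub> y \<in> I"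
  using A.quotient_eq_iff_same_a_r_cos[OF I] assms by blast

lemma ideal_smult: "x \<in> I \<Longrightarrow> c \<odot>\<^bsub>A\<^esub> x \<in> I"
proof -
  assume x: "x \<in> I"
  then have xc: "x \<in> carrier A" by (rule I.Icarr)
  have "c \<odot>\<^bsub>A\<^esub> x = (c \<odot>\<^bsub>A\<^esub> \<one>\<^bsub>A\<^esub>) \<otimes>\<^bsub>A\<^esub> x"
    using A xc unfolding is_algebra_def by (metis A.l_one A.one_closed)
  moreover have "c \<odot>\<^bsub>A\<^esub> \<one>\<^bsub>A\<^esub> \<in> carrier A" by simp
  ultimately show ?thesis using x I.I_l_closed by simp
qed

lemma quot_algebra_ops:
  assumes "x \<in> carrier A" "y \<in> carrier A"
  shows "(I +>\<^bsub>A\<^esub> x) \<oplus>\<^bsub>quot_algebra A I\<^esub> (I +>\<^bsub>A\<^esub> y) = I +>\<^bsub>A\<^esub> (x \<oplus>\<^bsub>A\<^esub> y)"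
    "(I +>\<^bsub>A\<^esub> x) \<otimes>\<^bsub>quot_algebra A I\<^esub> (I +>\<^bsub>A\<^esub> y) = I +>\<^bsub>A\<^esub> (x \<otimes>\<^bsub>A\<^esub> y)"
proof -
  show "(I +>\<^bsub>A\<^esub> x) \<oplus>\<^bsub>quot_algebra A I\<^esub> (I +>\<^bsub>A\<^esub> y) = I +>\<^bsub>A\<^esub> (x \<oplus>\<^bsub>A\<^esub> y)"
    by (simp add: quot_algebra_select I.a_rcos_sum assms)
  show "(I +>\<^bsub>A\<^esub> x) \<otimes>\<^bsub>quot_algebra A I\<^esub> (I +>\<^bsub>A\<^esub> y) = I +>\<^bsub>A\<^esub> (x \<otimes>\<^bsub>A\<^esub> y)"
    by (simp add: quot_algebra_select I.rcoset_mult_add assms)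
qed

lemma quot_algebra_smult:
  assumes "x \<in> carrier A"
  shows "c \<odot>\<^bsub>quot_algebra A I\<^esub> (I +>\<^bsub>A\<^esub> x) = I +>\<^bsub>A\<^esub> (c \<odot>\<^bsub>A\<^esub> x)"
proof -
  have "I +>\<^bsub>A\<^esub> (c \<odot>\<^bsub>A\<^esub> x') = I +>\<^bsub>A\<^esub> (c \<odot>\<^bsub>A\<^esub> x)" if "x' \<in> I +>\<^bsub>A\<^esub> x" for x'
  proof -
    have x': "x' \<in> carrier A" using that I.a_elemrcos_carrier assms by blast
    have "I +>\<^bsub>A\<^esub> x' = I +>\<^bsub>A\<^esub> x" using I.a_repr_independence'[OF that assms] by simp
    then have "x' \<ominus>\<^bsub>A\<^esub> x \<in> I" using coset_eq_iff x' assms by blast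
    then have "c \<odot>\<^bsub>A\<^esub> (x' \<ominus>\<^bsub>A\<^esub> x) \<in> I" by (rule ideal_smult)
    moreover have "c \<odot>\<^bsub>A\<^esub> (x' \<ominus>\<^bsub>A\<^esub> x) = c \<odot>\<^bsub>A\<^esub> x' \<ominus>\<^bsub>A\<^esub> c \<odot>\<^bsub>A\<^esub> x"
      using x' assms by (simp add: a_minus_def V.smult_r_distr V.smult_r_minus)
    ultimately show ?thesis using x' assms by (simp add: coset_eq_iff)
  qed
  moreover have "x \<in> I +>\<^bsub>A\<^esub> x" using I.a_rcos_self assms by blast
  ultimately show "c \<odot>\<^bsub>quot_algebra A I\<^esub> (I +>\<^bsub>A\<^esub> x) = I +>\<^bsub>A\<^esub> (c \<odot>\<^bsub>A\<^esub> x)"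
    unfolding quot_algebra_select by blast
qed

lemma quot_algebra_is_algebra: "is_algebra (quot_algebra A I)"
proof -
  let ?Q = "quot_algebra A I"
  have zero: "zero ?Q = I +>\<^bsub>A\<^esub> \<zero>\<^bsub>A\<^esub>"
    using I.a_rcos_const[OF I.zero_closed] by (simp add: quot_algebra_select)
  have ring: "ring ?Q"
  proof (rule ringI)
    show "abelian_group ?Q"
    proof (rule abelian_groupI)
      fix X assume "X \<in> carrier ?Q"
      then obtain x where x: "x \<in> carrier A" "X = I +>\<^bsub>A\<^esub> x" by (auto simp: quot_algebra_carrier)
      show "\<exists>Y\<in>carrier ?Q. Y \<oplus>\<^bsub>?Q\<^esub> X = \<zero>\<^bsub>?Q\<^esub>"
        using x by (intro bexI[of _ "I +>\<^bsub>A\<^esub> (\<ominus>\<^bsub>A\<^esub> x)"]) (auto simp: quot_algebra_ops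
            quot_algebra_carrier zero A.l_neg)
    qed (auto simp: quot_algebra_carrier quot_algebra_ops zero A.add.m_ac)
    show "Group.monoid ?Q"
      by (rule monoidI) (auto simp: quot_algebra_carrier quot_algebra_ops quot_algebra_select(3) A.m_assoc)
  qed (auto simp: quot_algebra_carrier quot_algebra_ops A.l_distr A.r_distr)
  have "vectorspace class_ring ?Q"
  proof -
    interpret Q': ring ?Q by (rule ring)
    have smult: "(a + b) \<odot>\<^bsub>A\<^esub> x = a \<odot>\<^bsub>A\<^esub> x \<oplus>\<^bsub>A\<^esub> b \<odot>\<^bsub>A\<^esub> x" "(a * b) \<odot>\<^bsub>A\<^esub> x = a \<odot>\<^bsub>A\<^esub> (b \<odot>\<^bsub>A\<^esub> x)" "1 \<odot>\<^bsub>A\<^esub> x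
        = x"
      if "x \<in> carrier A" for a b x
      using that V.smult_l_distr[of a b x] V.smult_assoc1[of a b x] V.smult_one[of x] by simp_all
    have "Module.module class_ring ?Q"
      by (rule Module.moduleI[OF class_cring.is_cring Q'.abelian_group_axioms])
        (auto simp: quot_algebra_carrier quot_algebra_ops quot_algebra_smult smult V.smult_r_distr)
    then show ?thesis using class_field[where 'a = 'k] by (simp add: vectorspace_def)
  qed
  with ring A show ?thesis
    unfolding is_algebra_def by (auto simp: quot_algebra_carrier quot_algebra_ops quot_algebra_smult)
qed

end

lemma free_algebra_select [simp]:
  "carrier free_algebra = UNIV" "mult free_algebra = (*)" "one free_algebra = 1" "zero free_algebra = 0"
  "add free_algebra = (+)" "module.smult free_algebra = (\<lambda>c x. scal c * x)"
  by (simp_all add: free_algebra_def)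

lemma free_algebra_is_algebra: "is_algebra free_algebra"
proof -
  have inv: "\<exists>y. x + y = 0" for x :: free by (rule exI[of _ "- x"]) simp
  have ring: "ring free_algebra"
    by (rule ringI; (rule abelian_groupI monoidI)?) (auto simp: algebra_simps inv)
  have "Module.module class_ring free_algebra"
  proof -
    interpret ring free_algebra by (rule ring)
    show ?thesis
      by (rule Module.moduleI[OF class_cring.is_cring abelian_group_axioms]) (auto simp: algebra_simps)
  qed
  moreover have "x * (scal c * y) = scal c * (x * y)" for c and x y :: free
    by (metis mult.assoc scal_commute)
  ultimately show ?thesis using ring class_field[where 'a = K] unfolding is_algebra_def vectorspace_def
    by (simp add: mult.assoc)
qed

interpretation FA: ring free_algebra
  using free_algebra_is_algebra by (simp add: is_algebra_def)

lemma free_a_inv [simp]: "\<ominus>\<^bsub>free_algebra\<^esub> x = - x"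
  by (rule FA.minus_equality) simp_all

lemma free_a_minus [simp]: "x \<ominus>\<^bsub>free_algebra\<^esub> y = x - y"
  by (simp add: a_minus_def)

lemma free_idealI:
  assumes "0 \<in> I" "\<And>x y. x \<in> I \<Longrightarrow> y \<in> I \<Longrightarrow> x + y \<in> I" "\<And>x y. x \<in> I \<Longrightarrow> y * x \<in> I" "\<And>x y. x \<in> I \<Longrightarrow> x * y \<in> I"
  shows "ideal I free_algebra"
proof (rule idealI)
  show "subgroup I (add_monoid free_algebra)"
  proof (rule FA.add.subgroupI)
    fix a assume "a \<in> I" then show "\<ominus>\<^bsub>free_algebra\<^esub> a \<in> I" using assms(3)[of a "-1"] by simp
  qed (use assms in auto)
qed (use assms in \<open>auto intro: FA.ring_axioms\<close>)

lemma mir_ideal: "ideal mir_ideal free_algebra"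
  unfolding mir_ideal_def by (rule FA.genideal_ideal) simp

lemma mir_ideal_self: "mir_relators \<subseteq> mir_ideal"
  unfolding mir_ideal_def by (rule FA.genideal_self) simp

lemma Umir_is_algebra: "is_algebra Umir"
  unfolding Umir_def by (rule quot_algebra_is_algebra[OF free_algebra_is_algebra mir_ideal])

lemma Umir_carrier: "carrier Umir = range mir_class"
  unfolding Umir_def mir_class_def[abs_def] quot_algebra_carrier[OF free_algebra_is_algebra mir_ideal]
      by simp

lemma mir_class_ops:
  "mir_class x \<oplus>\<^bsub>Umir\<^esub> mir_class y = mir_class (x + y)" "mir_class x \<otimes>\<^bsub>Umir\<^esub> mir_class y
      = mir_class (x * y)"
  "c \<odot>\<^bsub>Umir\<^esub> mir_class x = mir_class (scal c * x)" "\<one>\<^bsub>Umir\<^esub> = mir_class 1" "\<zero>\<^bsub>Umir\<^esub> = mir_class 0"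
proof -
  show "\<zero>\<^bsub>Umir\<^esub> = mir_class 0"
  proof -
    interpret ideal mir_ideal free_algebra by (rule mir_ideal)
    have "mir_ideal +>\<^bsub>free_algebra\<^esub> 0 = mir_ideal" using FA.a_rcos_zero[OF mir_ideal zero_closed] by simp
    then show ?thesis by (simp add: Umir_def mir_class_def quot_algebra_select)
  qed
qed (simp_all add: Umir_def mir_class_def quot_algebra_ops[OF free_algebra_is_algebra mir_ideal]
    quot_algebra_smult[OF free_algebra_is_algebra mir_ideal] quot_algebra_select(3))

lemma mir_class_eq_iff: "mir_class x = mir_class y \<longleftrightarrow> x - y \<in> mir_ideal"
  unfolding mir_class_def using coset_eq_iff[OF free_algebra_is_algebra mir_ideal, of x y] by simp

interpretation Um: ring Umir using Umir_is_algebra by (simp add: is_algebra_def)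

lemma U2_ideal: "ideal (U2_ideal d) Umir"
  unfolding U2_ideal_def by (rule Um.genideal_ideal) (auto simp: Umir_carrier)

lemma U2_is_algebra: "is_algebra (U2 d)"
  unfolding U2_def by (rule quot_algebra_is_algebra[OF Umir_is_algebra U2_ideal])

definition U2_proj :: "nat \<Rightarrow> free \<Rightarrow> free set set" where "U2_proj d x = U2_class d (mir_class x)"

definition U2_kernel :: "nat \<Rightarrow> free set" where "U2_kernel d = {x. mir_class x \<in> U2_ideal d}"

lemma U2_carrier: "carrier (U2 d) = range (U2_proj d)"
  unfolding U2_def quot_algebra_carrier[OF Umir_is_algebra U2_ideal] Umir_carrier
  by (auto simp: U2_proj_def U2_class_def)

lemma mir_class_minus: "mir_class x \<ominus>\<^bsub>Umir\<^esub> mir_class y = mir_class (x - y)"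
proof -
  have "\<ominus>\<^bsub>Umir\<^esub> mir_class y = mir_class (- y)"
    by (rule Um.minus_equality) (auto simp: mir_class_ops Umir_carrier)
  then show ?thesis by (simp add: a_minus_def mir_class_ops)
qed

lemma U2_proj_ops:
  "U2_proj d x \<oplus>\<^bsub>U2 d\<^esub> U2_proj d y = U2_proj d (x + y)" "U2_proj d x \<otimes>\<^bsub>U2 d\<^esub> U2_proj d y
      = U2_proj d (x * y)"
  "c \<odot>\<^bsub>U2 d\<^esub> U2_proj d x = U2_proj d (scal c * x)" "\<one>\<^bsub>U2 d\<^esub> = U2_proj d 1"
  by (simp_all add: U2_def U2_proj_def U2_class_def quot_algebra_ops[OF Umir_is_algebra U2_ideal]
      quot_algebra_smult[OF Umir_is_algebra U2_ideal] quot_algebra_select(3)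
      Umir_carrier mir_class_ops)

lemma U2_proj_eq_iff: "U2_proj d x = U2_proj d y \<longleftrightarrow> x - y \<in> U2_kernel d"
  unfolding U2_proj_def U2_class_def U2_kernel_def
  using coset_eq_iff[OF Umir_is_algebra U2_ideal, of "mir_class x" "mir_class y" d]
  by (simp add: Umir_carrier mir_class_minus)

lemma U2_kernel_closed:
  "0 \<in> U2_kernel d" "x \<in> U2_kernel d \<Longrightarrow> y \<in> U2_kernel d \<Longrightarrow> x + y \<in> U2_kernel d" "x \<in> U2_kernel d
      \<Longrightarrow> y * x \<in> U2_kernel d" "x \<in> U2_kernel d \<Longrightarrow> x * y \<in> U2_kernel d"
proof -
  interpret ideal "U2_ideal d" Umir by (rule U2_ideal)
  show "0 \<in> U2_kernel d" using zero_closed by (simp add: U2_kernel_def mir_class_ops)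
  show "x \<in> U2_kernel d \<Longrightarrow> y \<in> U2_kernel d \<Longrightarrow> x + y \<in> U2_kernel d"
    using a_closed[of "mir_class x" "mir_class y"] by (simp add: U2_kernel_def mir_class_ops)
  show "x \<in> U2_kernel d \<Longrightarrow> y * x \<in> U2_kernel d" "x \<in> U2_kernel d \<Longrightarrow> x * y \<in> U2_kernel d"
    using I_l_closed[of "mir_class x" "mir_class y"] I_r_closed[of "mir_class x" "mir_class y"]
    by (simp_all add: U2_kernel_def mir_class_ops Umir_carrier)
qed

lemma U2_kernel_relators: "mir_relators \<subseteq> U2_kernel d"
proof
  fix r assume "r \<in> mir_relators"
  then have "mir_class r = mir_class 0" using mir_ideal_self by (auto simp: mir_class_eq_iff)
  then show "r \<in> U2_kernel d" using U2_kernel_closed(1)[of d] by (simp add: U2_kernel_def)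
qed

lemma U2_kernel_PQ: "P_poly d \<in> U2_kernel d" "(Fl - 1) * Q_poly d \<in> U2_kernel d"
proof -
  have "{mir_class (P_poly d), mir_class ((Fl - 1) * Q_poly d)} \<subseteq> U2_ideal d"
    unfolding U2_ideal_def by (rule Um.genideal_self) (auto simp: Umir_carrier)
  then show "P_poly d \<in> U2_kernel d" "(Fl - 1) * Q_poly d \<in> U2_kernel d" by (auto simp: U2_kernel_def)
qed

text \<open>An ideal \<open>I\<close> of the free algebra that contains the relators contains \<open>mir_ideal\<close>, and its
  image in the mirabolic algebra is an ideal containing the two further generators.\<close>

lemma U2_kernel_minimal:
  assumes I: "0 \<in> I" "\<And>x y. x \<in> I \<Longrightarrow> y \<in> I \<Longrightarrow> x + y \<in> I" "\<And>x y. x \<in> I \<Longrightarrow> y * x \<in> I" "\<And>x y. x \<in> I \<Longrightarrow> x * y \<in> I"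
    and rel: "mir_relators \<subseteq> I" and PQ: "P_poly d \<in> I" "(Fl - 1) * Q_poly d \<in> I"
  shows "U2_kernel d \<subseteq> I"
proof
  fix x assume "x \<in> U2_kernel d"
  have mir: "mir_ideal \<subseteq> I"
    unfolding mir_ideal_def by (rule FA.genideal_minimal[OF free_idealI[OF I] rel])
  have "ideal (mir_class ` I) Umir"
  proof (rule idealI)
    show "subgroup (mir_class ` I) (add_monoid Umir)"
    proof (rule Um.add.subgroupI)
      fix a assume "a \<in> mir_class ` I"
      then obtain x where x: "a = mir_class x" "x \<in> I" by blast
      then have "\<ominus>\<^bsub>Umir\<^esub> a = mir_class (- x)"
        by (intro Um.minus_equality) (auto simp: mir_class_ops Umir_carrier)
      moreover have "- x \<in> I" using I(3)[OF x(2), of "-1"] by simp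
      ultimately show "\<ominus>\<^bsub>Umir\<^esub> a \<in> mir_class ` I" by blast
    qed (use I in \<open>auto simp: Umir_carrier mir_class_ops\<close>)
  qed (use I in \<open>auto simp: Umir_carrier mir_class_ops intro: Um.ring_axioms\<close>)
  then have "U2_ideal d \<subseteq> mir_class ` I"
    unfolding U2_ideal_def by (rule Um.genideal_minimal) (use PQ in auto)
  with \<open>x \<in> U2_kernel d\<close> obtain y where y: "y \<in> I" "mir_class x = mir_class y" by (auto simp: U2_kernel_def)
  then have "x - y \<in> I" using mir by (auto simp: mir_class_eq_iff)
  from I(2)[OF this y(1)] show "x \<in> I" by simp
qed

lemma single_eq_uv: "j < block_size b \<Longrightarrow> Poly_Mapping.single (b, j) 1 = uv b (int j)"
  by (simp add: uv_def)

lemma basis_B01: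
  assumes "j < 2 * m"
  shows "Poly_Mapping.single (B01 m, j) 1 = (if j < m then zv m (int j) else yv m (int j - int m + 1))"
  using assms by (simp add: zv_def yv_def uv_def)

text \<open>The eigenvalues of \<open>k\<close> (as exponents of \<open>v\<close>) and of \<open>l\<close> on the basis vectors.\<close>

fun basis_weight :: "block \<Rightarrow> nat \<Rightarrow> int" where
  "basis_weight (B1 m) j = int m - 2 * int j"
| "basis_weight (B0 m) j = int m - 2 * int j"
| "basis_weight (B01 m) j = (if j < m then int m - 2 * int j else int m - 2 * (int j - int m + 1))"

fun basis_ell :: "block \<Rightarrow> nat \<Rightarrow> nat" where
  "basis_ell (B1 m) j = 1"
| "basis_ell (B0 m) j = 0"
| "basis_ell (B01 m) j = (if j < m then 0 else 1)"

abbreviation basis_vec :: "block \<Rightarrow> nat \<Rightarrow> model" where "basis_vec b j \<equiv> Poly_Mapping.single (b, j) 1"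

lemma basis_vec_wt: assumes "j < block_size b" shows "model.wt (basis_weight b j) (basis_vec b j)"
proof (cases b)
  case (B01 m)
  have "model.wt (int m - 2 * i) (zv m i)" "model.wt (int m - 2 * i) (yv m i)" for i
    using model_Rosso_family[of m] by (simp_all only: model.Rosso_family_def)
  from this(1)[of "int j"] this(2)[of "int j - int m + 1"] show ?thesis
    using B01 assms by (cases "j < m") (simp_all add: basis_B01)
qed (use assms model_Lplus_family_0 model_Lplus_family_1 in \<open>auto simp: single_eq_uv
    model.Lplus_family_def simp del: block_size.simps\<close>)

lemma basis_vec_l: assumes "j < block_size b" shows "model.l (basis_vec b j)
    = pm_scale (of_nat (basis_ell b j)) (basis_vec b j)"
proof (cases b)
  case (B01 m)
  then show ?thesis using assms model_Rosso_family[of m]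
      by (auto simp: basis_B01 model.Rosso_family_def simp del: pm_scale_single)
qed (use assms model_Lplus_family_0 model_Lplus_family_1 in \<open>auto simp: single_eq_uv
    model.Lplus_family_def model_sm simp del: block_size.simps\<close>)

lemma basis_vec_relators: assumes "j < block_size b" "r \<in> mir_relators"
    shows "model_act r (basis_vec b j) = 0"
proof (cases b)
  case (B01 m)
  then show ?thesis using assms model.relators_Rosso_family[OF model_Rosso_family[of m]]
      by (auto simp: basis_B01)
qed (use assms model.relators_Lplus_family[OF model_Lplus_family_0] model.relators_Lplus_family[OF
    model_Lplus_family_1] in \<open>auto simp: single_eq_uv simp del: block_size.simps\<close>)

lemma basis_weight_in_weights: assumes "b \<in> blocks d" "j < block_size b"
    shows "basis_weight b j \<in> weights d"
  using assms by (auto simp: blocks_def mem_I_set weights_iff split: if_splits)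

text \<open>In \<open>L\<^sup>+(m,01)\<close> the weight \<open>- m\<close> occurs only in the image of \<open>l\<close>, and \<open>L\<^sup>+(d,0)\<close> is not among
  the blocks. This is why \<open>(l - 1) Q_d(k)\<close> vanishes on all of them.\<close>

lemma basis_weight_lowest: assumes "b \<in> blocks d" "j < block_size b" "basis_ell b j = 0"
    shows "basis_weight b j \<noteq> - int d"
  using assms by (auto simp: blocks_def mem_I_set weights_iff split: if_splits)

lemma prod_list_zero: "x \<in> set xs \<Longrightarrow> x = 0 \<Longrightarrow> prod_list xs = (0 :: K)"
  by (auto simp: prod_list_zero_iff)

lemma annihilatorI: "(\<And>b j. b \<in> blocks d \<Longrightarrow> j < block_size b \<Longrightarrow> model_act x (basis_vec b j) = 0)
    \<Longrightarrow> x \<in> annihilator d"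
  by (simp add: annihilator_def entry_def)

lemma annihilator_PQ: "P_poly d \<in> annihilator d" "(Fl - 1) * Q_poly d \<in> annihilator d"
proof -
  show "P_poly d \<in> annihilator d"
  proof (rule annihilatorI)
    fix b j assume b: "b \<in> blocks d" "j < block_size b"
    then obtain r where r: "basis_weight b j = 2 * int r - int d" "r \<le> d"
        using basis_weight_in_weights[OF b] by (auto simp: weights_def)
    show "model_act (P_poly d) (basis_vec b j) = 0"
      unfolding P_poly_kprod model.act_kprod[OF basis_vec_wt[OF b(2)]]
      by (subst prod_list_zero[of 0]) (use r in \<open>auto simp del: upt_Suc simp: image_iff\<close>)
  qed
  show "(Fl - 1) * Q_poly d \<in> annihilator d"
  proof (rule annihilatorI)
    fix b j assume b: "b \<in> blocks d" "j < block_size b"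
    show "model_act ((Fl - 1) * Q_poly d) (basis_vec b j) = 0"
    proof (cases "basis_ell b j = 0")
      case True
      obtain r where r: "basis_weight b j = 2 * int r - int d" "r \<le> d"
          using basis_weight_in_weights[OF b] by (auto simp: weights_def)
      moreover have "1 \<le> r" using basis_weight_lowest[OF b True] r by (cases r) auto
      ultimately have "model_act (Q_poly d) (basis_vec b j) = 0"
        unfolding Q_poly_kprod model.act_kprod[OF basis_vec_wt[OF b(2)]]
        by (subst prod_list_zero[of 0]) (auto simp del: upt_Suc simp: image_iff)
      then show ?thesis by (simp add: model.act_mult)
    next
      case False
      then have "basis_ell b j = 1" by (cases b) (auto split: if_splits)
      then have "model_act (Fl - 1) (basis_vec b j) = 0" using basis_vec_l[OF b(2)]
          by (simp add: model.act_simps)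
      then show ?thesis
        unfolding Q_poly_kprod by (simp only: model.act_mult model.act_kprod[OF basis_vec_wt[OF b(2)]]
            model.act_sm) simp
    qed
  qed
qed

lemma U2_kernel_annihilator: "U2_kernel d \<subseteq> annihilator d"
proof (rule U2_kernel_minimal)
  show "mir_relators \<subseteq> annihilator d" by (auto intro!: annihilatorI basis_vec_relators)
  show "0 \<in> annihilator d" by (simp add: annihilatorI)
qed (simp_all add: annihilator_add annihilator_mult annihilator_PQ)

section \<open>Faithfulness on the blocks\<close>

lemma U2_kernel_diff: "x \<in> U2_kernel d \<Longrightarrow> y \<in> U2_kernel d \<Longrightarrow> x - y \<in> U2_kernel d"
  using U2_kernel_closed(2)[of x d "- 1 * y"] U2_kernel_closed(3)[of y d "- 1"] by simp

lemma U2_kernel_minus: "x \<in> U2_kernel d \<Longrightarrow> - x \<in> U2_kernel d"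
  using U2_kernel_closed(3)[of x d "- 1"] by simp

lemma U2_kernel_diff_diff: "a - b \<in> U2_kernel d \<Longrightarrow> a' - b' \<in> U2_kernel d \<Longrightarrow> a - a' - (b - b') \<in> U2_kernel d"
  using U2_kernel_diff[of "a - b" d "a' - b'"] by (simp add: algebra_simps)

text \<open>The product of the left regular modules of all \<open>U(2,d)\<close>. A quotient type cannot depend on \<open>d\<close>,
  but the product over all \<open>d\<close> does not, and each \<open>U(2,d)\<close> is found in it as a component.\<close>

quotient_type U2_prod = "nat \<Rightarrow> free" / "\<lambda>x y. \<forall>d. x d - y d \<in> U2_kernel d"
proof (rule equivpI)
  show "reflp (\<lambda>x y. \<forall>d. x d - y d \<in> U2_kernel d)" by (simp add: reflp_def U2_kernel_closed)
  show "symp (\<lambda>x y. \<forall>d. x d - y d \<in> U2_kernel d)"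
    unfolding symp_def using U2_kernel_minus by fastforce
  show "transp (\<lambda>x y. \<forall>d. x d - y d \<in> U2_kernel d)"
    unfolding transp_def using U2_kernel_closed(2) by fastforce
qed

instantiation U2_prod :: ab_group_add
begin

lift_definition zero_U2_prod :: U2_prod is "\<lambda>d. 0" .
lift_definition plus_U2_prod :: "U2_prod \<Rightarrow> U2_prod \<Rightarrow> U2_prod" is "\<lambda>x y d. x d + y d"
  using U2_kernel_closed(2) by (fastforce simp: add_diff_add)
lift_definition uminus_U2_prod :: "U2_prod \<Rightarrow> U2_prod" is "\<lambda>x d. - x d"
  using U2_kernel_minus by fastforce
lift_definition minus_U2_prod :: "U2_prod \<Rightarrow> U2_prod \<Rightarrow> U2_prod" is "\<lambda>x y d. x d - y d"
  by (simp add: U2_kernel_diff_diff)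

instance by standard (transfer, simp add: U2_kernel_closed algebra_simps)+

end

lemma U2_prod_rep: obtains g where "w = abs_U2_prod g"
  using Quotient3_abs_rep[OF Quotient3_U2_prod, of w] by metis

definition prod_act :: "free \<Rightarrow> U2_prod \<Rightarrow> U2_prod" where
  "prod_act x w = abs_U2_prod (\<lambda>d. x * rep_U2_prod w d)"

lemma prod_act_abs: "prod_act x (abs_U2_prod g) = abs_U2_prod (\<lambda>d. x * g d)"
proof -
  have "\<forall>d. rep_U2_prod (abs_U2_prod g) d - g d \<in> U2_kernel d"
    using Quotient3_rep_abs[OF Quotient3_U2_prod, of g] by (simp add: U2_kernel_closed)
  then show ?thesis
    unfolding prod_act_def U2_prod.abs_eq_iff using U2_kernel_closed(3) by (simp flip: right_diff_distrib)
qed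

definition component :: "nat \<Rightarrow> free \<Rightarrow> U2_prod" where
  "component d x = abs_U2_prod (\<lambda>d'. if d' = d then x else 0)"

lemma component_eq_0: "component d x = 0 \<longleftrightarrow> x \<in> U2_kernel d"
  by (auto simp: component_def zero_U2_prod.abs_eq U2_prod.abs_eq_iff U2_kernel_closed)

lemma component_add: "component d x + component d y = component d (x + y)"
  by (simp add: component_def plus_U2_prod.abs_eq U2_prod.abs_eq_iff U2_kernel_closed)

lemma component_act: "prod_act x (component d y) = component d (x * y)"
  by (simp add: component_def prod_act_abs U2_prod.abs_eq_iff U2_kernel_closed)

lemma prod_act_vanish: "(\<And>d. x \<in> U2_kernel d) \<Longrightarrow> prod_act x w = 0"
  by (simp add: prod_act_def zero_U2_prod.abs_eq U2_prod.abs_eq_iff U2_kernel_closed)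

interpretation prod_act: bounded_mir_module prod_act d "range (component d)" for d
proof unfold_locales
  fix x y :: free and w w' :: U2_prod
  obtain g g' where g: "w = abs_U2_prod g" "w' = abs_U2_prod g'" by (metis U2_prod_rep)
  show "prod_act (x + y) w = prod_act x w + prod_act y w" "prod_act x (w + w') = prod_act x w + prod_act
      x w'"
    "prod_act (x * y) w = prod_act x (prod_act y w)" "prod_act 1 w = w"
    by (simp_all add: g prod_act_abs plus_U2_prod.abs_eq distrib_left distrib_right mult.assoc)
  show "x \<in> mir_relators \<Longrightarrow> prod_act x w = 0" using U2_kernel_relators by (intro prod_act_vanish) blast
  show "w \<in> range (component d) \<Longrightarrow> w' \<in> range (component d) \<Longrightarrow> w + w' \<in> range (component d)"
    by (auto simp: component_add)
  show "w \<in> range (component d) \<Longrightarrow> prod_act x w \<in> range (component d)"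
    by (auto simp: component_act)
  show "(0 :: U2_prod) \<in> range (component d)"
    using component_eq_0[of d 0] U2_kernel_closed(1) by (auto simp: image_iff intro!: exI[of _ 0])
  show "w \<in> range (component d) \<Longrightarrow> prod_act (P_poly d) w = 0"
    "w \<in> range (component d) \<Longrightarrow> prod_act ((Fl - 1) * Q_poly d) w = 0"
    using U2_kernel_PQ[of d] by (auto simp: component_act component_eq_0 intro: U2_kernel_closed simp
        del: mult.assoc)
qed

text \<open>If \<open>x\<close> annihilates all blocks then it annihilates the regular module of \<open>U(2,d)\<close>, in
  particular the unit element.\<close>

theorem U2_kernel_eq_annihilator: "U2_kernel d = annihilator d"
proof
  show "annihilator d \<subseteq> U2_kernel d"
  proof
    fix x assume "x \<in> annihilator d"
    then have "prod_act x (component d 1) = 0" by (intro prod_act.annihilator_faithful[of _ d]) auto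
    then show "x \<in> U2_kernel d" by (simp add: component_act component_eq_0)
  qed
qed (rule U2_kernel_annihilator)

section \<open>Matrix units\<close>

definition is_matrix_unit :: "free \<Rightarrow> block \<Rightarrow> nat \<Rightarrow> nat \<Rightarrow> K \<Rightarrow> bool" where
  "is_matrix_unit x b i j c \<longleftrightarrow> (\<forall>p<block_size b. \<forall>q<block_size b. entry x b p q = (if p = i \<and> q
      = j then c else 0))"

lemma is_matrix_unit_mult:
  assumes "is_matrix_unit x b i j c" "is_matrix_unit y b j k c'" "j < block_size b"
      shows "is_matrix_unit (x * y) b i k (c * c')"
  unfolding is_matrix_unit_def
proof (intro allI impI)
  fix p q assume pq: "p < block_size b" "q < block_size b"
  have "entry (x * y) b p q = (\<Sum>r<block_size b. if r = j then (if p = i \<and> q = k then c * c' else 0) else 0)"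
    unfolding entry_mult[OF pq(2)] by (rule sum.cong) (use assms pq in \<open>auto simp: is_matrix_unit_def\<close>)
  then show "entry (x * y) b p q = (if p = i \<and> q = k then c * c' else 0)" using assms(3) by simp
qed

lemma is_matrix_unit_sandwich:
  assumes "is_matrix_unit x b i j c" "is_matrix_unit y b k m c'" "j < block_size b" "k < block_size b"
  shows "is_matrix_unit (x * a * y) b i m (c * entry a b j k * c')"
  unfolding is_matrix_unit_def
proof (intro allI impI)
  fix p q assume pq: "p < block_size b" "q < block_size b"
  have xa: "entry (x * a) b p r = (if p = i then c * entry a b j r else 0)" if "r < block_size b" for r
  proof -
    have "entry (x * a) b p r = (\<Sum>s<block_size b. if s = j then (if p = i then c * entry a b j r else 0)
        else 0)"
      unfolding entry_mult[OF that] by (rule sum.cong) (use assms pq in \<open>auto simp: is_matrix_unit_def\<close>)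
    then show ?thesis using assms(3) by simp
  qed
  have "entry (x * a * y) b p q = (\<Sum>r<block_size b.
      if r = k then (if p = i \<and> q = m then c * entry a b j k * c' else 0) else 0)"
    unfolding entry_mult[OF pq(2)] by (rule sum.cong) (use assms pq xa in \<open>auto simp: is_matrix_unit_def\<close>)
  then show "entry (x * a * y) b p q = (if p = i \<and> q = m then c * entry a b j k * c' else 0)"
      using assms(4) by simp
qed

lemma is_matrix_unit_scal: "is_matrix_unit x b i j c \<Longrightarrow> is_matrix_unit (scal a * x) b i j (a * c)"
  by (auto simp: is_matrix_unit_def entry_scal)

lemma is_matrix_unit_normalize: "is_matrix_unit x b i j c \<Longrightarrow> c \<noteq> 0 \<Longrightarrow> is_matrix_unit (scal (inverse c) *
    x) b i j 1"
  using is_matrix_unit_scal[of x b i j c "inverse c"] by simp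

text \<open>Up to a scalar, the projection to the common eigenspace of \<open>k\<close> and \<open>l\<close> for \<open>v^\<mu>\<close> and \<open>\<epsilon>\<close>: the
  product over the other roots of \<open>P_d\<close> is Lagrange interpolation without the denominator, which is
  \<open>proj_val\<close>.\<close>

definition proj :: "nat \<Rightarrow> int \<Rightarrow> nat \<Rightarrow> free" where
  "proj d \<mu> \<epsilon> = kprod (filter (\<lambda>\<nu>. \<nu> \<noteq> \<mu>) (map (\<lambda>r. 2 * int r - int d) [0..<Suc d]))
    * (if \<epsilon> = 1 then Fl else 1 - Fl)"

definition proj_val :: "nat \<Rightarrow> int \<Rightarrow> K" where
  "proj_val d \<mu> = prod_list (map (\<lambda>\<nu>. vv powi \<mu> - vv powi \<nu>) (filter (\<lambda>\<nu>. \<nu> \<noteq> \<mu>)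
      (map (\<lambda>r. 2 * int r - int d) [0..<Suc d])))"

lemma proj_val_nonzero: "proj_val d \<mu> \<noteq> 0"
  unfolding proj_val_def by (rule prod_list_nonzero) (auto simp del: upt_Suc)

lemma basis_ell_cases: "basis_ell b j = 0 \<or> basis_ell b j = 1"
  by (cases b) auto

lemma proj_basis_vec:
  assumes b: "b \<in> blocks d" "j < block_size b" and \<epsilon>: "\<epsilon> = 0 \<or> \<epsilon> = 1"
  shows "model_act (proj d \<mu> \<epsilon>) (basis_vec b j) = (if basis_weight b j = \<mu> \<and> basis_ell b j
      = \<epsilon> then pm_scale (proj_val d \<mu>) (basis_vec b j) else 0)"
proof -
  let ?l = "if \<epsilon> = 1 then Fl else 1 - Fl"
  have l: "model_act ?l (basis_vec b j) = (if basis_ell b j = \<epsilon> then basis_vec b j else 0)"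
    using basis_vec_l[OF b(2)] basis_ell_cases[of b j] \<epsilon> by (auto simp: model.act_simps)
  let ?\<nu>s = "filter (\<lambda>\<nu>. \<nu> \<noteq> \<mu>) (map (\<lambda>r. 2 * int r - int d) [0..<Suc d])"
  have k: "model_act (kprod ?\<nu>s) (basis_vec b j) = (if basis_weight b j = \<mu> then pm_scale (proj_val d \<mu>)
      (basis_vec b j) else 0)"
  proof (cases "basis_weight b j = \<mu>")
    case True then show ?thesis using model.act_kprod[OF basis_vec_wt[OF b(2)], of ?\<nu>s]
        by (simp only: model_sm proj_val_def if_True simp_thms)
  next
    case False
    obtain r where r: "basis_weight b j = 2 * int r - int d" "r \<le> d" using basis_weight_in_weights[OF b]
        by (auto simp: weights_def)
    have "prod_list (map (\<lambda>\<nu>. vv powi basis_weight b j - vv powi \<nu>) ?\<nu>s) = 0"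
      by (rule prod_list_zero[of 0]) (use r False in \<open>auto simp del: upt_Suc simp: image_iff\<close>)
    then show ?thesis using model.act_kprod[OF basis_vec_wt[OF b(2)], of ?\<nu>s] False by simp
  qed
  show ?thesis unfolding proj_def model.act_mult l using k by auto
qed

lemma basis_weight_ell_inj:
  assumes "i < block_size b" "j < block_size b" "basis_weight b i = basis_weight b j" "basis_ell b i
      = basis_ell b j" shows "i = j"
  using assms by (cases b) (auto split: if_splits)

lemma proj_unit:
  assumes "b \<in> blocks d" "j < block_size b"
  shows "is_matrix_unit (proj d (basis_weight b j) (basis_ell b j)) b j j (proj_val d (basis_weight b j))"
  unfolding is_matrix_unit_def entry_def
  using assms basis_weight_ell_inj[of _ b j] basis_ell_cases[of b j]
  by (auto simp: proj_basis_vec lookup_single when_def)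

definition linked :: "block \<Rightarrow> nat \<Rightarrow> nat \<Rightarrow> bool" where
  "linked b i j \<longleftrightarrow> (\<exists>x. is_matrix_unit x b i j 1)"

context
  fixes d b assumes b: "b \<in> blocks d"
begin

lemma linked_refl: "j < block_size b \<Longrightarrow> linked b j j"
  unfolding linked_def using is_matrix_unit_normalize[OF proj_unit[OF b] proj_val_nonzero] by blast

lemma linked_trans: "linked b i j \<Longrightarrow> linked b j k \<Longrightarrow> j < block_size b \<Longrightarrow> linked b i k"
  unfolding linked_def using is_matrix_unit_mult[of _ b i j 1 _ k 1] by fastforce

text \<open>Multiply \<open>a\<close> from both sides by diagonal matrix units.\<close>

lemma linked_entry: "i < block_size b \<Longrightarrow> j < block_size b \<Longrightarrow> entry a b i j \<noteq> 0 \<Longrightarrow> linked b i j"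
  using is_matrix_unit_sandwich[OF _ _ _ , of _ b i i 1 _ j j 1 a] linked_refl[of i] linked_refl[of j]
      is_matrix_unit_normalize
  unfolding linked_def by (metis mult_1 mult_1_right)

end

lemma entry_fgen: "j < block_size b \<Longrightarrow> entry (fgen g) b i j = Poly_Mapping.lookup (model_col g b j) (b, i)"
  by (simp add: entry_def model_act_fgen model_gen_single)

lemma lookup_uv: "Poly_Mapping.lookup (uv b i) (b, j) = (if i = int j \<and> j < block_size b then 1 else 0)"
  by (auto simp: uv_def lookup_single when_def)

lemma lookup_zv: "Poly_Mapping.lookup (zv m i) (B01 m, j) = (if i = int j \<and> j < m then 1 else 0)"
  by (auto simp: zv_def lookup_uv)

lemma lookup_yv: "Poly_Mapping.lookup (yv m i) (B01 m, j) = (if int m + i - 1 = int j \<and> m \<le> j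
    \<and> j < 2 * m then 1 else 0)"
  by (auto simp: yv_def lookup_uv)

text \<open>In \<open>L\<^sup>+(m,\<delta>)\<close> neighbours are linked by \<open>e\<close> and \<open>f\<close>. In \<open>L\<^sup>+(m,01)\<close> the same holds among the
  vectors \<open>z\<close>, while \<open>f\<close> and \<open>e\<close> link \<open>z i\<close> with \<open>y (i+1)\<close> in both directions; the position of \<open>y
  (i+1)\<close> is \<open>m + i\<close>.\<close>

lemma all_linked_0:
  assumes b: "b \<in> blocks d" and j: "j < block_size b"
  shows "linked b j 0 \<and> linked b 0 j"
proof (cases "\<exists>m. b = B01 m")
  case False
  then obtain m \<delta> where sz: "block_size b = m + 1" and col: "\<And>g i. model_col g b i = colL (int m) \<delta>
      (uv b) g (int i)"
    by (cases b) auto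
  show ?thesis
    using j
  proof (induction j)
    case 0 then show ?case using linked_refl[OF b] by simp
  next
    case (Suc j)
    have "entry Ff b (Suc j) j \<noteq> 0" using Suc.prems by (simp add: entry_fgen col lookup_uv)
    then have "linked b (Suc j) j" using Suc.prems by (intro linked_entry[OF b]) auto
    moreover have "entry Fe b j (Suc j) \<noteq> 0" using Suc.prems sz by (simp add: entry_fgen col lookup_uv)
    then have "linked b j (Suc j)" using Suc.prems by (intro linked_entry[OF b]) auto
    ultimately show ?case using Suc linked_trans[OF b] by (meson Suc_lessD)
  qed
next
  case True
  then obtain m where m: "b = B01 m" by blast
  have z: "linked b j 0 \<and> linked b 0 j" if "j < m" for j
    using that
  proof (induction j)
    case 0 then show ?case using linked_refl[OF b] m by simp
  next
    case (Suc j)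
    have "entry Ff b (Suc j) j \<noteq> 0" using Suc.prems
        by (simp add: m entry_fgen lookup_add lookup_zv lookup_yv)
    then have "linked b (Suc j) j" using Suc.prems by (intro linked_entry[OF b]) (auto simp: m)
    moreover have "entry Fe b j (Suc j) \<noteq> 0" using Suc.prems
        by (simp add: m entry_fgen lookup_add lookup_zv lookup_yv)
    then have "linked b j (Suc j)" using Suc.prems by (intro linked_entry[OF b]) (auto simp: m)
    moreover have "j < block_size b" using Suc.prems m by simp
    ultimately show ?case using Suc linked_trans[OF b] by (meson Suc_lessD)
  qed
  show ?thesis
  proof (cases "j < m")
    case False
    let ?i = "j - m"
    have i: "?i < m" "?i < block_size b" using j False m by auto
    have "entry Ff b j ?i \<noteq> 0" using i j False by (simp add: m entry_fgen lookup_add lookup_zv lookup_yv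
        of_nat_diff)
    then have "linked b j ?i" using i j by (intro linked_entry[OF b])
    moreover have "entry Fe b ?i j \<noteq> 0" using i j False
        by (simp add: m entry_fgen lookup_add lookup_zv lookup_yv of_nat_diff)
    then have "linked b ?i j" using i j by (intro linked_entry[OF b])
    ultimately show ?thesis using z[OF i(1)] linked_trans[OF b] i(2) by blast
  qed (rule z)
qed

lemma all_linked: assumes "b \<in> blocks d" "i < block_size b" "j < block_size b" shows "linked b i j"
  using all_linked_0[of b d i] all_linked_0[of b d j] linked_trans[of b d i 0 j] assms by auto

text \<open>The order in which the blocks are separated: by highest weight, and within one highest weight
  \<open>L\<^sup>+(m,1)\<close> above \<open>L\<^sup>+(m,01)\<close> above \<open>L\<^sup>+(m,0)\<close>.\<close>

fun rank :: "block \<Rightarrow> nat" where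
  "rank (B1 m) = 3 * m + 2" | "rank (B01 m) = 3 * m + 1" | "rank (B0 m) = 3 * m"

fun param :: "block \<Rightarrow> nat" where
  "param (B1 m) = m" | "param (B01 m) = m" | "param (B0 m) = m"

lemma rank_inj: "rank b = rank b' \<Longrightarrow> b = b'"
  by (cases b; cases b') (simp_all, presburger+)

text \<open>An element that acts nontrivially on a block and as zero on all blocks of smaller rank. Weight
  \<open>m\<close> occurs in blocks of smaller or equal highest weight only at the top of those with highest
  weight \<open>m\<close>. The idempotent \<open>l\<close> separates \<open>L\<^sup>+(m,1)\<close> from the other two, and \<open>e l f\<close> vanishes on
  \<open>L\<^sup>+(m,0)\<close> but not on the top vector of \<open>L\<^sup>+(m,01)\<close>.\<close>

fun separator :: "nat \<Rightarrow> block \<Rightarrow> free" where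
  "separator d (B1 m) = proj d (int m) 1"
| "separator d (B01 m) = Fe * (Fl * (Ff * proj d (int m) 0))"
| "separator d (B0 m) = proj d (int m) 0"

lemma basis_weight_le_param:
  "j < block_size b \<Longrightarrow> basis_weight b j \<le> int (param b) \<and> (basis_weight b j = int (param b) \<longrightarrow> j = 0)"
  by (cases b) (auto split: if_splits)

lemma separator_zero:
  assumes b: "b \<in> blocks d" "b' \<in> blocks d" "rank b' < rank b" "j < block_size b'"
  shows "model_act (separator d b) (basis_vec b' j) = 0"
proof -
  have "param b' \<le> param b" using assms(3) by (cases b; cases b') auto
  have proj0: "model_act (proj d (int (param b)) \<epsilon>) (basis_vec b' j) = 0"
      if "basis_ell b' j \<noteq> \<epsilon> \<or> j \<noteq> 0 \<or> param b' \<noteq> param b" "\<epsilon> = 0 \<or> \<epsilon> = 1" for \<epsilon>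
    using that basis_weight_le_param[OF b(4)] \<open>param b' \<le> param b\<close> by (auto simp: proj_basis_vec[OF b(2,4)])
  show ?thesis
  proof (cases b)
    case (B1 m)
    have "basis_ell b' j \<noteq> 1 \<or> j \<noteq> 0 \<or> param b' \<noteq> param b" using assms(3,4) B1 by (cases b') auto
    then show ?thesis using proj0[of 1] B1 by simp
  next
    case (B0 m)
    have "param b' \<noteq> param b" using assms(3,4) B0 by (cases b') auto
    then show ?thesis using proj0[of 0] B0 by simp
  next
    case (B01 m)
    show ?thesis
    proof (cases "b' = B0 m \<and> j = 0")
      case True
      have P: "model_act (proj d (int m) 0) (basis_vec b' j) = model.sm (proj_val d (int m))
          (basis_vec b' j)"
        using b True by (simp add: proj_basis_vec model_sm)
      have "model.l (model.f (basis_vec b' j)) = 0"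
        using True model_Lplus_family_0[of m] by (simp add: single_eq_uv model.Lplus_family_def)
      then show ?thesis by (simp only: B01 separator.simps model.act_mult P model.act_sm) simp
    next
      case False
      then have "j \<noteq> 0 \<or> param b' \<noteq> param b" using assms(3) B01 by (cases b') auto
      then show ?thesis using proj0[of 0] B01 by (simp add: model.act_mult)
    qed
  qed
qed

lemma separator_nonzero:
  assumes b: "b \<in> blocks d"
  shows "entry (separator d b) b 0 0 \<noteq> 0"
proof (cases b)
  case (B1 m)
  then show ?thesis using b proj_val_nonzero by (simp add: entry_def proj_basis_vec)
next
  case (B0 m)
  then show ?thesis using b proj_val_nonzero by (simp add: entry_def proj_basis_vec)
next
  case (B01 m)
  then have m: "m \<ge> 1" using b by (auto simp: blocks_def)
  have "model.e (model.l (model.f (zv m 0))) = pm_scale (vv powi (1 - int m)) (zv m 0)"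
    using model_Rosso_family[of m] by (simp add: model.Rosso_family_def model.act_simps model_sm yv_0)
  moreover have z: "basis_vec (B01 m) 0 = zv m 0" using m basis_B01[of 0 m] by simp
  moreover have "model_act (proj d (int m) 0) (basis_vec b 0) = model.sm (proj_val d (int m))
      (basis_vec b 0)"
    using b B01 m by (simp add: proj_basis_vec model_sm)
  ultimately have "model_act (separator d b) (basis_vec b 0) = pm_scale (proj_val d (int m) * vv powi
      (1 - int m)) (zv m 0)"
    unfolding B01 separator.simps model.act_mult by (simp only: model.act_sm) (simp add: model_sm)
  then show ?thesis using m proj_val_nonzero by (simp add: entry_def B01 lookup_zv)
qed

lemma block_units:
  assumes b: "b \<in> blocks d" and ij: "i < block_size b" "j < block_size b"
  shows "\<exists>x. is_matrix_unit x b i j 1 \<and> (\<forall>b'\<in>blocks d. rank b' < rank b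
      \<longrightarrow> (\<forall>p<block_size b'. \<forall>q<block_size b'. entry x b' p q = 0))"
proof -
  have 0: "0 < block_size b" using ij by simp
  obtain x y where x: "is_matrix_unit x b i 0 1" and y: "is_matrix_unit y b 0 j 1"
    using all_linked[OF b ij(1) 0] all_linked[OF b 0 ij(2)] unfolding linked_def by blast
  let ?c = "entry (separator d b) b 0 0"
  let ?u = "x * separator d b * y"
  have "is_matrix_unit ?u b i j ?c" using is_matrix_unit_sandwich[OF x y 0 0] by simp
  then have "is_matrix_unit (scal (inverse ?c) * ?u) b i j 1"
      by (rule is_matrix_unit_normalize[OF _ separator_nonzero[OF b]])
  moreover have "entry (scal (inverse ?c) * ?u) b' p q = 0"
    if "b' \<in> blocks d" "rank b' < rank b" "p < block_size b'" "q < block_size b'" for b' p q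
  proof -
    have "entry (separator d b) b' r s = 0" if "s < block_size b'" for r s
      using separator_zero[OF b \<open>b' \<in> blocks d\<close> \<open>rank b' < rank b\<close> that] by (simp add: entry_def)
    then show ?thesis using that by (simp add: entry_scal entry_mult)
  qed
  ultimately show ?thesis by blast
qed

lemma entry_sum: "entry (sum x A) b i j = (\<Sum>t\<in>A. entry (x t) b i j)"
  by (induction A rule: infinite_finite_induct) (simp_all add: entry_0 entry_add)

lemma finite_I_set: "finite (I_set t)"
  by (rule finite_subset[of _ "{..nat t}"]) (auto simp: I_set_def)

lemma finite_blocks: "finite (blocks d)"
  by (simp add: blocks_def finite_I_set)

text \<open>Back substitution: block by block in order of increasing rank, the element found so far is
  corrected in the next block by a combination of matrix units that vanish on the blocks already
  treated.\<close>

theorem entries_surjective: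
  "\<exists>x. \<forall>b\<in>blocks d. \<forall>i<block_size b. \<forall>j<block_size b. entry x b i j = Y b i j"
proof -
  have "\<exists>x. \<forall>b\<in>blocks d. rank b < n \<longrightarrow> (\<forall>i<block_size b. \<forall>j<block_size b. entry x b i j = Y b i j)" for n
  proof (induction n)
    case 0 then show ?case by simp
  next
    case (Suc n)
    then obtain x where x: "\<And>b i j. b \<in> blocks d \<Longrightarrow> rank b < n \<Longrightarrow> i < block_size b \<Longrightarrow> j < block_size b
        \<Longrightarrow> entry x b i j = Y b i j"
      by blast
    show ?case
    proof (cases "\<exists>b\<in>blocks d. rank b = n")
      case False
      then show ?thesis using x by (metis less_Suc_eq)
    next
      case True
      then obtain b where b: "b \<in> blocks d" "rank b = n" by blast
      define u where "u i j = (SOME x. is_matrix_unit x b i j 1 \<and> (\<forall>b'\<in>blocks d. rank b' < rank b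
          \<longrightarrow> (\<forall>p<block_size b'. \<forall>q<block_size b'. entry x b' p q = 0)))" for i j
      have u: "is_matrix_unit (u i j) b i j 1" "\<And>b' p q. b' \<in> blocks d \<Longrightarrow> rank b' < n \<Longrightarrow> p < block_size b'
          \<Longrightarrow> q < block_size b' \<Longrightarrow> entry (u i j) b' p q = 0"
        if "i < block_size b" "j < block_size b" for i j
        using someI_ex[OF block_units[OF b(1) that]] b(2) unfolding u_def[symmetric] by blast+
      define y where "y = x + (\<Sum>i<block_size b. \<Sum>j<block_size b. scal (Y b i j - entry x b i j) * u i j)"
      have "entry y b' p q = Y b' p q" if b': "b' \<in> blocks d" "rank b' < Suc n" "p < block_size b'" "q <
          block_size b'" for b' p q
      proof (cases "rank b' = n")
        case True
        then have [simp]: "b' = b" using b rank_inj by metis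
        have "(\<Sum>i<block_size b. \<Sum>j<block_size b. entry (scal (Y b i j - entry x b i j) * u i j) b p q) =
          (\<Sum>i<block_size b. \<Sum>j<block_size b. if j = q then (if i = p then Y b p q - entry x b p q else
              0) else 0)"
          using b' u(1) by (intro sum.cong refl) (auto simp: entry_scal is_matrix_unit_def)
        also have "\<dots> = Y b p q - entry x b p q" using b' by simp
        finally show ?thesis by (simp add: y_def entry_add entry_sum)
      next
        case False
        then have "rank b' < n" using b' by simp
        then show ?thesis using x b' u(2) by (simp add: y_def entry_add entry_sum entry_scal)
      qed
      then show ?thesis by blast
    qed
  qed
  note * = this
  have "rank b < Suc (Max (rank ` blocks d))" if "b \<in> blocks d" for b
    using finite_blocks that by (simp add: less_Suc_eq_le)
  then show ?thesis using *[of "Suc (Max (rank ` blocks d))"] by blast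
qed

section \<open>The Wedderburn decomposition and the dimension\<close>

definition emat :: "free \<Rightarrow> block \<Rightarrow> K mat" where
  "emat x b = mat (block_size b) (block_size b) (\<lambda>(i, j). entry x b i j)"

lemma emat_carrier [simp]: "emat x b \<in> carrier_mat (block_size b) (block_size b)"
  by (simp add: emat_def)

lemma emat_ops:
  "emat (x + y) b = emat x b + emat y b" "emat (x * y) b = emat x b * emat y b"
  "emat 1 b = 1\<^sub>m (block_size b)" "emat (scal c * x) b = c \<cdot>\<^sub>m emat x b"
  by (rule eq_matI; auto simp: emat_def entry_add entry_mult entry_one entry_scal scalar_prod_def
      lessThan_atLeast0)+

lemma emat_eq_iff: "(\<forall>b\<in>blocks d. emat x b = emat y b) \<longleftrightarrow> x - y \<in> U2_kernel d"
proof -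
  have "emat x b = emat y b \<longleftrightarrow> (\<forall>i<block_size b. \<forall>j<block_size b. entry (x - y) b i j = 0)" for b
    by (auto simp: emat_def mat_eq_iff entry_diff)
  then show ?thesis by (simp add: U2_kernel_eq_annihilator annihilator_def)
qed

lemma emat_surjective:
  assumes "\<And>b. b \<in> blocks d \<Longrightarrow> M b \<in> carrier_mat (block_size b) (block_size b)"
  obtains x where "\<And>b. b \<in> blocks d \<Longrightarrow> emat x b = M b"
proof -
  obtain x where x: "\<forall>b\<in>blocks d. \<forall>i<block_size b. \<forall>j<block_size b. entry x b i j = M b $$ (i, j)"
    using entries_surjective[of d "\<lambda>b i j. M b $$ (i, j)"] by blast
  have "emat x b = M b" if "b \<in> blocks d" for b
    using x assms[OF that] that by (intro eq_matI) (auto simp: emat_def)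
  then show ?thesis by (rule that)
qed

text \<open>The choice of a preimage in the free algebra is irrelevant by \<open>emat_eq_iff\<close>.\<close>

definition wedderburn :: "nat \<Rightarrow> free set set \<Rightarrow> block \<Rightarrow> K mat" where
  "wedderburn d X = (\<lambda>b\<in>blocks d. emat (SOME x. U2_proj d x = X) b)"

lemma wedderburn_U2_proj: "wedderburn d (U2_proj d x) = (\<lambda>b\<in>blocks d. emat x b)"
proof -
  have "U2_proj d (SOME y. U2_proj d y = U2_proj d x) = U2_proj d x" by (rule someI[of _ x]) simp
  then have "\<forall>b\<in>blocks d. emat (SOME y. U2_proj d y = U2_proj d x) b = emat x b"
    by (simp add: U2_proj_eq_iff emat_eq_iff)
  then show ?thesis by (simp add: wedderburn_def cong: restrict_cong)
qed

lemma wedderburn_iso: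
  "wedderburn d \<in> algebra_iso (U2 d) (direct_sum_algebra (blocks d) (\<lambda>b. Mat (block_size b)))"
proof -
  let ?B = "direct_sum_algebra (blocks d) (\<lambda>b. Mat (block_size b))"
  have hom: "wedderburn d \<in> Ring.ring_hom (U2 d) ?B"
    by (rule Ring.ring_hom_memI)
      (auto simp: U2_carrier U2_proj_ops wedderburn_U2_proj emat_ops direct_sum_algebra_def
          module_mat_simps)
  have inj: "inj_on (wedderburn d) (carrier (U2 d))"
  proof (rule inj_onI)
    fix X Y assume XY: "X \<in> carrier (U2 d)" "Y \<in> carrier (U2 d)" and eq: "wedderburn d X = wedderburn d Y"
    from XY obtain x y where [simp]: "X = U2_proj d x" "Y = U2_proj d y" by (auto simp: U2_carrier)
    have "emat x b = emat y b" if "b \<in> blocks d" for b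
      using fun_cong[OF eq, of b] that by (simp add: wedderburn_U2_proj)
    then show "X = Y" by (simp add: U2_proj_eq_iff flip: emat_eq_iff)
  qed
  have surj: "wedderburn d ` carrier (U2 d) = carrier ?B"
  proof
    show "wedderburn d ` carrier (U2 d) \<subseteq> carrier ?B" using hom by (auto simp: Ring.ring_hom_def)
    show "carrier ?B \<subseteq> wedderburn d ` carrier (U2 d)"
    proof
      fix M assume "M \<in> carrier ?B"
      then have M: "M \<in> (\<Pi>\<^sub>E b\<in>blocks d. carrier_mat (block_size b) (block_size b))"
        by (simp add: direct_sum_algebra_def module_mat_simps)
      then obtain x where "\<And>b. b \<in> blocks d \<Longrightarrow> emat x b = M b"
        using emat_surjective[of d M] by (auto simp: PiE_iff)
      then have "wedderburn d (U2_proj d x) = M"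
        using M by (auto simp: wedderburn_U2_proj restrict_def PiE_iff extensional_def fun_eq_iff)
      then show "M \<in> wedderburn d ` carrier (U2 d)" by (auto simp: U2_carrier)
    qed
  qed
  have "wedderburn d (c \<odot>\<^bsub>U2 d\<^esub> X) = c \<odot>\<^bsub>?B\<^esub> wedderburn d X" if "X \<in> carrier (U2 d)" for c X
    using that by (auto simp: U2_carrier U2_proj_ops wedderburn_U2_proj emat_ops(4)
        direct_sum_algebra_def module_mat_simps
        intro!: restrict_ext)
  with hom inj surj show ?thesis
    by (simp add: algebra_iso_def ring_iso_def bij_betw_def)
qed

lemma smult_mat_vec:
  "A \<in> carrier_mat n m \<Longrightarrow> w \<in> carrier_vec m \<Longrightarrow> (c \<cdot>\<^sub>m A) *\<^sub>v w = c \<cdot>\<^sub>v (A *\<^sub>v (w :: K vec))"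
  by (rule eq_vecI) (auto simp: scalar_prod_def sum_distrib_left mult.assoc)

lemma block_vectorspace: "vectorspace class_ring (block_space b)"
proof -
  interpret vec_space "TYPE(K)" "block_size b" .
  show ?thesis by (rule vectorspace_axioms)
qed

text \<open>The block modules are needed over \<open>U(2,d)\<close> and over the mirabolic algebra. Both are quotients
  \<open>q\<close> of the free algebra, so that one argument serves for both.\<close>

context
  fixes A :: "(K, 'a) module" and q :: "free \<Rightarrow> 'a" and F :: "'a \<Rightarrow> block \<Rightarrow> K mat" and d :: nat and b :: block
  assumes carrier: "carrier A = range q"
    and q: "\<And>x y. q x \<oplus>\<^bsub>A\<^esub> q y = q (x + y)" "\<And>x y. q x \<otimes>\<^bsub>A\<^esub> q y = q (x * y)"
      "\<And>c x. c \<odot>\<^bsub>A\<^esub> q x = q (scal c * x)" "\<one>\<^bsub>A\<^esub> = q 1"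
    and F: "\<And>x. F (q x) b = emat x b" and b: "b \<in> blocks d"
begin

lemma block_left_module: "is_left_module A (block_space b) (block_act F b)"
  unfolding is_left_module_def
proof (intro conjI ballI allI)
  show "vectorspace class_ring (block_space b)" by (rule block_vectorspace)
  have vec: "w \<in> carrier (block_space b) \<longleftrightarrow> w \<in> carrier_vec (block_size b)" for w
    by (simp add: module_vec_simps)
  show "block_act F b \<one>\<^bsub>A\<^esub> w = w" if "w \<in> carrier (block_space b)" for w
    using that by (simp add: vec block_act_def q F emat_ops)
  fix X assume "X \<in> carrier A"
  then obtain x where [simp]: "X = q x" by (auto simp: carrier)
  note E = emat_carrier[of x b]
  show "block_act F b X \<in> LinearCombinations.module_hom class_ring (block_space b) (block_space b)"
    by (auto simp: LinearCombinations.module_hom_def block_act_def F module_vec_simps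
      mult_add_distrib_mat_vec[OF E] mult_mat_vec[OF E] intro: mult_mat_vec_carrier[OF E])
  show "block_act F b (c \<odot>\<^bsub>A\<^esub> X) w = c \<odot>\<^bsub>block_space b\<^esub> block_act F b X w"
    if "w \<in> carrier (block_space b)" for c w
    using that by (simp add: vec block_act_def q F emat_ops(4) module_vec_simps smult_mat_vec[OF E])
  fix Y w assume "Y \<in> carrier A" "w \<in> carrier (block_space b)"
  then obtain y where [simp]: "Y = q y" and w: "w \<in> carrier_vec (block_size b)" by (auto simp: carrier vec)
  show "block_act F b (X \<otimes>\<^bsub>A\<^esub> Y) w = block_act F b X (block_act F b Y w)"
    using assoc_mult_mat_vec[OF E emat_carrier[of y b] w] by (simp add: block_act_def q F emat_ops)
  show "block_act F b (X \<oplus>\<^bsub>A\<^esub> Y) w = block_act F b X w \<oplus>\<^bsub>block_space b\<^esub> block_act F b Y w"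
    using add_mult_distrib_mat_vec[OF E emat_carrier[of y b] w]
        by (simp add: block_act_def q F emat_ops module_vec_simps)
qed

text \<open>All matrices occur as actions, and some matrix maps a given nonzero vector \<open>w\<close> to any
  prescribed vector \<open>v\<close>: the one whose only nonzero column is \<open>v / w $ j\<close>, at a position \<open>j\<close> where
  \<open>w\<close> does not vanish.\<close>

lemma block_simple: "is_simple_module A (block_space b) (block_act F b)"
  unfolding is_simple_module_def
proof (intro conjI allI impI)
  let ?n = "block_size b"
  have n: "0 < ?n" using b by (auto simp: blocks_def)
  show "carrier (block_space b) \<noteq> {\<zero>\<^bsub>block_space b\<^esub>}"
  proof
    assume "carrier (block_space b) = {\<zero>\<^bsub>block_space b\<^esub>}"
    then have "carrier_vec ?n = {0\<^sub>v ?n :: K vec}" by (simp add: module_vec_simps)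
    then have "(unit_vec ?n 0 :: K vec) = 0\<^sub>v ?n" using unit_vec_carrier[of ?n 0] by blast
    from arg_cong[OF this, of "\<lambda>v. v $ 0"] show False using n by simp
  qed
  fix W assume W: "VectorSpace.subspace class_ring W (block_space b) \<and> (\<forall>X\<in>carrier A. \<forall>w\<in>W. block_act F
      b X w \<in> W)"
  then have "submodule class_ring W (block_space b)" by (simp add: VectorSpace.subspace_def)
  from LinearCombinations.submodule.subset[OF this] LinearCombinations.submodule.zero_closed[OF this]
  have sub: "W \<subseteq> carrier_vec ?n" "0\<^sub>v ?n \<in> W" by (simp_all add: module_vec_simps)
  show "W = {\<zero>\<^bsub>block_space b\<^esub>} \<or> W = carrier (block_space b)"
  proof (cases "W = {0\<^sub>v ?n}")
    case False
    then obtain w where w: "w \<in> W" "w \<noteq> 0\<^sub>v ?n" using sub(2) by blast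
    then have wc: "w \<in> carrier_vec ?n" using sub(1) by blast
    have "\<exists>j<?n. w $ j \<noteq> 0"
    proof (rule ccontr)
      assume "\<not> (\<exists>j<?n. w $ j \<noteq> 0)"
      then have "w = 0\<^sub>v ?n" by (intro eq_vecI) (use wc in simp_all)
      then show False using w(2) by simp
    qed
    then obtain j where j: "j < ?n" "w $ j \<noteq> 0" by blast
    have "v \<in> W" if v: "v \<in> carrier_vec ?n" for v
    proof -
      define M where "M b' = mat (block_size b') (block_size b') (\<lambda>(p, r).
          if r = j then v $ p / w $ j else 0)" for b'
      obtain x where "\<And>b. b \<in> blocks d \<Longrightarrow> emat x b = M b"
        by (rule emat_surjective[of d M]) (auto simp: M_def)
      then have x: "emat x b = M b" using b by blast
      have "(M b *\<^sub>v w) $ p = v $ p" if "p < ?n" for p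
      proof -
        have "(M b *\<^sub>v w) $ p = (\<Sum>r\<in>{0..<?n}. (if r = j then v $ p / w $ j else 0) * w $ r)"
          using that wc by (simp add: M_def scalar_prod_def)
        also have "\<dots> = (\<Sum>r\<in>{0..<?n}. if r = j then v $ p else 0)"
          using j by (intro sum.cong) auto
        also have "\<dots> = v $ p" using j by simp
        finally show ?thesis .
      qed
      then have "emat x b *\<^sub>v w = v"
        unfolding x using v by (intro eq_vecI) (simp_all add: M_def)
      moreover have "block_act F b (q x) w \<in> W" using W w(1) carrier by blast
      ultimately show ?thesis by (simp add: block_act_def F)
    qed
    then have "W = carrier_vec ?n" using sub(1) by blast
    then show ?thesis by (simp add: module_vec_simps)
  qed (simp add: module_vec_simps)
qed (rule block_left_module)

end

lemma U2_block_simple: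
  "b \<in> blocks d \<Longrightarrow> is_simple_module (U2 d) (block_space b) (block_act (wedderburn d) b)"
  by (rule block_simple[where q = "U2_proj d" and d = d]) (simp_all add: U2_carrier U2_proj_ops
      wedderburn_U2_proj)

lemma Umir_block_simple:
  "b \<in> blocks d \<Longrightarrow> is_simple_module Umir (block_space b) (block_act (wedderburn d \<circ> U2_class d) b)"
  by (rule block_simple[where q = mir_class and d = d])
    (simp_all add: Umir_carrier mir_class_ops wedderburn_U2_proj flip: U2_proj_def)

lemma block_act_gen:
  assumes "b \<in> blocks d" "j < block_size b"
  shows "block_act (wedderburn d \<circ> U2_class d) b (mir_class (fgen g)) (unit_vec (block_size b) j)
    = vec (block_size b) (\<lambda>i. Poly_Mapping.lookup (model_col g b j) (b, i))"
proof -
  have "(wedderburn d \<circ> U2_class d) (mir_class (fgen g)) b = emat (fgen g) b"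
    using wedderburn_U2_proj[of d "fgen g"] assms by (simp add: U2_proj_def)
  then show ?thesis
    using assms by (intro eq_vecI) (auto simp: block_act_def emat_def entry_fgen)
qed

lemma unit_vecs_block_basis: "vectorspace.basis class_ring (block_space b) (unit_vec (block_size b) `
    {..<block_size b})"
proof -
  interpret vec_space "TYPE(K)" "block_size b" .
  have eq: "set (unit_vecs (block_size b)) = unit_vec (block_size b) ` {..<block_size b}"
    by (auto simp: unit_vecs_def)
  from unit_vecs_basis show ?thesis unfolding eq .
qed

lemma unit_vec_inj: "inj_on (unit_vec n :: nat \<Rightarrow> K vec) {..<n}"
proof (rule inj_onI)
  fix i j assume ij: "i \<in> {..<n}" "j \<in> {..<n}" and eq: "(unit_vec n i :: K vec) = unit_vec n j"
  have "(unit_vec n i :: K vec) $ i = unit_vec n j $ i" using eq by simp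
  then show "i = j" using ij by (auto split: if_splits)
qed

lemma is_Lplus_block:
  assumes b: "b \<in> blocks d" "block_size b = m + 1" "\<And>g i. model_col g b i = colL (int m) \<delta> (uv b) g (int i)"
  shows "is_Lplus m \<delta> (block_space b) (block_act (wedderburn d \<circ> U2_class d) b)"
  unfolding is_Lplus_def
proof (intro conjI exI[of _ "unit_vec (block_size b)"] ballI)
  let ?n = "block_size b" and ?act = "block_act (wedderburn d \<circ> U2_class d) b"
  have n: "{0..m} = {..<?n}" using b(2) by auto
  show "is_left_module Umir (block_space b) ?act" using Umir_block_simple[OF b(1)]
      by (simp add: is_simple_module_def)
  show "inj_on (unit_vec ?n :: nat \<Rightarrow> K vec) {0..m}" unfolding n by (rule unit_vec_inj)
  show "vectorspace.basis class_ring (block_space b) (unit_vec ?n ` {0..m})" unfolding n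
      by (rule unit_vecs_block_basis)
  fix i assume "i \<in> {0..m}"
  then have i: "i < ?n" "i \<le> m" using b(2) by auto
  show "?act (mir_class Fk) (unit_vec ?n i) = (vv powi (int m - 2 * int i)) \<odot>\<^bsub>block_space b\<^esub> unit_vec ?n i"
    unfolding block_act_gen[OF b(1) i(1)] b(3) module_vec_simps
    by (rule eq_vecI) (use i in \<open>auto simp: lookup_uv\<close>)
  show "?act (mir_class Ff) (unit_vec ?n i) = (if i = m then \<zero>\<^bsub>block_space b\<^esub> else qint (int i + 1)
      \<odot>\<^bsub>block_space b\<^esub> unit_vec ?n (i + 1))"
    unfolding block_act_gen[OF b(1) i(1)] b(3) module_vec_simps
    by (rule eq_vecI) (use i b(2) in \<open>auto simp: lookup_uv\<close>)
  show "?act (mir_class Fe) (unit_vec ?n i) = (if i = 0 then \<zero>\<^bsub>block_space b\<^esub> else qint (int m - int i +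
      1) \<odot>\<^bsub>block_space b\<^esub> unit_vec ?n (i - 1))"
    unfolding block_act_gen[OF b(1) i(1)] b(3) module_vec_simps
    by (rule eq_vecI) (use i b(2) in \<open>auto simp: lookup_uv\<close>)
next
  let ?n = "block_size b" and ?act = "block_act (wedderburn d \<circ> U2_class d) b"
  fix w assume "w \<in> carrier (block_space b)"
  then have w: "w \<in> carrier_vec ?n" by (simp add: module_vec_simps)
  have "(wedderburn d \<circ> U2_class d) (mir_class Fl) b = emat Fl b"
    using wedderburn_U2_proj[of d Fl] b(1) by (simp add: U2_proj_def)
  moreover have "emat Fl b = \<delta> \<cdot>\<^sub>m 1\<^sub>m ?n"
    by (rule eq_matI) (auto simp: emat_def entry_fgen b(3) lookup_uv)
  ultimately show "?act (mir_class Fl) w = \<delta> \<odot>\<^bsub>block_space b\<^esub> w"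
    using w by (simp add: block_act_def module_vec_simps smult_mat_vec[OF one_carrier_mat])
qed

lemma is_Lplus01_block:
  assumes b: "B01 m \<in> blocks d"
  shows "is_Lplus01 m (block_space (B01 m)) (block_act (wedderburn d \<circ> U2_class d) (B01 m))"
proof -
  let ?b = "B01 m" let ?n = "block_size ?b" and ?act = "block_act (wedderburn d \<circ> U2_class d) ?b"
  let ?p = "\<lambda>(i, \<epsilon>). if \<epsilon> = (0::nat) then i else m + i - 1"
  let ?u = "\<lambda>x. (unit_vec ?n (?p x) :: K vec)"
  have bij: "bij_betw ?p (Lplus01_index m) {..<?n}"
  proof (rule bij_betwI[where g = "\<lambda>j. if j < m then (j, 0) else (j - m + 1, 1)"])
  qed (auto simp: Lplus01_index_def split: if_splits)
  have inj: "inj_on ?u (Lplus01_index m)"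
    using comp_inj_on[OF bij_betw_imp_inj_on[OF bij]] unit_vec_inj[of ?n] bij_betw_imp_surj_on[OF bij]
        by (simp add: o_def)
  have img: "?u ` Lplus01_index m = unit_vec ?n ` {..<?n}"
    using bij_betw_imp_surj_on[OF bij] by (metis image_image)
  have kl: "?act (mir_class Fk) (?u (i, \<epsilon>)) = (vv powi (int m - 2 * int i)) \<odot>\<^bsub>block_space ?b\<^esub> ?u (i, \<epsilon>)"
    "?act (mir_class Fl) (?u (i, \<epsilon>)) = of_nat \<epsilon> \<odot>\<^bsub>block_space ?b\<^esub> ?u (i, \<epsilon>)"
    if "(i, \<epsilon>) \<in> Lplus01_index m" for i \<epsilon>
  proof -
    have p: "?p (i, \<epsilon>) < ?n" using bij_betwE[OF bij] that by auto
    show "?act (mir_class Fk) (?u (i, \<epsilon>)) = (vv powi (int m - 2 * int i)) \<odot>\<^bsub>block_space ?b\<^esub> ?u (i, \<epsilon>)"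
      unfolding block_act_gen[OF b p] module_vec_simps
      by (rule eq_vecI) (use that in \<open>auto simp: Lplus01_index_def lookup_zv lookup_yv of_nat_diff\<close>)
    show "?act (mir_class Fl) (?u (i, \<epsilon>)) = of_nat \<epsilon> \<odot>\<^bsub>block_space ?b\<^esub> ?u (i, \<epsilon>)"
      unfolding block_act_gen[OF b p] module_vec_simps
      by (rule eq_vecI) (use that in \<open>auto simp: Lplus01_index_def lookup_zv lookup_yv of_nat_diff\<close>)
  qed
  show ?thesis
    unfolding is_Lplus01_def
  proof (intro conjI exI[of _ ?u])
    show "is_simple_module Umir (block_space ?b) ?act" by (rule Umir_block_simple[OF b])
    show "vectorspace.basis class_ring (block_space ?b) (?u ` Lplus01_index m)"
      unfolding img by (rule unit_vecs_block_basis)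
    show "\<forall>(i, \<epsilon>)\<in>Lplus01_index m.
        ?act (mir_class Fk) (?u (i, \<epsilon>)) = (vv powi (int m - 2 * int i)) \<odot>\<^bsub>block_space ?b\<^esub> ?u (i, \<epsilon>) \<and>
        ?act (mir_class Fl) (?u (i, \<epsilon>)) = of_nat \<epsilon> \<odot>\<^bsub>block_space ?b\<^esub> ?u (i, \<epsilon>)"
      using kl unfolding prod.case by (auto simp only: prod.case)
  qed (rule inj)
qed

lemma I_set_negative: "t < 0 \<Longrightarrow> I_set t = {}"
  by (auto simp: I_set_def)

lemma I_set_step: assumes "t \<ge> -2" shows "I_set (t + 2) = insert (nat (t + 2)) (I_set t)"
proof -
  have "int m \<le> t + 2 \<and> int m mod 2 = (t + 2) mod 2 \<longleftrightarrow> m = nat (t + 2) \<or> int m \<le> t \<and> int m mod 2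
      = t mod 2" for m
  proof -
    have nat: "m = nat (t + 2) \<longleftrightarrow> int m = t + 2" using assms by linarith
    consider "int m \<le> t" | "int m = t + 1" | "int m = t + 2" | "int m > t + 2" by linarith
    then show ?thesis
    proof cases
      case 2
      have "(t + 1) mod 2 \<noteq> t mod 2" by presburger
      then show ?thesis unfolding nat 2 by simp
    qed (simp_all add: nat)
  qed
  then show ?thesis unfolding I_set_def insert_def by (simp only: mem_Collect_eq Un_def)
qed

text \<open>Passing from \<open>c\<close> to \<open>c + 2\<close> adds \<open>(c+3)\<^sup>2 + 4 (c+2)\<^sup>2 + (c+1)\<^sup>2\<close>, which is \<open>(c+3)\<^sup>3 -
  (c+1)\<^sup>3\<close>. The block \<open>B01 0\<close>, which is excluded, would have size zero and may be counted as well.\<close>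

lemma sum_block_size: "(\<Sum>b\<in>blocks d. block_size b ^ 2) = (d + 1) ^ 3"
proof -
  let ?A = "\<lambda>d. (\<Sum>m\<in>I_set (int d). (m + 1)\<^sup>2) + (\<Sum>m\<in>I_set (int d). (2 * m)\<^sup>2) + (\<Sum>m\<in>I_set (int d - 2).
      (m + 1)\<^sup>2)"
  have "(\<Sum>b\<in>blocks d. block_size b ^ 2) = (\<Sum>b\<in>B1 ` I_set (int d). block_size b ^ 2)
      + (\<Sum>b\<in>B01 ` {m \<in> I_set (int d). m \<ge> 1}. block_size b ^ 2) + (\<Sum>b\<in>B0 ` I_set (int d - 2). block_size
          b ^ 2)"
  proof -
    have "(\<Sum>b\<in>A \<union> B \<union> C. g b) = sum g A + sum g B + sum g C"
      if "finite A" "finite B" "finite C" "A \<inter> B = {}" "(A \<union> B) \<inter> C = {}" for A B C and g :: "block \<Rightarrow> nat"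
      using that by (simp add: sum.union_disjoint)
    then show ?thesis unfolding blocks_def by (rule trans) (auto simp: finite_I_set)
  qed
  also have "\<dots> = (\<Sum>m\<in>I_set (int d). (m + 1)\<^sup>2) + (\<Sum>m\<in>{m \<in> I_set (int d). m \<ge> 1}. (2 * m)\<^sup>2) +
      (\<Sum>m\<in>I_set (int d - 2). (m + 1)\<^sup>2)"
    by (simp add: sum.reindex inj_on_def)
  also have "(\<Sum>m\<in>{m \<in> I_set (int d). m \<ge> 1}. (2 * m)\<^sup>2) = (\<Sum>m\<in>I_set (int d). (2 * m)\<^sup>2)"
    by (rule sum.mono_neutral_left) (auto simp: finite_I_set)
  finally have eq: "(\<Sum>b\<in>blocks d. block_size b ^ 2) = ?A d" .
  have "?A d = (d + 1) ^ 3"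
  proof (induction d rule: less_induct)
    case (less d)
    show ?case
    proof (cases "d < 2")
      case True
      have "I_set 0 = {0}" "I_set 1 = {1}"
        using I_set_step[of "-2"] I_set_step[of "-1"] by (simp_all add: I_set_negative)
      moreover have "d = 0 \<or> d = 1" using True by auto
      ultimately show ?thesis by (elim disjE) (simp_all add: I_set_negative power2_eq_square power3_eq_cube)
    next
      case False
      then obtain c where c: "d = c + 2" by (metis add.commute le_Suc_ex not_less)
      have 1: "I_set (int d) = insert (c + 2) (I_set (int c))" "I_set (int d - 2)
          = insert c (I_set (int c - 2))"
        using I_set_step[of "int c"] I_set_step[of "int c - 2"]
            by (simp_all add: c nat_add_distrib add.commute)
      have 2: "c + 2 \<notin> I_set (int c)" "c \<notin> I_set (int c - 2)" by (auto simp: I_set_def)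
      have "?A d = ?A c + (c + 3)\<^sup>2 + (2 * (c + 2))\<^sup>2 + (c + 1)\<^sup>2"
        unfolding 1 using 2 by (simp add: finite_I_set) (simp add: power2_eq_square algebra_simps)
      also have "?A c = (c + 1) ^ 3" using less[of c] c by simp
      finally show ?thesis by (simp add: c power2_eq_square power3_eq_cube algebra_simps)
    qed
  qed
  with eq show ?thesis by simp
qed

text \<open>The entries of all blocks, listed as one vector by an enumeration \<open>h\<close> of the positions,
  identify \<open>U(2,d)\<close> with a coordinate space. The map is taken in the direction from the coordinate
  space, whose dimension is known.\<close>

lemma U2_dim:
  "vectorspace.fin_dim class_ring (U2 d)" "vectorspace.dim class_ring (U2 d) = (d + 1) ^ 3"
proof -
  let ?T = "SIGMA b:blocks d. {..<block_size b} \<times> {..<block_size b}"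
  define N where "N = card ?T"
  have N: "N = (d + 1) ^ 3"
  proof -
    have "N = (\<Sum>b\<in>blocks d. card ({..<block_size b} \<times> {..<block_size b}))"
      unfolding N_def by (rule card_SigmaI) (simp_all add: finite_blocks)
    also have "\<dots> = (\<Sum>b\<in>blocks d. block_size b ^ 2)"
      by (simp only: card_cartesian_product card_lessThan power2_eq_square)
    finally show ?thesis by (simp only: sum_block_size)
  qed
  have "finite ?T" by (intro finite_SigmaI finite_blocks) auto
  then obtain h where h: "bij_betw h {..<N} ?T"
    unfolding N_def lessThan_atLeast0 by (rule exE[OF ex_bij_betw_nat_finite])
  define ent where "ent x s = (case s of (b, i, j) \<Rightarrow> entry x b i j)" for x s
  define co where "co x = vec N (\<lambda>t. ent x (h t))" for x
  have co_iff: "co x = co y \<longleftrightarrow> U2_proj d x = U2_proj d y" for x y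
  proof -
    have "co x = co y \<longleftrightarrow> (\<forall>t\<in>{..<N}. ent x (h t) = ent y (h t))"
      by (simp add: co_def vec_eq_iff Ball_def)
    also have "\<dots> \<longleftrightarrow> (\<forall>s\<in>h ` {..<N}. ent x s = ent y s)"
      by (simp only: ball_simps)
    also have "\<dots> \<longleftrightarrow> (\<forall>s\<in>?T. ent x s = ent y s)"
      by (simp only: bij_betw_imp_surj_on[OF h])
    also have "\<dots> \<longleftrightarrow> U2_proj d x = U2_proj d y"
      unfolding U2_proj_eq_iff U2_kernel_eq_annihilator annihilator_def mem_Collect_eq entry_diff
          ent_def by auto
    finally show ?thesis .
  qed
  have co_surj: "\<exists>x. co x = w" if "w \<in> carrier_vec N" for w
  proof -
    obtain x where x: "\<forall>b\<in>blocks d. \<forall>i<block_size b. \<forall>j<block_size b. entry x b i j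
        = w $ (inv_into {..<N} h (b, i, j))"
      using entries_surjective[of d "\<lambda>b i j. w $ (inv_into {..<N} h (b, i, j))"] by blast
    have "ent x (h t) = w $ t" if t: "t < N" for t
    proof -
      obtain b i j where s: "h t = (b, i, j)" by (cases "h t") auto
      have "h t \<in> ?T" using bij_betwE[OF h] t by blast
      then have "entry x b i j = w $ (inv_into {..<N} h (h t))" using x unfolding s by simp
      also have "inv_into {..<N} h (h t) = t"
        by (rule inv_into_f_f[OF bij_betw_imp_inj_on[OF h]]) (use t in simp)
      finally show ?thesis by (simp add: ent_def s)
    qed
    then have "co x = w" using that by (intro eq_vecI) (simp_all add: co_def)
    then show ?thesis by blast
  qed
  define G where "G w = U2_proj d (SOME x. co x = w)" for w
  have G_co: "G (co x) = U2_proj d x" for x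
  proof -
    have "co (SOME y. co y = co x) = co x" by (rule someI[of _ x]) simp
    then show ?thesis by (simp add: G_def co_iff)
  qed
  have co_ops: "co x + co y = co (x + y)" "c \<cdot>\<^sub>v co x = co (scal c * x)" for x y c
    by (rule eq_vecI; simp add: co_def ent_def entry_add entry_scal split: prod.splits)+
  interpret Vn: vec_space "TYPE(K)" N .
  have vsU: "vectorspace class_ring (U2 d)" using U2_is_algebra by (simp add: is_algebra_def)
  have vsV: "vectorspace class_ring (module_vec TYPE(K) N)" by (rule Vn.vectorspace_axioms)
  have range: "carrier_vec N = range co"
  proof
    show "carrier_vec N \<subseteq> range co" using co_surj by blast
  qed (auto simp: co_def)
  have "G \<in> LinearCombinations.module_hom class_ring (module_vec TYPE(K) N) (U2 d)"
    unfolding LinearCombinations.module_hom_def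
    by (auto simp: module_vec_simps range G_co co_ops U2_proj_ops U2_carrier)
  then have lm: "linear_map class_ring (module_vec TYPE(K) N) (U2 d) G"
    unfolding linear_map_def mod_hom_def mod_hom_axioms_def using vsU vsV by (auto simp: vectorspace_def)
  have inj: "inj_on G (carrier (module_vec TYPE(K) N))"
    by (auto simp: module_vec_simps range inj_on_def G_co co_iff)
  have surj: "G ` carrier (module_vec TYPE(K) N) = carrier (U2 d)"
    by (auto simp: module_vec_simps range G_co U2_carrier image_iff)
  have fd: "vectorspace.fin_dim class_ring (module_vec TYPE(K) N)" using Vn.fin_dim by simp
  show "vectorspace.fin_dim class_ring (U2 d)"
    by (rule linear_map.rank_nullity_main(2)[OF lm fd surj])
  show "vectorspace.dim class_ring (U2 d) = (d + 1) ^ 3"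
    using linear_map.dim_eq[OF lm fd inj surj] Vn.dim_is_n N by simp
qed

theorem theorem5p4:
  fixes d :: nat
  shows "is_algebra (U2 d) \<and>
    (\<exists>\<phi> \<in> algebra_iso (U2 d) (direct_sum_algebra (blocks d) (\<lambda>b. Mat (block_size b))).
       (\<forall>b\<in>blocks d. is_simple_module (U2 d) (block_space b) (block_act \<phi> b)) \<and>
       (\<forall>m\<in>I_set (int d).
          is_Lplus m 1 (block_space (B1 m)) (block_act (\<phi> \<circ> U2_class d) (B1 m))) \<and>
       (\<forall>m\<in>I_set (int d). m \<ge> 1 \<longrightarrow>
          is_Lplus01 m (block_space (B01 m)) (block_act (\<phi> \<circ> U2_class d) (B01 m))) \<and>
       (\<forall>m\<in>I_set (int d - 2).
          is_Lplus m 0 (block_space (B0 m)) (block_act (\<phi> \<circ> U2_class d) (B0 m)))) \<and>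
    vectorspace.fin_dim class_ring (U2 d) \<and>
    vectorspace.dim class_ring (U2 d) = (d + 1) ^ 3"
proof (intro conjI bexI[OF _ wedderburn_iso] ballI impI)
  show "is_algebra (U2 d)" by (rule U2_is_algebra)
  show "is_simple_module (U2 d) (block_space b) (block_act (wedderburn d) b)" if "b \<in> blocks d" for b
    by (rule U2_block_simple[OF that])
  show "is_Lplus m 1 (block_space (B1 m)) (block_act (wedderburn d \<circ> U2_class d) (B1 m))"
      if "m \<in> I_set (int d)" for m
    by (rule is_Lplus_block) (use that in \<open>auto simp: blocks_def\<close>)
  show "is_Lplus01 m (block_space (B01 m)) (block_act (wedderburn d \<circ> U2_class d) (B01 m))"
      if "m \<in> I_set (int d)" "1 \<le> m" for m
    by (rule is_Lplus01_block) (use that in \<open>auto simp: blocks_def\<close>)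
  show "is_Lplus m 0 (block_space (B0 m)) (block_act (wedderburn d \<circ> U2_class d) (B0 m))"
      if "m \<in> I_set (int d - 2)" for m
    by (rule is_Lplus_block) (use that in \<open>auto simp: blocks_def\<close>)
qed (rule U2_dim)+

end
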